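(* Let $n\ge1$ be an integer and let $\mathcal L$ be a linear operator generating an analytic semigroup $\{e^{-t\mathcal L}\}_{t>0}$ on $L^2(\mathbb R^n)$ whose kernel $p_t(x,y)$ satisfies a Gaussian upper bound: there are constants $C_0,A>0$ with $|p_t(x,y)|\le C_0\,t^{-n/2}e^{-A|x-y|^2/t}$ for all $x,y\in\mathbb R^n$ and $t>0$. Let $0<\gamma<n$, $1<p<n/\gamma$, $1/q=1/p-\gamma/n$ and $w\in A_{p,q}$. Assume that $p\le\alpha<\beta<s\le\infty$ with $1/\beta=1/\alpha-\gamma/n$, and that $\mu\in\Delta_2$. Then the generalized fractional integral $\mathcal L^{-\gamma/2}$ is bounded from $(L^p,L^s)^{\alpha}(w^p,w^q;\mu)$ into $(L^q,L^s)^{\beta}(w^q;\mu)$; that is, there is a constant $C>0$ independent of $f$ such that $\|\mathcal L^{-\gamma/2}f\|_{(L^q,L^s)^{\beta}(w^q;\mu)}\le C\|f\|_{(L^p,L^s)^{\alpha}(w^p,w^q;\mu)}$ for all $f\in(L^p,L^s)^{\alpha}(w^p,w^q;\mu)$.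
   Context: A weight is a non-negative locally integrable function on $\mathbb R^n$; for a weight $w$ and measurable $E$, $w(E)=\int_E w(x)\,dx$, and $w^q(E)=\int_E w(x)^q\,dx$. $B(y,r)$ is the open Euclidean ball with center $y$ and radius $r$; $p'=p/(p-1)$. The semigroup acts by $e^{-t\mathcal L}f(x)=\int_{\mathbb R^n}p_t(x,y)f(y)\,dy$. Generalized fractional integral: $\mathcal L^{-\gamma/2}f(x)=\frac1{\Gamma(\gamma/2)}\int_0^\infty e^{-t\mathcal L}f(x)\,t^{\gamma/2-1}\,dt$, i.e. the integral operator with kernel $\mathcal K_\gamma(x,y)=\frac1{\Gamma(\gamma/2)}\int_0^\infty p_t(x,y)t^{\gamma/2-1}\,dt$. For $1<p,q<\infty$, $w\in A_{p,q}$ means: there is $C>0$ such that for every ball $B$, $\left(\frac1{|B|}\int_B w^q\,dx\right)^{1/q}\left(\frac1{|B|}\int_B w^{-p'}\,dx\right)^{1/p'}\le C$. $\mu\in\Delta_2$ means that $\mu$ is a weight and there is $C>0$ with $\mu(2B)\le C\mu(B)$ for every ball $B$ ($2B$ is the concentric ball with twice the radius). Weighted amalgam spaces: for $1\le p\le\alpha\le s\le\infty$ and weights $\nu,w,\mu$, the space $(L^p,L^s)^{\alpha}(\nu,w;\mu)$ consists of all locally integrable $f$ with $$\|f\|_{(L^p,L^s)^{\alpha}(\nu,w;\mu)}:=\sup_{r>0}\Big\|w(B(y,r))^{1/\alpha-1/p-1/s}\,\|f\chi_{B(y,r)}\|_{L^p(\nu)}\Big\|_{L^s(\mu)}<\infty,$$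 where the $L^s(\mu)$-norm (norm with respect to $\mu(y)\,dy$, usual modification when $s=\infty$) is taken in $y$, and $\|g\|_{L^p(\nu)}=(\int|g|^p\nu\,dx)^{1/p}$. One writes $(L^p,L^s)^{\alpha}(w;\mu):=(L^p,L^s)^{\alpha}(w,w;\mu)$. *)

theory Defs
  imports "HOL-Analysis.Analysis" "HOL-Probability.Essential_Supremum"
begin

section \<open>Operators and semigroups on the complex space L2(R^n)\<close>

text \<open>
  Elements of \<open>L2\<close> are represented by functions, equality in \<open>L2\<close> being equality
  almost everywhere.  Accordingly, identities between elements of \<open>L2\<close> are stated with \<open>aeq\<close>.
\<close>

definition aeq :: "(real^'n \<Rightarrow> complex) \<Rightarrow> (real^'n \<Rightarrow> complex) \<Rightarrow> bool" where
  "aeq f g \<longleftrightarrow> (AE x in lebesgue. f x = g x)"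

definition L2 :: "(real^'n \<Rightarrow> complex) set" where
  "L2 = {f \<in> borel_measurable lebesgue. integrable lebesgue (\<lambda>x. (norm (f x))\<^sup>2)}"

definition l2norm :: "(real^'n \<Rightarrow> complex) \<Rightarrow> real" where
  "l2norm f = sqrt (LINT x|lebesgue. (norm (f x))\<^sup>2)"

text \<open>A linear operator in \<open>L2\<close> with domain \<open>D\<close>; its values outside \<open>D\<close> are irrelevant.\<close>

definition linear_operator ::
  "(real^'n \<Rightarrow> complex) set \<Rightarrow> ((real^'n \<Rightarrow> complex) \<Rightarrow> (real^'n \<Rightarrow> complex)) \<Rightarrow> bool" where
  "linear_operator D S \<longleftrightarrow>
     D \<subseteq> L2 \<and> (\<lambda>_. 0) \<in> D \<and>
     (\<forall>f\<in>D. S f \<in> L2) \<and>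
     (\<forall>f\<in>D. \<forall>g\<in>L2. aeq f g \<longrightarrow> g \<in> D \<and> aeq (S f) (S g)) \<and>
     (\<forall>f\<in>D. \<forall>g\<in>D. (\<lambda>x. f x + g x) \<in> D \<and> aeq (S (\<lambda>x. f x + g x)) (\<lambda>x. S f x + S g x)) \<and>
     (\<forall>c. \<forall>f\<in>D. (\<lambda>x. c * f x) \<in> D \<and> aeq (S (\<lambda>x. c * f x)) (\<lambda>x. c * S f x))"

definition bounded_operator ::
  "((real^'n \<Rightarrow> complex) \<Rightarrow> (real^'n \<Rightarrow> complex)) \<Rightarrow> bool" where
  "bounded_operator S \<longleftrightarrow> linear_operator L2 S \<and> (\<exists>M. \<forall>f\<in>L2. l2norm (S f) \<le> M * l2norm f)"

definition sector :: "real \<Rightarrow> complex set" where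
  "sector \<theta> = {z. z \<noteq> 0 \<and> \<bar>Arg z\<bar> < \<theta>}"

text \<open>
  Analyticity is complex differentiability in the operator norm of bounded operators on \<open>L2\<close>:
  the operator \<open>S\<close> below is the derivative of \<open>T\<close> at \<open>z\<close>.
\<close>

definition analytic_semigroup ::
  "(complex \<Rightarrow> (real^'n \<Rightarrow> complex) \<Rightarrow> (real^'n \<Rightarrow> complex)) \<Rightarrow> bool" where
  "analytic_semigroup T \<longleftrightarrow> (\<exists>\<theta>. 0 < \<theta> \<and> \<theta> \<le> pi / 2 \<and>
     (\<forall>z\<in>sector \<theta>. bounded_operator (T z)) \<and>
     (\<forall>z\<in>sector \<theta>. \<forall>w\<in>sector \<theta>. \<forall>f\<in>L2. aeq (T (z + w) f) (T z (T w f))) \<and>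
     (\<forall>f\<in>L2. ((\<lambda>z. l2norm (\<lambda>x. T z f x - f x)) \<longlongrightarrow> 0) (at 0 within sector \<theta>)) \<and>
     (\<forall>z\<in>sector \<theta>. \<exists>S. bounded_operator S \<and>
        (\<forall>e>0. \<forall>\<^sub>F w in at z. \<forall>f\<in>L2.
           l2norm (\<lambda>x. (T w f x - T z f x) / (w - z) - S f x) \<le> e * l2norm f)))"

text \<open>
  The sign convention is that of \<open>exp (-t L)\<close>: the infinitesimal generator of the semigroup in
  the usual sense is \<open>-L\<close>, with its maximal domain \<open>D\<close>.
\<close>

definition generates_analytic_semigroup ::
  "(real^'n \<Rightarrow> complex) set \<Rightarrow> ((real^'n \<Rightarrow> complex) \<Rightarrow> (real^'n \<Rightarrow> complex)) \<Rightarrow>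
   (complex \<Rightarrow> (real^'n \<Rightarrow> complex) \<Rightarrow> (real^'n \<Rightarrow> complex)) \<Rightarrow> bool" where
  "generates_analytic_semigroup D L T \<longleftrightarrow>
     analytic_semigroup T \<and>
     D = {f \<in> L2. \<exists>g\<in>L2.
            ((\<lambda>t. l2norm (\<lambda>x. (f x - T (of_real t) f x) / of_real t - g x)) \<longlongrightarrow> 0) (at_right 0)} \<and>
     (\<forall>f\<in>D. L f \<in> L2 \<and>
        ((\<lambda>t. l2norm (\<lambda>x. (f x - T (of_real t) f x) / of_real t - L f x)) \<longlongrightarrow> 0) (at_right 0))"

definition has_kernel ::
  "(complex \<Rightarrow> (real^'n \<Rightarrow> complex) \<Rightarrow> (real^'n \<Rightarrow> complex)) \<Rightarrow>
   (real \<Rightarrow> real^'n \<Rightarrow> real^'n \<Rightarrow> complex) \<Rightarrow> bool" where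
  "has_kernel T p \<longleftrightarrow>
     (\<lambda>(t, x, y). p t x y) \<in> borel_measurable (lebesgue_on ({0<..} \<times> UNIV)) \<and>
     (\<forall>t>0. (\<lambda>(x, y). p t x y) \<in> borel_measurable lebesgue) \<and>
     (\<forall>t>0. \<forall>f\<in>L2. aeq (T (of_real t) f) (\<lambda>x. LINT y|lebesgue. p t x y * f y))"

definition gaussian_upper_bound :: "(real \<Rightarrow> real^'n \<Rightarrow> real^'n \<Rightarrow> complex) \<Rightarrow> bool" where
  "gaussian_upper_bound p \<longleftrightarrow> (\<exists>C\<^sub>0>0. \<exists>A>0. \<forall>t>0. \<forall>x y.
     norm (p t x y) \<le> C\<^sub>0 * t powr (- real CARD('n) / 2) * exp (- A * (norm (x - y))\<^sup>2 / t))"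


section \<open>The generalized fractional integral\<close>

definition semigroup_integral ::
  "(real \<Rightarrow> real^'n \<Rightarrow> real^'n \<Rightarrow> complex) \<Rightarrow> real \<Rightarrow> (real^'n \<Rightarrow> complex) \<Rightarrow> real^'n \<Rightarrow> complex" where
  "semigroup_integral p t f x = (LINT y|lebesgue. p t x y * f y)"

definition fractional_integral ::
  "(real \<Rightarrow> real^'n \<Rightarrow> real^'n \<Rightarrow> complex) \<Rightarrow> real \<Rightarrow> (real^'n \<Rightarrow> complex) \<Rightarrow> real^'n \<Rightarrow> complex" where
  "fractional_integral p \<gamma> f x =
     complex_of_real (1 / Gamma (\<gamma> / 2)) *
     (LINT t:{0<..}|lebesgue. semigroup_integral p t f x * complex_of_real (t powr (\<gamma> / 2 - 1)))"

text \<open>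
  Since a divergent integral has the value 0 in the library, convergence of the integrals defining
  \<open>fractional_integral p \<gamma> f x\<close> is a separate predicate.
\<close>

definition fractional_integral_converges ::
  "(real \<Rightarrow> real^'n \<Rightarrow> real^'n \<Rightarrow> complex) \<Rightarrow> real \<Rightarrow> (real^'n \<Rightarrow> complex) \<Rightarrow> real^'n \<Rightarrow> bool" where
  "fractional_integral_converges p \<gamma> f x \<longleftrightarrow>
     (AE t in lebesgue. 0 < t \<longrightarrow> integrable lebesgue (\<lambda>y. p t x y * f y)) \<and>
     set_integrable lebesgue {0<..}
       (\<lambda>t. semigroup_integral p t f x * complex_of_real (t powr (\<gamma> / 2 - 1)))"


section \<open>Weights\<close>

definition locally_integrable :: "(real^'n \<Rightarrow> 'b::euclidean_space) \<Rightarrow> bool" where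
  "locally_integrable f \<longleftrightarrow> (\<forall>K. compact K \<longrightarrow> f absolutely_integrable_on K)"

definition weight :: "(real^'n \<Rightarrow> real) \<Rightarrow> bool" where
  "weight w \<longleftrightarrow> (\<forall>x. 0 \<le> w x) \<and> locally_integrable w"

text \<open>\<open>emeasure (weighted w) E\<close> is \<open>w(E)\<close>, and \<open>emeasure (weighted (\<lambda>x. w x powr q)) E\<close> is \<open>w^q(E)\<close>.\<close>

definition weighted :: "(real^'n \<Rightarrow> real) \<Rightarrow> (real^'n) measure" where
  "weighted w = density lebesgue (\<lambda>x. ennreal (w x))"

text \<open>Real powers on \<open>[0,\<infinity>]\<close>, with \<open>0\<close> and \<open>\<infinity>\<close> exchanged by negative exponents.\<close>

definition epowr :: "ennreal \<Rightarrow> real \<Rightarrow> ennreal" where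
  "epowr x a =
     (if a = 0 then 1
      else if x = 0 then (if a > 0 then 0 else \<infinity>)
      else if x = \<infinity> then (if a > 0 then \<infinity> else 0)
      else ennreal (enn2real x powr a))"

text \<open>
  Positivity almost everywhere is implicit in the Muckenhoupt-type condition, as the average of
  \<open>w^(-p')\<close> has to be finite; it must be explicit here because \<open>0 powr a = 0\<close> for all \<open>a\<close>.
\<close>

definition A_weight :: "real \<Rightarrow> real \<Rightarrow> (real^'n \<Rightarrow> real) \<Rightarrow> bool" where
  "A_weight p q w \<longleftrightarrow>
     weight w \<and> (AE x in lebesgue. 0 < w x) \<and>
     (\<exists>C::real. 0 < C \<and> (\<forall>y r. 0 < r \<longrightarrow>
        epowr (emeasure (weighted (\<lambda>x. w x powr q)) (ball y r) / emeasure lebesgue (ball y r)) (1 / q) *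
        epowr (emeasure (weighted (\<lambda>x. w x powr (- (p / (p - 1))))) (ball y r)
                 / emeasure lebesgue (ball y r)) (1 / (p / (p - 1)))
        \<le> ennreal C))"

text \<open>
  The weight zero, for which the doubling inequality is void and every amalgam norm with
  respect to \<open>\<mu>\<close> vanishes, is excluded.
\<close>

definition doubling_weight :: "(real^'n \<Rightarrow> real) \<Rightarrow> bool" where
  "doubling_weight \<mu> \<longleftrightarrow>
     weight \<mu> \<and> \<not> (AE x in lebesgue. \<mu> x = 0) \<and>
     (\<exists>C::real. 0 < C \<and> (\<forall>y r. 0 < r \<longrightarrow>
        emeasure (weighted \<mu>) (ball y (2 * r)) \<le> ennreal C * emeasure (weighted \<mu>) (ball y r)))"


section \<open>Weighted amalgam spaces\<close>

text \<open>The norm of \<open>L^s(M)\<close>, for functions with values in \<open>[0,\<infinity>]\<close> and \<open>1 \<le> s \<le> \<infinity>\<close>.\<close>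

definition Lnorm :: "ennreal \<Rightarrow> 'a measure \<Rightarrow> ('a \<Rightarrow> ennreal) \<Rightarrow> ennreal" where
  "Lnorm s M g =
     (if s = \<infinity> then esssup M g
      else epowr (\<integral>\<^sup>+ y. epowr (g y) (enn2real s) \<partial>M) (1 / enn2real s))"

text \<open>With \<open>1 / \<infinity> = 0\<close>, \<open>enn2real (1 / s)\<close> is the real number \<open>1/s\<close> for all \<open>1 \<le> s \<le> \<infinity>\<close>.\<close>

definition amalgam_norm ::
  "ennreal \<Rightarrow> ennreal \<Rightarrow> ennreal \<Rightarrow> (real^'n \<Rightarrow> real) \<Rightarrow> (real^'n \<Rightarrow> real) \<Rightarrow> (real^'n \<Rightarrow> real) \<Rightarrow>
   (real^'n \<Rightarrow> complex) \<Rightarrow> ennreal" where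
  "amalgam_norm p s \<alpha> \<nu> w \<mu> f =
     (SUP r\<in>{0<..}. Lnorm s (weighted \<mu>) (\<lambda>y.
        epowr (emeasure (weighted w) (ball y r)) (enn2real (1 / \<alpha>) - enn2real (1 / p) - enn2real (1 / s)) *
        Lnorm p (weighted \<nu>) (\<lambda>x. ennreal (norm (f x)) * indicator (ball y r) x)))"

definition amalgam_space ::
  "ennreal \<Rightarrow> ennreal \<Rightarrow> ennreal \<Rightarrow> (real^'n \<Rightarrow> real) \<Rightarrow> (real^'n \<Rightarrow> real) \<Rightarrow> (real^'n \<Rightarrow> real) \<Rightarrow>
   (real^'n \<Rightarrow> complex) set" where
  "amalgam_space p s \<alpha> \<nu> w \<mu> = {f. locally_integrable f \<and> amalgam_norm p s \<alpha> \<nu> w \<mu> f < \<infinity>}"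

end

theory Submission
  imports Defs
begin

text \<open>
  The Gaussian bound gives a pointwise bound of the fractional integral of f by the Riesz potential I
  of the absolute value of f, so everything reduces to I.  Around a ball B one splits f at 2B.  The local
  part is controlled by the Muckenhoupt-Wheeden inequality (I maps L^p(w^p) to L^q(w^q)).  On B, Hoelder's
  inequality and the A_{p,q} condition bound the far part by the sum over j of w^q(2^j B)^(-1/q) times the
  L^p(w^p) norm of f on 2^j B.  After multiplication by the weight factors of the amalgam norms, the j-th
  term carries (w^q(B) / w^q(2^j B))^(1/beta - 1/s), which decays geometrically by reverse doubling, and
  the sum is taken in L^s(mu) by convexity.

  The Muckenhoupt-Wheeden inequality is proved without dyadic cubes.  Let F_k(x) be the average of f over
  B(x, 2^k) and let kappa_m(x) be the largest k with F_k(x) > 2^m; then I f is at most a constant times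
  the sum over m of 2^m 2^(gamma kappa_m).  For each m the Vitali lemma selects disjoint balls B_j among
  the B(x, 2^kappa_m(x)).  By the weak type inequality at least half of B_j lies outside the level set of
  height 2^(m+N) of the maximal function, and these halves have bounded overlap in m.  They play the role
  of a sparse family: the bilinear form with kernel I is bounded by the maximal functions with respect to
  the doubling measures w^(-p') and w^q.
\<close>

section \<open>Powers, interpolation and countable sums\<close>

text \<open>Since 1/\<beta> - 1/q = 1/\<alpha> - 1/p, both amalgam norms carry the same power \<eta>
  - 1/q of w^q(B), where \<eta> = 1/\<beta> - 1/s. The condition \<beta> < s says that \<eta> is
  positive, and this is what makes the decay in j geometric.

  Half of B_j can stand for B_j because A_{p,q} forces a set that fills a fixed proportion of a ball
  in Lebesgue measure to carry a fixed proportion of both weights w^q and w^(-p').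

  The stopping scale kappa_m exists only for integrable f, whose averages tend to 0 uniformly as the
  radius grows. The norm inequality is therefore proved for integrable functions. This is enough,
  because it is applied to f cut off to 2B, which Hoelder's inequality makes integrable.

  Weights, functions and kernel are only Lebesgue measurable, which is too weak for sections and for
  joint measurability. They are replaced by Borel representatives, the weight by one that is
  positive everywhere. The analysis takes place over \<open>lborel\<close>, and the completion
  appears only where the given objects enter and leave.\<close>

lemma epowr_zero_exponent [simp]: "epowr x 0 = 1"
  by (simp add: epowr_def)

lemma epowr_zero [simp]: "a > 0 \<Longrightarrow> epowr 0 a = 0"
  by (simp add: epowr_def)

lemma epowr_top [simp]: "a > 0 \<Longrightarrow> epowr top a = top"
  by (simp add: epowr_def)

lemma epowr_ennreal: "x > 0 \<Longrightarrow> epowr (ennreal x) a = ennreal (x powr a)"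
  by (simp add: epowr_def)

lemma epowr_ennreal': "x \<ge> 0 \<Longrightarrow> a > 0 \<Longrightarrow> epowr (ennreal x) a = ennreal (x powr a)"
  by (cases "x = 0") (auto simp: epowr_ennreal)

lemma epowr_one [simp]: "epowr x 1 = x"
  by (cases x) (auto simp: epowr_ennreal')

lemma epowr_measurable [measurable]: "(\<lambda>x. epowr x a) \<in> borel_measurable borel"
  unfolding epowr_def by measurable

lemma epowr_mono: "0 \<le> a \<Longrightarrow> x \<le> y \<Longrightarrow> epowr x a \<le> epowr y a"
  by (cases x; cases y; cases "a = 0")
     (auto simp: epowr_ennreal' powr_mono2 ennreal_leI top_unique)

lemma epowr_mult: "0 < a \<Longrightarrow> epowr (x * y) a = epowr x a * epowr y a"
proof (cases x; cases y)
  fix r s :: real assume "0 < a" "0 \<le> r" "x = ennreal r" "0 \<le> s" "y = ennreal s"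
  then show ?thesis
    by (simp add: ennreal_mult[symmetric] epowr_ennreal' powr_mult)
qed (auto simp: ennreal_mult_top ennreal_top_mult epowr_ennreal')

lemma epowr_epowr: "0 < a \<Longrightarrow> 0 < b \<Longrightarrow> epowr (epowr x a) b = epowr x (a * b)"
  by (cases x) (auto simp: epowr_ennreal' powr_powr)

lemma epowr_eq_0_iff: "0 < a \<Longrightarrow> epowr x a = 0 \<longleftrightarrow> x = 0"
  by (cases x) (auto simp: epowr_ennreal' ennreal_eq_0_iff)

lemma epowr_less_top_iff: "0 < a \<Longrightarrow> epowr x a < top \<longleftrightarrow> x < top"
  by (cases x) (auto simp: epowr_ennreal')

lemma epowr_inverse_exponents: "0 < a \<Longrightarrow> epowr (epowr x a) (1 / a) = x"
  by (simp add: epowr_epowr)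

lemma epowr_inverse_exponents': "0 < a \<Longrightarrow> epowr (epowr x (1 / a)) a = x"
  by (simp add: epowr_epowr)

text \<open>Hoelder's inequality with exponents 1/\<theta> and 1/(1 - \<theta>). Young's inequality
  is applied pointwise to f/A and g/B and then integrated. Working with upper bounds A, B > 0
  instead of the integrals avoids a division by zero.\<close>

lemma nn_integral_powr_interpolation_le:
  fixes f g :: "'a \<Rightarrow> real"
  assumes [measurable]: "f \<in> borel_measurable M" "g \<in> borel_measurable M"
    and pos: "\<And>x. f x \<ge> 0" "\<And>x. g x \<ge> 0" and \<theta>: "0 < \<theta>" "\<theta> < 1"
    and A: "(\<integral>\<^sup>+x. ennreal (f x) \<partial>M) \<le> ennreal A" "A > 0"
    and B: "(\<integral>\<^sup>+x. ennreal (g x) \<partial>M) \<le> ennreal B" "B > 0"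
  shows "(\<integral>\<^sup>+x. ennreal (f x powr \<theta> * g x powr (1 - \<theta>)) \<partial>M) \<le> ennreal (A powr \<theta> * B powr (1 - \<theta>))"
proof -
  let ?c = "A powr \<theta> * B powr (1 - \<theta>)"
  have le: "f x powr \<theta> * g x powr (1 - \<theta>) \<le> ?c * (\<theta> / A * f x + (1 - \<theta>) / B * g x)" for x
  proof (cases "f x = 0 \<or> g x = 0")
    case True
    then show ?thesis using pos[of x] \<theta> A B by auto
  next
    case False
    then have "f x > 0" "g x > 0" using pos[of x] by (auto simp: less_le)
    then have "(f x / A) powr \<theta> * (g x / B) powr (1 - \<theta>) \<le> \<theta> * (f x / A) + (1 - \<theta>) * (g x / B)"
      using \<theta> A B by (intro Youngs_inequality_0) auto
    also have "(f x / A) powr \<theta> * (g x / B) powr (1 - \<theta>) = f x powr \<theta> * g x powr (1 - \<theta>) / ?c"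
      using pos[of x] A B by (simp add: powr_divide)
    finally show ?thesis using A B by (simp add: field_simps)
  qed
  have "(\<integral>\<^sup>+x. ennreal (f x powr \<theta> * g x powr (1 - \<theta>)) \<partial>M)
      \<le> (\<integral>\<^sup>+x. ennreal ?c * (ennreal (\<theta> / A) * ennreal (f x) + ennreal ((1 - \<theta>) / B) * ennreal (g x)) \<partial>M)"
    using le pos \<theta> A B
    by (intro nn_integral_mono) (simp add: ennreal_mult[symmetric] ennreal_plus[symmetric] ennreal_leI del: ennreal_plus)
  also have "\<dots> = ennreal ?c * (ennreal (\<theta> / A) * (\<integral>\<^sup>+x. ennreal (f x) \<partial>M) + ennreal ((1 - \<theta>) / B) * (\<integral>\<^sup>+x. ennreal (g x) \<partial>M))"
    by (simp add: nn_integral_cmult nn_integral_add)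
  also have "\<dots> \<le> ennreal ?c * (ennreal (\<theta> / A) * ennreal A + ennreal ((1 - \<theta>) / B) * ennreal B)"
    using A B by (intro mult_left_mono add_mono) auto
  also have "\<dots> = ennreal ?c"
    using A B \<theta> by (simp add: ennreal_mult[symmetric] ennreal_plus[symmetric] del: ennreal_plus)
  finally show ?thesis .
qed

section \<open>Countable sums as integrals against counting measure, for families of balls and for
  integer scales alike\<close>

lemma nn_integral_count_space_swap:
  fixes f :: "'i \<Rightarrow> 'a \<Rightarrow> ennreal"
  assumes I: "countable I" and M: "sigma_finite_measure M"
    and f: "\<And>i. i \<in> I \<Longrightarrow> f i \<in> borel_measurable M"
  shows "(\<integral>\<^sup>+x. (\<integral>\<^sup>+i. f i x \<partial>count_space I) \<partial>M) = (\<integral>\<^sup>+i. (\<integral>\<^sup>+x. f i x \<partial>M) \<partial>count_space I)"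
proof -
  interpret pair_sigma_finite "count_space I" M
    using I M by (simp add: pair_sigma_finite_def sigma_finite_measure_count_space_countable)
  have "case_prod f \<in> borel_measurable (count_space I \<Otimes>\<^sub>M M)"
    using I f by (intro measurable_pair_measure_countable1) auto
  from Fubini'[OF this] show ?thesis .
qed

lemma borel_measurable_nn_integral_count_space:
  fixes f :: "'i \<Rightarrow> 'a \<Rightarrow> ennreal"
  assumes I: "countable I" and f: "\<And>i. i \<in> I \<Longrightarrow> f i \<in> borel_measurable M"
  shows "(\<lambda>x. \<integral>\<^sup>+i. f i x \<partial>count_space I) \<in> borel_measurable M"
proof -
  interpret sigma_finite_measure "count_space I"
    using I by (rule sigma_finite_measure_count_space_countable)
  have *: "(\<lambda>p. f (fst p) (snd p)) \<in> borel_measurable (count_space I \<Otimes>\<^sub>M M)"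
    using I f by (intro measurable_pair_measure_countable1) auto
  have "(\<lambda>p. f (snd p) (fst p)) \<in> borel_measurable (M \<Otimes>\<^sub>M count_space I)"
    using measurable_compose[OF measurable_pair_swap' *] by (simp add: case_prod_beta)
  from borel_measurable_nn_integral_fst[OF this] show ?thesis by simp
qed

lemma nn_integral_UN_le:
  fixes \<phi> :: "'a \<Rightarrow> ennreal"
  assumes I: "countable I" and M: "sigma_finite_measure M"
    and [measurable]: "\<phi> \<in> borel_measurable M" "\<And>i. i \<in> I \<Longrightarrow> A i \<in> sets M"
    and S: "S \<subseteq> (\<Union>i\<in>I. A i)"
  shows "(\<integral>\<^sup>+x\<in>S. \<phi> x \<partial>M) \<le> (\<integral>\<^sup>+i. (\<integral>\<^sup>+x\<in>A i. \<phi> x \<partial>M) \<partial>count_space I)"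
proof -
  have "(\<integral>\<^sup>+x\<in>S. \<phi> x \<partial>M) \<le> (\<integral>\<^sup>+x. (\<integral>\<^sup>+i. \<phi> x * indicator (A i) x \<partial>count_space I) \<partial>M)"
  proof (intro nn_integral_mono)
    fix x
    show "\<phi> x * indicator S x \<le> (\<integral>\<^sup>+i. \<phi> x * indicator (A i) x \<partial>count_space I)"
    proof (cases "x \<in> S")
      case True
      then obtain i where "i \<in> I" "x \<in> A i" using S by auto
      then show ?thesis
        using True nn_integral_ge_point[of i I "\<lambda>i. \<phi> x * indicator (A i) x"] by simp
    qed simp
  qed
  also have "\<dots> = (\<integral>\<^sup>+i. (\<integral>\<^sup>+x\<in>A i. \<phi> x \<partial>M) \<partial>count_space I)"
    using I M by (intro nn_integral_count_space_swap) auto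
  finally show ?thesis .
qed

lemma nn_integral_disjoint_le:
  fixes \<phi> :: "'a \<Rightarrow> ennreal"
  assumes I: "countable I" and M: "sigma_finite_measure M"
    and [measurable]: "\<phi> \<in> borel_measurable M" "\<And>i. i \<in> I \<Longrightarrow> A i \<in> sets M"
    and disj: "\<And>i j. i \<in> I \<Longrightarrow> j \<in> I \<Longrightarrow> i \<noteq> j \<Longrightarrow> A i \<inter> A j = {}"
    and S: "\<And>i. i \<in> I \<Longrightarrow> A i \<subseteq> S"
  shows "(\<integral>\<^sup>+i. (\<integral>\<^sup>+x\<in>A i. \<phi> x \<partial>M) \<partial>count_space I) \<le> (\<integral>\<^sup>+x\<in>S. \<phi> x \<partial>M)"
proof -
  have "(\<integral>\<^sup>+i. (\<integral>\<^sup>+x\<in>A i. \<phi> x \<partial>M) \<partial>count_space I) = (\<integral>\<^sup>+x. (\<integral>\<^sup>+i. \<phi> x * indicator (A i) x \<partial>count_space I) \<partial>M)"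
    using I M by (intro nn_integral_count_space_swap[symmetric]) auto
  also have "\<dots> \<le> (\<integral>\<^sup>+x\<in>S. \<phi> x \<partial>M)"
  proof (intro nn_integral_mono)
    fix x
    show "(\<integral>\<^sup>+i. \<phi> x * indicator (A i) x \<partial>count_space I) \<le> \<phi> x * indicator S x"
    proof (cases "\<exists>i\<in>I. x \<in> A i")
      case True
      then obtain i where i: "i \<in> I" "x \<in> A i" by auto
      have "(\<integral>\<^sup>+j. \<phi> x * indicator (A j) x \<partial>count_space I) = (\<integral>\<^sup>+j. \<phi> x * indicator {i} j \<partial>count_space I)"
        using i disj by (intro nn_integral_cong) (auto simp: indicator_def)
      also have "\<dots> = \<phi> x" using i by (simp add: nn_integral_cmult)
      finally show ?thesis using i S[OF i(1)] by (simp add: subset_iff)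
    next
      case False
      then have "(\<integral>\<^sup>+j. \<phi> x * indicator (A j) x \<partial>count_space I) = (\<integral>\<^sup>+j. 0 \<partial>count_space I)"
        by (intro nn_integral_cong) (auto simp: indicator_def)
      then show ?thesis by simp
    qed
  qed
  finally show ?thesis .
qed

section \<open>Geometric sums over integer scales\<close>

lemma nn_integral_geometric_atMost:
  fixes c :: real and K :: int
  assumes "c > 0"
  shows "(\<integral>\<^sup>+k. ennreal (2 powr (c * real_of_int k)) \<partial>count_space {..K})
           = ennreal (2 powr (c * real_of_int K) / (1 - 2 powr (- c)))"
proof -
  have bij: "bij_betw (\<lambda>i::nat. K - int i) UNIV {..K}"
    by (rule bij_betwI[where g="\<lambda>k. nat (K - k)"]) auto
  have eq: "2 powr (c * real_of_int (K - int i)) = 2 powr (c * real_of_int K) * (2 powr (- c)) ^ i" for i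
    by (simp add: powr_realpow[symmetric] powr_powr powr_add[symmetric] algebra_simps)
  have lt: "2 powr (- c) < 1"
    using assms powr_less_mono[of "-c" 0 2] by simp
  have "(\<integral>\<^sup>+k. ennreal (2 powr (c * real_of_int k)) \<partial>count_space {..K})
      = (\<Sum>i. ennreal (2 powr (c * real_of_int K) * (2 powr (- c)) ^ i))"
    by (subst nn_integral_bij_count_space[OF bij, symmetric]) (simp only: nn_integral_count_space_nat eq)
  also have "\<dots> = ennreal (2 powr (c * real_of_int K) / (1 - 2 powr (- c)))"
    using lt by (intro suminf_ennreal_eq sums_mult[where c="2 powr (c * real_of_int K)" and a="1 / (1 - 2 powr (- c))", simplified] geometric_sums) auto
  finally show ?thesis .
qed

lemma nn_integral_geometric_less:
  fixes c y :: real
  assumes "c > 0" "y \<ge> 0"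
  shows "(\<integral>\<^sup>+k. ennreal (2 powr (c * real_of_int k)) * indicator {k. 2 powr real_of_int k < y} k \<partial>count_space UNIV)
           \<le> ennreal (y powr c / (1 - 2 powr (- c)))"
proof (cases "y = 0")
  case True
  then show ?thesis by simp
next
  case False
  then have y: "y > 0" using assms by simp
  define K where "K = \<lfloor>log 2 y\<rfloor>"
  have lt: "2 powr (- c) < 1"
    using assms powr_less_mono[of "-c" 0 2] by simp
  have sub: "{k. 2 powr real_of_int k < y} \<subseteq> {..K}"
    using y by (auto simp: K_def le_floor_iff less_log_iff[symmetric])
  have "2 powr real_of_int K \<le> y"
    using y by (simp add: K_def le_log_iff[symmetric])
  then have "2 powr (c * real_of_int K) \<le> y powr c"
    using powr_mono2[of c "2 powr real_of_int K" y] assms by (simp add: powr_powr mult.commute)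
  then have *: "2 powr (c * real_of_int K) / (1 - 2 powr (- c)) \<le> y powr c / (1 - 2 powr (- c))"
    using lt by (intro divide_right_mono) auto
  have "(\<integral>\<^sup>+k. ennreal (2 powr (c * real_of_int k)) * indicator {k. 2 powr real_of_int k < y} k \<partial>count_space UNIV)
     \<le> (\<integral>\<^sup>+k. ennreal (2 powr (c * real_of_int k)) * indicator {..K} k \<partial>count_space UNIV)"
    using sub by (intro nn_integral_mono mult_left_mono) (auto simp: indicator_def)
  also have "\<dots> = (\<integral>\<^sup>+k. ennreal (2 powr (c * real_of_int k)) \<partial>count_space {..K})"
    by (simp add: nn_integral_count_space_indicator)
  also have "\<dots> \<le> ennreal (y powr c / (1 - 2 powr (- c)))"
    using * assms by (simp add: nn_integral_geometric_atMost ennreal_leI)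
  finally show ?thesis .
qed

section \<open>The maximal function of a doubling measure\<close>

lemma borel_measurable_indicator_ball [measurable]:
  fixes r :: real
  assumes [measurable]: "f \<in> borel_measurable M" "g \<in> borel_measurable M"
  shows "(\<lambda>x. indicator (ball (f x :: 'a::euclidean_space) r) (g x) :: ennreal) \<in> borel_measurable M"
proof -
  have "(\<lambda>x. indicator (ball (f x) r) (g x) :: ennreal) = (\<lambda>x. if dist (f x) (g x) < r then 1 else 0)"
    by (auto simp: indicator_def fun_eq_iff)
  then show ?thesis by simp
qed

lemma ennreal_mult_mult: "0 \<le> a \<Longrightarrow> 0 \<le> b \<Longrightarrow> ennreal a * (ennreal b * x) = ennreal (a * b) * x"
  by (simp add: ennreal_mult mult.assoc)

text \<open>A discrete layer cake formula. If 2^k < F \<le> 2^(k+1), then the summand of this single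
  k already dominates F^p.\<close>

lemma epowr_le_dyadic_sum:
  fixes F :: ennreal and p :: real
  assumes p: "p > 0"
  shows "epowr F p \<le> (\<integral>\<^sup>+k. ennreal (2 powr (p * (real_of_int k + 1))) * indicator {k. ennreal (2 powr real_of_int k) < F} k
            \<partial>count_space UNIV)" (is "_ \<le> ?S")
proof -
  have ge: "ennreal (2 powr (p * (real_of_int k + 1))) \<le> ?S" if "ennreal (2 powr real_of_int k) < F" for k
    using nn_integral_ge_point[of k UNIV "\<lambda>k. ennreal (2 powr (p * (real_of_int k + 1))) * indicator {k. ennreal (2 powr real_of_int k) < F} k"] that
    by simp
  show ?thesis
  proof (cases F)
    case (real x)
    show ?thesis
    proof (cases "x = 0")
      case False
      then have x: "x > 0" using real by simp
      \<comment> \<open>Ceiling minus one, not floor: the indicator asks for the strict inequality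
        2^k < x.\<close>
      define k where "k = \<lceil>log 2 x\<rceil> - 1"
      have "real_of_int k < log 2 x" "log 2 x \<le> real_of_int k + 1"
        unfolding k_def by linarith+
      then have *: "2 powr real_of_int k < x" "x \<le> 2 powr (real_of_int k + 1)"
        using x by (simp_all add: less_log_iff log_le_iff)
      have "x powr p \<le> (2 powr (real_of_int k + 1)) powr p"
        using * x p by (intro powr_mono2) auto
      also have "\<dots> = 2 powr (p * (real_of_int k + 1))"
        by (simp add: powr_powr mult.commute)
      finally have "epowr F p \<le> ennreal (2 powr (p * (real_of_int k + 1)))"
        using x real by (simp add: epowr_ennreal ennreal_leI)
      also have "\<dots> \<le> ?S"
        using * real by (intro ge) (simp add: ennreal_less_iff)
      finally show ?thesis .
    qed (use real p in auto)
  next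
    case top
    \<comment> \<open>For F = \<infinity> every k contributes, and the summands are
      unbounded.\<close>
    have "?S = top"
    proof (rule ccontr)
      assume "?S \<noteq> top"
      then obtain r where r: "?S = ennreal r" "r \<ge> 0" by (cases ?S) auto
      define k where "k = \<lceil>log 2 (r + 1) / p\<rceil>"
      have "log 2 (r + 1) / p \<le> real_of_int k + 1" unfolding k_def by linarith
      then have "log 2 (r + 1) \<le> p * (real_of_int k + 1)"
        using p by (simp add: field_simps)
      then have "r + 1 \<le> 2 powr (p * (real_of_int k + 1))"
        using r by (simp add: log_le_iff)
      moreover have "ennreal (2 powr (p * (real_of_int k + 1))) \<le> ennreal r"
        using ge[of k] r top by simp
      ultimately show False using r by simp
    qed
    then show ?thesis by simp
  qed
qed

text \<open>Used for Lebesgue measure and for the two weights. Balls have positive finite mass, so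
  averages are genuine quotients in \<open>ennreal\<close>. The sigma-algebra is the Borel one,
  which makes averages measurable in the centre.\<close>

locale doubling_measure =
  fixes \<nu> :: "'a::euclidean_space measure" and D :: real
  assumes sets_eq [measurable_cong, simp]: "sets \<nu> = sets borel"
    and ball_pos: "0 < r \<Longrightarrow> 0 < emeasure \<nu> (ball x r)"
    and ball_finite: "emeasure \<nu> (ball x r) < top"
    and doubling: "0 < r \<Longrightarrow> emeasure \<nu> (ball x (2 * r)) \<le> ennreal D * emeasure \<nu> (ball x r)"
begin

lemma space_eq [simp]: "space \<nu> = UNIV"
  using sets_eq_imp_space_eq[OF sets_eq] by simp

lemma D_pos: "D > 0"
  using doubling[of 1 0] ball_pos[of 2 0] by (cases "D > 0") (auto simp: ennreal_neg)

lemma sigma_finite_measure_nu: "sigma_finite_measure \<nu>"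
proof
  show "\<exists>A. countable A \<and> A \<subseteq> sets \<nu> \<and> \<Union>A = space \<nu> \<and> (\<forall>a\<in>A. emeasure \<nu> a \<noteq> \<infinity>)"
  proof (intro exI[of _ "range (\<lambda>n::nat. ball 0 (real n))"] conjI)
    show "\<Union>(range (\<lambda>n::nat. ball (0::'a) (real n))) = space \<nu>"
      by (auto intro: reals_Archimedean2)
  qed (use ball_finite in \<open>auto simp: less_top\<close>)
qed

sublocale sigma_finite_measure \<nu> by (rule sigma_finite_measure_nu)

lemma doubling_power:
  "0 < r \<Longrightarrow> emeasure \<nu> (ball x (2 ^ m * r)) \<le> ennreal (D ^ m) * emeasure \<nu> (ball x r)"
proof (induction m)
  case (Suc m)
  have "emeasure \<nu> (ball x (2 ^ Suc m * r)) \<le> ennreal D * emeasure \<nu> (ball x (2 ^ m * r))"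
    using doubling[of "2 ^ m * r" x] Suc.prems by (simp add: mult.assoc)
  also have "\<dots> \<le> ennreal D * (ennreal (D ^ m) * emeasure \<nu> (ball x r))"
    using Suc by (intro mult_left_mono) auto
  finally show ?case
    using D_pos by (simp add: ennreal_mult mult.assoc)
qed simp

text \<open>Only the radii 2^k occur. The supremum in \<open>maximal\<close> is then countable,
  hence measurable, and among scales that are bounded above there is a largest one.\<close>

definition average :: "('a \<Rightarrow> ennreal) \<Rightarrow> int \<Rightarrow> 'a \<Rightarrow> ennreal" where
  "average g k x = (\<integral>\<^sup>+y\<in>ball x (2 powr k). g y \<partial>\<nu>) / emeasure \<nu> (ball x (2 powr k))"

definition maximal :: "('a \<Rightarrow> ennreal) \<Rightarrow> 'a \<Rightarrow> ennreal" where
  "maximal g x = (SUP k. average g k x)"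

lemma emeasure_ball_measurable [measurable]: "(\<lambda>x. emeasure \<nu> (ball x r)) \<in> borel_measurable borel"
proof -
  have "(\<lambda>x. emeasure \<nu> (ball x r)) = (\<lambda>x. \<integral>\<^sup>+y. indicator (ball x r) y \<partial>\<nu>)"
    by simp
  then show ?thesis by (simp only:) measurable
qed

lemma average_measurable [measurable]:
  assumes [measurable]: "g \<in> borel_measurable borel"
  shows "average g k \<in> borel_measurable borel"
  unfolding average_def by measurable

lemma maximal_measurable [measurable]:
  assumes [measurable]: "g \<in> borel_measurable borel"
  shows "maximal g \<in> borel_measurable borel"
  unfolding maximal_def by measurable

lemma average_le_maximal: "average g k x \<le> maximal g x"
  unfolding maximal_def by (rule SUP_upper) auto

lemma nn_integral_eq_average:
  "(\<integral>\<^sup>+y\<in>ball x (2 powr k). g y \<partial>\<nu>) = average g k x * emeasure \<nu> (ball x (2 powr k))"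
  unfolding average_def using ball_pos[of "2 powr k" x] ball_finite[of x "2 powr k"]
  by (simp add: ennreal_divide_times ennreal_divide_self)

text \<open>Lets the centred maximal function at x control means over balls that merely contain x:
  the ball around z lies in the ball of twice the radius around x, which lies in the fourfold ball
  around z. The latter costs two doublings.\<close>

lemma nn_integral_ball_le_maximal:
  assumes "dist z x < 2 powr real_of_int k"
  shows "(\<integral>\<^sup>+y\<in>ball z (2 powr k). g y \<partial>\<nu>) \<le> ennreal (D\<^sup>2) * emeasure \<nu> (ball z (2 powr k)) * maximal g x"
proof -
  have e: "2 powr (real_of_int k + 1) = 2 * 2 powr real_of_int k"
    by (simp add: powr_add)
  have "(\<integral>\<^sup>+y\<in>ball z (2 powr k). g y \<partial>\<nu>) \<le> (\<integral>\<^sup>+y\<in>ball x (2 powr (k + 1)). g y \<partial>\<nu>)"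
  proof (intro nn_integral_mono mult_left_mono)
    fix y
    have "dist x y \<le> dist z x + dist z y" by (metis dist_commute dist_triangle)
    then show "indicator (ball z (2 powr k)) y \<le> (indicator (ball x (2 powr (k + 1))) y :: ennreal)"
      using assms by (auto simp: indicator_def e)
  qed simp
  also have "\<dots> = average g (k + 1) x * emeasure \<nu> (ball x (2 powr (k + 1)))"
    by (rule nn_integral_eq_average)
  also have "\<dots> \<le> maximal g x * (ennreal (D\<^sup>2) * emeasure \<nu> (ball z (2 powr k)))"
  proof (intro mult_mono average_le_maximal)
    have "ball x (2 powr (k + 1)) \<subseteq> ball z (2 ^ 2 * 2 powr k)"
    proof
      fix y assume "y \<in> ball x (2 powr (k + 1))"
      then have "dist x y < 2 * 2 powr real_of_int k" by (simp add: e)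
      moreover have "(2 :: real) powr real_of_int k > 0" by simp
      ultimately have "dist z y < 4 * 2 powr real_of_int k"
        using assms dist_triangle[of z y x] by linarith
      then show "y \<in> ball z (2 ^ 2 * 2 powr k)" by simp
    qed
    then have "emeasure \<nu> (ball x (2 powr (k + 1))) \<le> emeasure \<nu> (ball z (2 ^ 2 * 2 powr k))"
      by (intro emeasure_mono) auto
    also have "\<dots> \<le> ennreal (D\<^sup>2) * emeasure \<nu> (ball z (2 powr k))"
      by (intro doubling_power) auto
    finally show "emeasure \<nu> (ball x (2 powr (k + 1))) \<le> ennreal (D\<^sup>2) * emeasure \<nu> (ball z (2 powr k))" .
  qed auto
  finally show ?thesis by (simp add: ac_simps)
qed

text \<open>The Vitali lemma needs bounded radii, hence the bound K on the scales; it disappears in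
  \<open>weak_type\<close> by monotone convergence. The enlarged balls have radius 5r < 8r, so three
  doublings suffice and give \<open>D ^ 3\<close>.\<close>

lemma weak_type_truncated:
  fixes l :: real and K :: int
  assumes [measurable]: "g \<in> borel_measurable borel" and l: "l > 0"
  shows "ennreal l * emeasure \<nu> {x. \<exists>k\<le>K. ennreal l < average g k x} \<le> ennreal (D ^ 3) * (\<integral>\<^sup>+y. g y \<partial>\<nu>)"
proof -
  define E where "E = {x. \<exists>k\<le>K. ennreal l < average g k x}"
  obtain \<kappa> where \<kappa>: "\<And>x. x \<in> E \<Longrightarrow> \<kappa> x \<le> K \<and> ennreal l < average g (\<kappa> x) x"
    unfolding E_def by atomize_elim (rule choice, auto)
  define r where "r x = 2 powr real_of_int (\<kappa> x)" for x
  have r: "0 < r x \<and> r x \<le> 2 powr K" if "x \<in> E" for x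
    using \<kappa>[OF that] by (auto simp: r_def)
  have [simp]: "r x > 0" for x by (simp add: r_def)
  have E_cov: "E \<subseteq> (\<Union>i\<in>E. cball i (r i))"
  proof
    fix x assume "x \<in> E"
    then show "x \<in> (\<Union>i\<in>E. cball i (r i))"
      by (intro UN_I[of x]) (simp_all add: less_imp_le)
  qed
  obtain C where C: "countable C" "C \<subseteq> E"
      and disj: "pairwise (\<lambda>i j. disjnt (cball i (r i)) (cball j (r j))) C"
      and cov: "E \<subseteq> (\<Union>i\<in>C. cball i (5 * r i))"
    by (rule Vitali_covering_lemma_cballs[where a="\<lambda>x. x", OF E_cov r]) (assumption, rule that)
  have "E \<subseteq> (\<Union>i\<in>C. ball i (2 ^ 3 * r i))"
  proof
    fix x assume "x \<in> E"
    then obtain i where i: "i \<in> C" "x \<in> cball i (5 * r i)" using cov by auto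
    moreover have "5 * r i < 2 ^ 3 * r i" by simp
    ultimately show "x \<in> (\<Union>i\<in>C. ball i (2 ^ 3 * r i))"
      by (intro UN_I[of i]) (auto simp: mem_ball mem_cball intro: le_less_trans)
  qed
  then have "(\<integral>\<^sup>+x\<in>E. 1 \<partial>\<nu>) \<le> (\<integral>\<^sup>+i. (\<integral>\<^sup>+x\<in>ball i (2 ^ 3 * r i). 1 \<partial>\<nu>) \<partial>count_space C)"
    using C by (intro nn_integral_UN_le sigma_finite_measure_axioms) auto
  moreover have [measurable]: "E \<in> sets borel"
    unfolding E_def by measurable
  ultimately have "emeasure \<nu> E \<le> (\<integral>\<^sup>+i. emeasure \<nu> (ball i (2 ^ 3 * r i)) \<partial>count_space C)"
    by simp
  also have "\<dots> \<le> (\<integral>\<^sup>+i. ennreal (D ^ 3) * emeasure \<nu> (ball i (r i)) \<partial>count_space C)"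
    by (intro nn_integral_mono doubling_power) auto
  also have "\<dots> = ennreal (D ^ 3) * (\<integral>\<^sup>+i. emeasure \<nu> (ball i (r i)) \<partial>count_space C)"
    by (simp add: nn_integral_cmult)
  finally have "ennreal l * emeasure \<nu> E \<le> ennreal l * (ennreal (D ^ 3) * (\<integral>\<^sup>+i. emeasure \<nu> (ball i (r i)) \<partial>count_space C))"
    by (intro mult_left_mono) auto
  also have "\<dots> = ennreal (D ^ 3) * (\<integral>\<^sup>+i. ennreal l * emeasure \<nu> (ball i (r i)) \<partial>count_space C)"
    by (simp add: nn_integral_cmult ac_simps)
  also have "\<dots> \<le> ennreal (D ^ 3) * (\<integral>\<^sup>+i. (\<integral>\<^sup>+y\<in>ball i (r i). g y \<partial>\<nu>) \<partial>count_space C)"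
  proof (intro mult_left_mono nn_integral_mono)
    fix i assume "i \<in> space (count_space C)"
    then have "ennreal l \<le> average g (\<kappa> i) i" using C \<kappa>[of i] by (auto intro: less_imp_le)
    then show "ennreal l * emeasure \<nu> (ball i (r i)) \<le> (\<integral>\<^sup>+y\<in>ball i (r i). g y \<partial>\<nu>)"
      unfolding r_def nn_integral_eq_average by (rule mult_right_mono) auto
  qed auto
  also have "\<dots> \<le> ennreal (D ^ 3) * (\<integral>\<^sup>+y\<in>UNIV. g y \<partial>\<nu>)"
  proof (intro mult_left_mono nn_integral_disjoint_le sigma_finite_measure_axioms C)
    fix i j assume "i \<in> C" "j \<in> C" "i \<noteq> j"
    then have "disjnt (cball i (r i)) (cball j (r j))" using disj by (auto simp: pairwise_def)
    then show "ball i (r i) \<inter> ball j (r j) = {}" using ball_subset_cball[of i "r i"] ball_subset_cball[of j "r j"] unfolding disjnt_def by blast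
  qed auto
  finally show ?thesis unfolding E_def by simp
qed

lemma weak_type:
  fixes l :: real
  assumes [measurable]: "g \<in> borel_measurable borel" and l: "l > 0"
  shows "ennreal l * emeasure \<nu> {x. ennreal l < maximal g x} \<le> ennreal (D ^ 3) * (\<integral>\<^sup>+y. g y \<partial>\<nu>)"
proof -
  define E where "E n = {x. \<exists>k\<le>int n. ennreal l < average g k x}" for n :: nat
  have [measurable]: "E n \<in> sets borel" for n unfolding E_def by measurable
  have "{x. ennreal l < maximal g x} = (\<Union>n. E n)"
    by (auto simp: E_def maximal_def less_SUP_iff) (metis nat_le_iff order_refl)
  moreover have "incseq E"
    unfolding incseq_def E_def by (auto, meson of_nat_mono order_trans)
  ultimately have "emeasure \<nu> {x. ennreal l < maximal g x} = (SUP n. emeasure \<nu> (E n))"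
    by (simp add: SUP_emeasure_incseq image_subset_iff)
  then have "ennreal l * emeasure \<nu> {x. ennreal l < maximal g x} = (SUP n. ennreal l * emeasure \<nu> (E n))"
    by (simp add: SUP_mult_left_ennreal)
  also have "\<dots> \<le> ennreal (D ^ 3) * (\<integral>\<^sup>+y. g y \<partial>\<nu>)"
    unfolding E_def using l by (intro SUP_least weak_type_truncated) auto
  finally show ?thesis .
qed

text \<open>The part of g below height c adds at most c to every average. This is the truncation
  behind the interpolation in \<open>strong_type\<close>.\<close>

lemma maximal_le_add_const:
  assumes [measurable]: "g \<in> borel_measurable borel"
  shows "maximal g x \<le> maximal (\<lambda>y. g y * indicator {y. c < g y} y) x + c"
  unfolding maximal_def[of g]
proof (rule SUP_least)
  fix k
  let ?B = "ball x (2 powr real_of_int k)"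
  let ?h = "\<lambda>y. g y * indicator {y. c < g y} y"
  have "(\<integral>\<^sup>+y\<in>?B. g y \<partial>\<nu>) \<le> (\<integral>\<^sup>+y. ?h y * indicator ?B y + c * indicator ?B y \<partial>\<nu>)"
    by (intro nn_integral_mono) (auto simp: indicator_def)
  also have "\<dots> = (\<integral>\<^sup>+y\<in>?B. ?h y \<partial>\<nu>) + c * emeasure \<nu> ?B"
    by (simp add: nn_integral_add nn_integral_cmult)
  finally have "average g k x \<le> average ?h k x + c * emeasure \<nu> ?B / emeasure \<nu> ?B"
    unfolding average_def add_divide_distrib_ennreal[symmetric] by (rule divide_right_mono_ennreal)
  also have "c * emeasure \<nu> ?B / emeasure \<nu> ?B = c"
    using ball_pos[of "2 powr k" x] ball_finite[of x "2 powr k"]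
    by (simp add: mult_divide_eq_ennreal less_top)
  also have "average ?h k x + c \<le> maximal ?h x + c"
    by (intro add_mono average_le_maximal order_refl)
  finally show "average g k x \<le> maximal ?h x + c" .
qed

text \<open>Marcinkiewicz interpolation between the weak type inequality and the trivial bound in
  L^\<infinity>. At height 2^k the weak type inequality is applied to the part of g above 2^k / 2.
  After exchanging sum and integral, each y sees only the k with 2^k < 2 g(y), and that sum is
  geometric because p > 1.\<close>

theorem strong_type:
  fixes p :: real
  assumes p: "p > 1"
  shows "\<exists>C::real. C > 0 \<and> (\<forall>g \<in> borel_measurable borel.
    (\<integral>\<^sup>+x. epowr (maximal g x) p \<partial>\<nu>) \<le> ennreal C * (\<integral>\<^sup>+x. epowr (g x) p \<partial>\<nu>))"
proof -
  \<comment> \<open>\<open>D ^ 3\<close> comes from the weak type inequality. In 2^(p+1), the factor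
    2^p is the dyadic step of the layer cake and the remaining 2 comes from halving the height. The
    last factor is the geometric sum up to 2 g(y).\<close>
  define C where "C = D ^ 3 * 2 powr (p + 1) * (2 powr (p - 1) / (1 - 2 powr (- (p - 1))))"
  have lt: "2 powr (- (p - 1)) < (1::real)"
    using p powr_less_mono[of "- (p - 1)" 0 2] by simp
  have C: "C > 0" using D_pos lt by (simp add: C_def)
  have "(\<integral>\<^sup>+x. epowr (maximal g x) p \<partial>\<nu>) \<le> ennreal C * (\<integral>\<^sup>+x. epowr (g x) p \<partial>\<nu>)"
    if [measurable]: "g \<in> borel_measurable borel" for g
  proof -
    let ?a = "\<lambda>k::int. 2 powr real_of_int k :: real"
    let ?h = "\<lambda>k y. g y * indicator {y. ennreal (?a k / 2) < g y} y"
    have [measurable]: "?h k \<in> borel_measurable borel" for k by measurable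
    have level: "emeasure \<nu> {x. ennreal (?a k) < maximal g x}
        \<le> ennreal (2 * D ^ 3 * 2 powr (- real_of_int k)) * (\<integral>\<^sup>+y. ?h k y \<partial>\<nu>)" for k
    proof -
      have "{x. ennreal (?a k) < maximal g x} \<subseteq> {x. ennreal (?a k / 2) < maximal (?h k) x}"
      proof safe
        fix x assume "ennreal (?a k) < maximal g x"
        also have "\<dots> \<le> maximal (?h k) x + ennreal (?a k / 2)"
          by (rule maximal_le_add_const) measurable
        finally have *: "ennreal (?a k) < maximal (?h k) x + ennreal (?a k / 2)" .
        show "ennreal (?a k / 2) < maximal (?h k) x"
        proof (rule ccontr)
          assume "\<not> ennreal (?a k / 2) < maximal (?h k) x"
          then have "maximal (?h k) x + ennreal (?a k / 2) \<le> ennreal (?a k / 2) + ennreal (?a k / 2)"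
            by (intro add_mono) auto
          also have "\<dots> = ennreal (?a k)" by (simp add: ennreal_plus[symmetric] del: ennreal_plus)
          finally show False using * by simp
        qed
      qed
      then have "emeasure \<nu> {x. ennreal (?a k) < maximal g x} \<le> emeasure \<nu> {x. ennreal (?a k / 2) < maximal (?h k) x}"
        by (intro emeasure_mono) auto
      also have "\<dots> = ennreal (2 * 2 powr (- real_of_int k)) * (ennreal (?a k / 2) * emeasure \<nu> {x. ennreal (?a k / 2) < maximal (?h k) x})"
        by (simp add: ennreal_mult_mult powr_minus)
      also have "\<dots> \<le> ennreal (2 * 2 powr (- real_of_int k)) * (ennreal (D ^ 3) * (\<integral>\<^sup>+y. ?h k y \<partial>\<nu>))"
        by (intro mult_left_mono weak_type) auto
      also have "\<dots> = ennreal (2 * D ^ 3 * 2 powr (- real_of_int k)) * (\<integral>\<^sup>+y. ?h k y \<partial>\<nu>)"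
        using D_pos by (subst ennreal_mult_mult) (auto simp: mult_ac)
      finally show ?thesis .
    qed
    have "(\<integral>\<^sup>+x. epowr (maximal g x) p \<partial>\<nu>) \<le> (\<integral>\<^sup>+x. (\<integral>\<^sup>+k. ennreal (2 powr (p * (real_of_int k + 1)))
        * indicator {x. ennreal (?a k) < maximal g x} x \<partial>count_space UNIV) \<partial>\<nu>)"
      using epowr_le_dyadic_sum[of p "maximal g _"] p
      by (intro nn_integral_mono) (simp add: indicator_def)
    also have "\<dots> = (\<integral>\<^sup>+k. ennreal (2 powr (p * (real_of_int k + 1))) * emeasure \<nu> {x. ennreal (?a k) < maximal g x} \<partial>count_space UNIV)"
      by (subst nn_integral_count_space_swap[OF countableI_type sigma_finite_measure_axioms]) (auto simp: nn_integral_cmult)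
    also have "\<dots> \<le> (\<integral>\<^sup>+k. ennreal (2 powr (p * (real_of_int k + 1))) *
         (ennreal (2 * D ^ 3 * 2 powr (- real_of_int k)) * (\<integral>\<^sup>+y. ?h k y \<partial>\<nu>)) \<partial>count_space UNIV)"
      by (intro nn_integral_mono mult_left_mono level) auto
    also have "\<dots> = (\<integral>\<^sup>+k. (\<integral>\<^sup>+y. ennreal (D ^ 3 * 2 powr (p + 1)) * (ennreal (2 powr ((p - 1) * real_of_int k)) * ?h k y) \<partial>\<nu>) \<partial>count_space UNIV)"
    proof (intro nn_integral_cong)
      fix k :: int
      have eq: "2 powr (p * (real_of_int k + 1)) * (2 * D ^ 3 * 2 powr (- real_of_int k))
          = D ^ 3 * 2 powr (p + 1) * 2 powr ((p - 1) * real_of_int k)"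
      proof -
        have "2 powr (p * (real_of_int k + 1)) * 2 powr (- real_of_int k) = 2 powr p * (2::real) powr ((p - 1) * real_of_int k)"
          by (simp add: powr_add[symmetric] algebra_simps)
        then show ?thesis by (simp add: powr_add mult_ac)
      qed
      have "ennreal (2 powr (p * (real_of_int k + 1))) * (ennreal (2 * D ^ 3 * 2 powr (- real_of_int k)) * (\<integral>\<^sup>+y. ?h k y \<partial>\<nu>))
          = ennreal (D ^ 3 * 2 powr (p + 1) * 2 powr ((p - 1) * real_of_int k)) * (\<integral>\<^sup>+y. ?h k y \<partial>\<nu>)"
        using D_pos by (subst ennreal_mult_mult) (simp_all only: eq, auto)
      also have "\<dots> = ennreal (D ^ 3 * 2 powr (p + 1)) * (ennreal (2 powr ((p - 1) * real_of_int k)) * (\<integral>\<^sup>+y. ?h k y \<partial>\<nu>))"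
        using D_pos by (subst ennreal_mult_mult) auto
      also have "\<dots> = (\<integral>\<^sup>+y. ennreal (D ^ 3 * 2 powr (p + 1)) * (ennreal (2 powr ((p - 1) * real_of_int k)) * ?h k y) \<partial>\<nu>)"
        by (simp add: nn_integral_cmult)
      finally show "ennreal (2 powr (p * (real_of_int k + 1))) * (ennreal (2 * D ^ 3 * 2 powr (- real_of_int k)) * (\<integral>\<^sup>+y. ?h k y \<partial>\<nu>))
          = (\<integral>\<^sup>+y. ennreal (D ^ 3 * 2 powr (p + 1)) * (ennreal (2 powr ((p - 1) * real_of_int k)) * ?h k y) \<partial>\<nu>)" .
    qed
    also have "\<dots> = (\<integral>\<^sup>+y. (\<integral>\<^sup>+k. ennreal (D ^ 3 * 2 powr (p + 1)) * (ennreal (2 powr ((p - 1) * real_of_int k)) * ?h k y) \<partial>count_space UNIV) \<partial>\<nu>)"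
      by (rule nn_integral_count_space_swap[OF countableI_type sigma_finite_measure_axioms, symmetric]) auto
    also have "\<dots> \<le> (\<integral>\<^sup>+y. ennreal C * epowr (g y) p \<partial>\<nu>)"
    proof (intro nn_integral_mono)
      fix y
      show "(\<integral>\<^sup>+k. ennreal (D ^ 3 * 2 powr (p + 1)) * (ennreal (2 powr ((p - 1) * real_of_int k)) * ?h k y) \<partial>count_space UNIV)
          \<le> ennreal C * epowr (g y) p"
      proof (cases "g y")
        case top
        then show ?thesis using p C by (simp add: ennreal_mult_top)
      next
        case (real t)
        have ind: "indicator {y. ennreal (?a k / 2) < g y} y = (indicator {k. ?a k < 2 * t} k :: ennreal)" for k
          using real by (auto simp: indicator_def ennreal_less_iff)
        have "(\<integral>\<^sup>+k. ennreal (D ^ 3 * 2 powr (p + 1)) * (ennreal (2 powr ((p - 1) * real_of_int k)) * ?h k y) \<partial>count_space UNIV)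
          = (\<integral>\<^sup>+k. ennreal (D ^ 3 * 2 powr (p + 1)) * g y * (ennreal (2 powr ((p - 1) * real_of_int k)) * indicator {k. ?a k < 2 * t} k) \<partial>count_space UNIV)"
          unfolding ind by (intro nn_integral_cong) (simp add: ac_simps)
        also have "\<dots> = ennreal (D ^ 3 * 2 powr (p + 1)) * g y *
            (\<integral>\<^sup>+k. ennreal (2 powr ((p - 1) * real_of_int k)) * indicator {k. ?a k < 2 * t} k \<partial>count_space UNIV)"
          by (simp add: nn_integral_cmult)
        also have "\<dots> \<le> ennreal (D ^ 3 * 2 powr (p + 1)) * g y * ennreal ((2 * t) powr (p - 1) / (1 - 2 powr (- (p - 1))))"
          using p real by (intro mult_left_mono nn_integral_geometric_less) auto
        also have "\<dots> = ennreal (D ^ 3 * 2 powr (p + 1) * t * ((2 * t) powr (p - 1) / (1 - 2 powr (- (p - 1)))))"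
          using real D_pos lt by (simp add: ennreal_mult[symmetric])
        also have "D ^ 3 * 2 powr (p + 1) * t * ((2 * t) powr (p - 1) / (1 - 2 powr (- (p - 1)))) = C * t powr p"
        proof -
          have "t * t powr (p - 1) = t powr p"
            using real p by (cases "t = 0") (simp_all add: powr_mult_base)
          then show ?thesis unfolding C_def powr_mult by (simp add: field_simps)
        qed
        also have "ennreal (C * t powr p) = ennreal C * epowr (g y) p"
          using real p C by (simp add: epowr_ennreal' ennreal_mult)
        finally show ?thesis .
      qed
    qed
    also have "\<dots> = ennreal C * (\<integral>\<^sup>+x. epowr (g x) p \<partial>\<nu>)"
      by (simp add: nn_integral_cmult)
    finally show ?thesis .
  qed
  with C show ?thesis by auto
qed

end

section \<open>Pairs of dual weights\<close>

lemma measure_lborel_ball: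
  fixes x :: "'a::euclidean_space"
  assumes "r \<ge> 0"
  shows "measure lborel (ball x r) = unit_ball_vol DIM('a) * r powr DIM('a)"
  using assms by (cases "r = 0") (simp_all add: content_ball powr_realpow)

lemma doubling_measure_lborel: "doubling_measure (lborel :: 'a::euclidean_space measure) (2 ^ DIM('a))"
proof
  fix x :: 'a and r :: real
  show "0 < r \<Longrightarrow> 0 < emeasure lborel (ball x r)"
    by (simp add: emeasure_ball)
  show "emeasure lborel (ball x r) < top"
    using emeasure_lborel_ball_finite[of x r] by (simp add: less_top)
  show "0 < r \<Longrightarrow> emeasure lborel (ball x (2 * r)) \<le> ennreal (2 ^ DIM('a)) * emeasure lborel (ball x r)"
    by (simp add: emeasure_ball ennreal_mult[symmetric] power_mult_distrib mult_ac)
qed simp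

lemma emeasure_density_pos:
  fixes w :: "'a::euclidean_space \<Rightarrow> real"
  assumes [measurable]: "w \<in> borel_measurable borel" "E \<in> sets borel" and w: "\<And>x. w x > 0"
    and E: "emeasure lborel E > 0"
  shows "emeasure (density lborel (\<lambda>x. ennreal (w x))) E > 0"
proof (rule ccontr)
  assume "\<not> ?thesis"
  then have "(\<integral>\<^sup>+x\<in>E. ennreal (w x) \<partial>lborel) = 0"
    by (simp add: emeasure_density)
  moreover have "\<not> w x \<le> 0" for x
    using w by (simp add: not_le)
  ultimately have "AE x in lborel. x \<notin> E"
    by (subst (asm) nn_integral_0_iff_AE) (auto elim!: eventually_mono simp: indicator_def ennreal_eq_0_iff split: if_splits)
  then have "emeasure lborel E = 0"
    by (subst (asm) AE_iff_measurable[of E]) auto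
  then show False using E by simp
qed

text \<open>
  For a weight w in A_{p,q} take u = w^q, v = w^(-p'), a = 1/q and b = 1/p'.  Then u^a v^b = 1, and
  a + b = 1 - gamma/n is the power of the volume on the right-hand side of the A_{p,q} condition.
\<close>

locale dual_weights =
  fixes u v :: "'a::euclidean_space \<Rightarrow> real" and a b C0 :: real
  assumes u_measurable [measurable]: "u \<in> borel_measurable borel"
    and v_measurable [measurable]: "v \<in> borel_measurable borel"
    and u_pos: "\<And>x. u x > 0" and v_pos: "\<And>x. v x > 0"
    and a_pos: "a > 0" and b_pos: "b > 0" and ab_less: "a + b < 1"
    and duality: "\<And>x. u x powr a * v x powr b = 1"
    and C0_pos: "C0 > 0"
    and u_finite: "\<And>x r. emeasure (density lborel (\<lambda>x. ennreal (u x))) (ball x r) < top"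
    and v_finite: "\<And>x r. emeasure (density lborel (\<lambda>x. ennreal (v x))) (ball x r) < top"
    and A_condition: "\<And>x r. 0 < r \<Longrightarrow>
      measure (density lborel (\<lambda>x. ennreal (u x))) (ball x r) powr a *
      measure (density lborel (\<lambda>x. ennreal (v x))) (ball x r) powr b \<le> C0 * measure lborel (ball x r) powr (a + b)"
begin

abbreviation "U \<equiv> density lborel (\<lambda>x. ennreal (u x))"
abbreviation "V \<equiv> density lborel (\<lambda>x. ennreal (v x))"

lemma ball_measure_pos:
  assumes "r > 0"
  shows "measure U (ball x r) > 0" "measure V (ball x r) > 0"
  using emeasure_density_pos[of u "ball x r"] emeasure_density_pos[of v "ball x r"] u_pos v_pos assms
    u_finite[of x r] v_finite[of x r]
  by (auto simp: emeasure_ball measure_def enn2real_positive_iff)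

text \<open>
  Hoelder's inequality for u^(a/(a+b)) v^(b/(a+b)) = 1 reverses the A_{p,q} condition, on arbitrary sets.
  Comparing the two on a ball and on a large subset of it gives doubling and reverse doubling of both
  weights at once.
\<close>

lemma lebesgue_le_weights:
  assumes [measurable]: "E \<in> sets borel" and E: "E \<subseteq> ball x r" "measure lborel E > 0"
  shows "measure U E > 0" "measure V E > 0"
    "measure lborel E powr (a + b) \<le> measure U E powr a * measure V E powr b"
proof -
  have fin: "emeasure U E < top" "emeasure V E < top" "emeasure lborel E < top"
    using emeasure_mono[of E "ball x r" U] emeasure_mono[of E "ball x r" V] emeasure_mono[of E "ball x r" lborel] E
      u_finite[of x r] v_finite[of x r] emeasure_lborel_ball_finite[of x r]
    by (auto simp: less_top[symmetric] top_unique)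
  have "emeasure lborel E > 0" using E by (simp add: measure_def enn2real_positive_iff)
  then have "emeasure U E > 0" "emeasure V E > 0"
    by (auto intro!: emeasure_density_pos u_pos v_pos)
  with fin show *: "measure U E > 0" "measure V E > 0"
    by (auto simp: measure_def enn2real_positive_iff)
  define c where "c = a + b"
  have c: "c > 0" using a_pos b_pos by (simp add: c_def)
  have one: "u x powr (a / c) * v x powr (1 - a / c) = 1" for x
  proof -
    have "1 - a / c = b / c" using c by (simp add: c_def field_simps)
    then have "u x powr (a / c) * v x powr (1 - a / c) = (u x powr a * v x powr b) powr (1 / c)"
      by (simp add: powr_mult powr_powr)
    then show ?thesis by (simp add: duality)
  qed
  have "(\<integral>\<^sup>+x. ennreal ((u x * indicator E x) powr (a / c) * (v x * indicator E x) powr (1 - a / c)) \<partial>lborel)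
     \<le> ennreal (measure U E powr (a / c) * measure V E powr (1 - a / c))"
  proof (rule nn_integral_powr_interpolation_le)
    have "emeasure U E = (\<integral>\<^sup>+x. ennreal (u x * indicator E x) \<partial>lborel)"
      using u_pos by (subst emeasure_density) (auto intro!: nn_integral_cong simp: indicator_def)
    then show "(\<integral>\<^sup>+x. ennreal (u x * indicator E x) \<partial>lborel) \<le> ennreal (measure U E)"
      using fin by (simp add: emeasure_eq_ennreal_measure less_top[symmetric])
    have "emeasure V E = (\<integral>\<^sup>+x. ennreal (v x * indicator E x) \<partial>lborel)"
      using v_pos by (subst emeasure_density) (auto intro!: nn_integral_cong simp: indicator_def)
    then show "(\<integral>\<^sup>+x. ennreal (v x * indicator E x) \<partial>lborel) \<le> ennreal (measure V E)"
      using fin by (simp add: emeasure_eq_ennreal_measure less_top[symmetric])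
  qed (use u_pos v_pos a_pos b_pos * in \<open>auto simp: c_def less_imp_le field_simps\<close>)
  also have "(\<integral>\<^sup>+x. ennreal ((u x * indicator E x) powr (a / c) * (v x * indicator E x) powr (1 - a / c)) \<partial>lborel)
     = (\<integral>\<^sup>+x. indicator E x \<partial>lborel)"
    by (intro nn_integral_cong) (auto simp: indicator_def one)
  finally have "measure lborel E \<le> measure U E powr (a / c) * measure V E powr (1 - a / c)"
    using fin by (simp add: emeasure_eq_ennreal_measure less_top[symmetric])
  then have "measure lborel E powr c \<le> (measure U E powr (a / c) * measure V E powr (1 - a / c)) powr c"
    using c by (intro powr_mono2) auto
  also have "\<dots> = measure U E powr a * measure V E powr b"
  proof -
    have "a / c * c = a" "(1 - a / c) * c = b" using c by (auto simp: c_def field_simps)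
    then show ?thesis by (simp only: powr_mult powr_powr)
  qed
  finally show "measure lborel E powr (a + b) \<le> measure U E powr a * measure V E powr b"
    by (simp add: c_def)
qed

text \<open>Chaining the A condition on the ball, |B| \<le> K |E| and the reversed inequality on E
  gives U(B)^a V(B)^b \<le> C0 K^(a+b) U(E)^a V(E)^b. Replacing one of the two masses of E by that
  of B and cancelling leaves a bound for the other weight alone.\<close>

lemma weight_comparison:
  assumes [measurable]: "E \<in> sets borel" and E: "E \<subseteq> ball x r" and r: "r > 0"
    and K: "measure lborel (ball x r) \<le> K * measure lborel E"
  shows "measure U (ball x r) \<le> (C0 * K powr (a + b)) powr (1 / a) * measure U E"
    and "measure V (ball x r) \<le> (C0 * K powr (a + b)) powr (1 / b) * measure V E"
proof -
  let ?B = "ball x r"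
  have B: "measure lborel ?B > 0" using r by simp
  then have E0: "measure lborel E > 0" and K0: "K > 0"
    using less_le_trans[OF B K] measure_nonneg[of lborel E] by (auto simp: zero_less_mult_iff)
  note E1 = lebesgue_le_weights[OF _ E E0]
  have le: "measure U E \<le> measure U ?B" "measure V E \<le> measure V ?B"
    using E u_finite[of x r] v_finite[of x r] by (auto intro!: measure_mono_fmeasurable fmeasurableI)
  note pos = ball_measure_pos[OF r, of x]
  have "measure U ?B powr a * measure V ?B powr b \<le> C0 * measure lborel ?B powr (a + b)"
    by (rule A_condition[OF r])
  also have "\<dots> \<le> C0 * (K * measure lborel E) powr (a + b)"
    using K C0_pos a_pos b_pos by (intro mult_left_mono powr_mono2) auto
  also have "\<dots> = C0 * K powr (a + b) * measure lborel E powr (a + b)"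
    by (simp add: powr_mult)
  also have "\<dots> \<le> C0 * K powr (a + b) * (measure U E powr a * measure V E powr b)"
    using E1(3) C0_pos by (intro mult_left_mono) auto
  finally have main: "measure U ?B powr a * measure V ?B powr b \<le> C0 * K powr (a + b) * (measure U E powr a * measure V E powr b)" .
  have root: "s \<le> A powr (1 / e) * t" if "s powr e \<le> A * t powr e" "e > 0" "A \<ge> 0" "s \<ge> 0" "t \<ge> 0" for s t A e :: real
  proof -
    have "s = (s powr e) powr (1 / e)" using that by (simp add: powr_powr)
    also have "\<dots> \<le> (A * t powr e) powr (1 / e)" using that by (intro powr_mono2) auto
    also have "\<dots> = A powr (1 / e) * t" using that by (simp add: powr_mult powr_powr)
    finally show ?thesis .
  qed
  show "measure U ?B \<le> (C0 * K powr (a + b)) powr (1 / a) * measure U E"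
  proof (rule root)
    have "measure U ?B powr a * measure V ?B powr b \<le> C0 * K powr (a + b) * (measure U E powr a * measure V ?B powr b)"
      using main le b_pos C0_pos
      by (elim order_trans) (intro mult_left_mono powr_mono2, auto)
    then have "measure U ?B powr a * measure V ?B powr b \<le> (C0 * K powr (a + b) * measure U E powr a) * measure V ?B powr b"
      by (simp add: mult_ac)
    then show "measure U ?B powr a \<le> C0 * K powr (a + b) * measure U E powr a"
      by (rule mult_right_le_imp_le) (use pos in auto)
  qed (use a_pos C0_pos in auto)
  show "measure V ?B \<le> (C0 * K powr (a + b)) powr (1 / b) * measure V E"
  proof (rule root)
    have "measure U ?B powr a * measure V ?B powr b \<le> C0 * K powr (a + b) * (measure U ?B powr a * measure V E powr b)"
      using main le a_pos C0_pos
      by (elim order_trans) (intro mult_left_mono mult_right_mono powr_mono2, auto)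
    then have "measure V ?B powr b * measure U ?B powr a \<le> (C0 * K powr (a + b) * measure V E powr b) * measure U ?B powr a"
      by (simp add: mult_ac)
    then show "measure V ?B powr b \<le> C0 * K powr (a + b) * measure V E powr b"
      by (rule mult_right_le_imp_le) (use pos in auto)
  qed (use b_pos C0_pos in auto)
qed

definition "DU = (C0 * (2 powr DIM('a)) powr (a + b)) powr (1 / a)"
definition "DV = (C0 * (2 powr DIM('a)) powr (a + b)) powr (1 / b)"

lemma doubling_U_V:
  assumes r: "r > 0"
  shows "measure U (ball x (2 * r)) \<le> DU * measure U (ball x r)"
    and "measure V (ball x (2 * r)) \<le> DV * measure V (ball x r)"
proof -
  have "measure lborel (ball x (2 * r)) = 2 powr DIM('a) * measure lborel (ball x r)"
    using r by (simp add: measure_lborel_ball powr_mult del: content_ball)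
  then show "measure U (ball x (2 * r)) \<le> DU * measure U (ball x r)"
    and "measure V (ball x (2 * r)) \<le> DV * measure V (ball x r)"
    unfolding DU_def DV_def using r by (intro weight_comparison; auto)+
qed

sublocale U: doubling_measure U DU
proof
  fix x r assume r: "0 < (r :: real)"
  show "0 < emeasure U (ball x r)" 
    using ball_measure_pos[OF r, of x] u_finite[of x r] by (simp add: measure_def enn2real_positive_iff)
  show "emeasure U (ball x (2 * r)) \<le> ennreal DU * emeasure U (ball x r)"
    using doubling_U_V(1)[OF r, of x] u_finite[of x r] u_finite[of x "2 * r"]
    by (simp add: emeasure_eq_ennreal_measure less_top[symmetric] ennreal_mult[symmetric] DU_def)
qed (auto simp: u_finite)

sublocale V: doubling_measure V DV
proof
  fix x r assume r: "0 < (r :: real)"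
  show "0 < emeasure V (ball x r)" 
    using ball_measure_pos[OF r, of x] v_finite[of x r] by (simp add: measure_def enn2real_positive_iff)
  show "emeasure V (ball x (2 * r)) \<le> ennreal DV * emeasure V (ball x r)"
    using doubling_U_V(2)[OF r, of x] v_finite[of x r] v_finite[of x "2 * r"]
    by (simp add: emeasure_eq_ennreal_measure less_top[symmetric] ennreal_mult[symmetric] DV_def)
qed (auto simp: v_finite)

text \<open>The annulus 2B - B fills a fixed proportion of 2B in volume, so U(2B) \<le> K U(2B - B)
  = K (U(2B) - U(B)), which rearranges to U(B) \<le> (1 - 1/K) U(2B).\<close>

lemma reverse_doubling:
  "\<exists>\<delta>. 0 < \<delta> \<and> \<delta> < 1 \<and> (\<forall>x. \<forall>r>0. measure U (ball x r) \<le> \<delta> * measure U (ball x (2 * r)))"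
proof -
  \<comment> \<open>2^n / (2^n - 1) is the volume of 2B divided by that of the annulus. The added 1
    ensures K > 1, so that 1 - 1/K lies strictly between 0 and 1.\<close>
  define K where "K = 1 + (C0 * (2 powr DIM('a) / (2 powr DIM('a) - 1)) powr (a + b)) powr (1 / a)"
  have n1: "2 powr DIM('a) > (1::real)" using powr_less_mono[of 0 "real DIM('a)" 2] by simp
  have K: "K > 1" using C0_pos n1 by (auto simp: K_def)
  have "measure U (ball x r) \<le> (1 - 1 / K) * measure U (ball x (2 * r))" if r: "r > 0" for x r
  proof -
    let ?E = "ball x (2 * r) - ball x r"
    have sub: "ball x r \<subseteq> ball x (2 * r)" using r by auto
    have L: "measure lborel (ball x (2 * r)) = 2 powr DIM('a) * measure lborel (ball x r)"
      using r by (simp add: measure_lborel_ball powr_mult del: content_ball)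
    have diff: "measure lborel ?E = measure lborel (ball x (2 * r)) - measure lborel (ball x r)"
      using sub emeasure_lborel_ball_finite[of x "2 * r"] by (intro measure_Diff) auto
    have le: "measure lborel (ball x (2 * r)) \<le> 2 powr DIM('a) / (2 powr DIM('a) - 1) * measure lborel ?E"
    proof -
      have "measure lborel ?E = (2 powr DIM('a) - 1) * measure lborel (ball x r)"
        using diff by (simp only: L left_diff_distrib mult_1)
      then show ?thesis using n1 by (simp only: L) simp
    qed
    from weight_comparison(1)[OF _ _ _ le] r
    have "measure U (ball x (2 * r)) \<le> (C0 * (2 powr DIM('a) / (2 powr DIM('a) - 1)) powr (a + b)) powr (1 / a) * measure U ?E"
      by simp
    also have "\<dots> \<le> K * measure U ?E"
      unfolding K_def by (intro mult_right_mono) auto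
    also have "measure U ?E = measure U (ball x (2 * r)) - measure U (ball x r)"
      using sub u_finite[of x "2 * r"] by (intro measure_Diff) auto
    finally show ?thesis using K by (simp add: field_simps)
  qed
  then show ?thesis using K by (intro exI[of _ "1 - 1 / K"]) auto
qed

end

section \<open>The Riesz potential and its stopping scales\<close>

text \<open>With e = n - \<gamma> this is the Riesz potential of order \<gamma> without its
  normalizing constant. On the diagonal the kernel takes the default value
  \<open>0 powr (- e) = 0\<close>, which affects a null set only.\<close>

definition riesz :: "real \<Rightarrow> ('a::euclidean_space \<Rightarrow> ennreal) \<Rightarrow> 'a \<Rightarrow> ennreal" where
  "riesz e f x = (\<integral>\<^sup>+y. ennreal (dist x y powr (- e)) * f y \<partial>lborel)"

lemma riesz_measurable [measurable]:
  assumes [measurable]: "f \<in> borel_measurable borel"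
  shows "riesz e f \<in> borel_measurable borel"
  unfolding riesz_def by measurable

interpretation Leb: doubling_measure "lborel :: 'a::euclidean_space measure" "2 ^ DIM('a)"
  by (rule doubling_measure_lborel)

lemma emeasure_lborel_ball_eq:
  fixes x :: "'a::euclidean_space"
  assumes "r > 0"
  shows "emeasure lborel (ball x r) = ennreal (unit_ball_vol DIM('a) * r powr DIM('a))"
  using assms by (simp add: emeasure_ball powr_realpow)

text \<open>The ball around x lies in the ball of twice the radius around z, and 2^n is the ratio of
  their volumes.\<close>

lemma Leb_average_shift:
  fixes x z :: "'a::euclidean_space"
  assumes "dist x z < 2 powr real_of_int k"
  shows "Leb.average f k x \<le> ennreal (2 powr DIM('a)) * Leb.average f (k + 1) z"
proof -
  have e: "2 powr (real_of_int k + 1) = 2 * 2 powr real_of_int k"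
    by (simp add: powr_add)
  have "(\<integral>\<^sup>+y\<in>ball x (2 powr k). f y \<partial>lborel) \<le> (\<integral>\<^sup>+y\<in>ball z (2 powr (k + 1)). f y \<partial>lborel)"
  proof (intro nn_integral_mono mult_left_mono)
    fix y
    have "dist z y \<le> dist x z + dist x y" by (metis dist_commute dist_triangle)
    then show "indicator (ball x (2 powr k)) y \<le> (indicator (ball z (2 powr (k + 1))) y :: ennreal)"
      using assms by (auto simp: indicator_def e)
  qed simp
  also have "\<dots> = Leb.average f (k + 1) z * ennreal (2 powr DIM('a) * (unit_ball_vol DIM('a) * (2 powr k) powr DIM('a)))"
    by (subst Leb.nn_integral_eq_average) (simp add: emeasure_lborel_ball_eq powr_mult e mult_ac)
  also have "\<dots> = ennreal (2 powr DIM('a)) * Leb.average f (k + 1) z * emeasure lborel (ball x (2 powr k))"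
    by (simp add: emeasure_lborel_ball_eq ennreal_mult mult_ac)
  finally have "Leb.average f k x \<le> ennreal (2 powr DIM('a)) * Leb.average f (k + 1) z * emeasure lborel (ball x (2 powr k))
      / emeasure lborel (ball x (2 powr k))"
    unfolding Leb.average_def[of f k x] by (rule divide_right_mono_ennreal)
  also have "\<dots> = ennreal (2 powr DIM('a)) * Leb.average f (k + 1) z"
    using Leb.ball_pos[of "2 powr k" x] Leb.ball_finite[of x "2 powr k"]
    by (intro mult_divide_eq_ennreal) auto
  finally show ?thesis .
qed

text \<open>An average is at most the total integral divided by the volume of the ball. This is
  where integrability of f yields a largest scale at each level.\<close>

lemma Leb_average_bounded_scale:
  fixes f :: "'a::euclidean_space \<Rightarrow> ennreal"
  assumes fin: "(\<integral>\<^sup>+y. f y \<partial>lborel) < top"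
  shows "\<exists>K. \<forall>x k. ennreal (2 powr real_of_int m) < Leb.average f k x \<longrightarrow> k \<le> K"
proof -
  obtain R where R: "(\<integral>\<^sup>+y. f y \<partial>lborel) = ennreal R" "R \<ge> 0"
    using fin by (cases "\<integral>\<^sup>+y. f y \<partial>lborel") auto
  let ?w = "unit_ball_vol DIM('a)"
  \<comment> \<open>The added 1 makes log 2 S non-negative, which settles negative k; for k \<ge> 0
    one passes from k n \<le> log 2 S to k \<le> log 2 S.\<close>
  define S where "S = R / (2 powr real_of_int m * ?w) + 1"
  have S: "S \<ge> 1" using R by (simp add: S_def)
  have "k \<le> \<lceil>log 2 S\<rceil>" if k: "ennreal (2 powr real_of_int m) < Leb.average f k x" for x k
  proof -
    have "ennreal (2 powr real_of_int m) * emeasure lborel (ball x (2 powr k)) \<le> (\<integral>\<^sup>+y\<in>ball x (2 powr k). f y \<partial>lborel)"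
      unfolding Leb.nn_integral_eq_average using k by (intro mult_right_mono) auto
    also have "\<dots> \<le> (\<integral>\<^sup>+y. f y \<partial>lborel)"
      by (intro nn_integral_mono) (auto simp: indicator_def)
    finally have "2 powr real_of_int m * (?w * (2 powr k) powr DIM('a)) \<le> R"
      using R by (simp add: emeasure_lborel_ball_eq ennreal_mult[symmetric])
    then have "2 powr (real_of_int k * DIM('a)) \<le> R / (2 powr real_of_int m * ?w)"
      by (simp add: powr_powr field_simps)
    also have "\<dots> \<le> S" by (simp add: S_def)
    finally have *: "real_of_int k * DIM('a) \<le> log 2 S"
      using S by (simp add: le_log_iff)
    have "real_of_int k \<le> log 2 S"
    proof (cases "k \<ge> 0")
      case True
      then have "real_of_int k * 1 \<le> real_of_int k * DIM('a)"
        using DIM_positive[where 'a='a] by (intro mult_left_mono) (auto simp: Suc_le_eq)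
      then show ?thesis using * by simp
    next
      case False
      then have "real_of_int k \<le> 0" by simp
      also have "0 \<le> log 2 S" using S by simp
      finally show ?thesis .
    qed
    then show ?thesis by linarith
  qed
  then show ?thesis by blast
qed

text \<open>Each y \<noteq> x has 2^(k-1) \<le> |x - y| < 2^k for some k, and there the kernel is at
  most 2^(e - e k). The single term with this k dominates the integrand.\<close>

lemma riesz_le_dyadic:
  fixes f :: "'a::euclidean_space \<Rightarrow> ennreal"
  assumes [measurable]: "f \<in> borel_measurable borel" and e: "e > 0"
  shows "riesz e f x \<le> (\<integral>\<^sup>+k. ennreal (2 powr (e - e * real_of_int k)) *
      (\<integral>\<^sup>+y\<in>ball x (2 powr real_of_int k). f y \<partial>lborel) \<partial>count_space UNIV)"
proof -
  have "riesz e f x \<le> (\<integral>\<^sup>+y. (\<integral>\<^sup>+k. ennreal (2 powr (e - e * real_of_int k)) *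
      (f y * indicator (ball x (2 powr real_of_int k)) y) \<partial>count_space UNIV) \<partial>lborel)"
    unfolding riesz_def
  proof (intro nn_integral_mono)
    fix y
    show "ennreal (dist x y powr (- e)) * f y \<le> (\<integral>\<^sup>+k. ennreal (2 powr (e - e * real_of_int k)) *
      (f y * indicator (ball x (2 powr real_of_int k)) y) \<partial>count_space UNIV)"
    proof (cases "x = y")
      case False
      define d where "d = dist x y"
      have d: "d > 0" using False by (simp add: d_def)
      define k where "k = \<lfloor>log 2 d\<rfloor> + 1"
      have "log 2 d < real_of_int k" "real_of_int k - 1 \<le> log 2 d"
        unfolding k_def by linarith+
      then have k: "d < 2 powr real_of_int k" "2 powr (real_of_int k - 1) \<le> d"
        using d by (simp_all add: log_less_iff le_log_iff)
      have "d powr (- e) \<le> (2 powr (real_of_int k - 1)) powr (- e)"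
        using k e by (intro powr_mono2') auto
      also have "\<dots> = 2 powr (e - e * real_of_int k)"
        by (simp add: powr_powr algebra_simps)
      finally have "ennreal (d powr (- e)) * f y \<le> ennreal (2 powr (e - e * real_of_int k)) *
         (f y * indicator (ball x (2 powr real_of_int k)) y)"
        using k by (auto intro!: mult_right_mono ennreal_leI simp: d_def)
      also have "\<dots> \<le> (\<integral>\<^sup>+k. ennreal (2 powr (e - e * real_of_int k)) *
         (f y * indicator (ball x (2 powr real_of_int k)) y) \<partial>count_space UNIV)"
        by (rule nn_integral_ge_point) simp
      finally show ?thesis by (simp add: d_def)
    qed simp
  qed
  also have "\<dots> = (\<integral>\<^sup>+k. ennreal (2 powr (e - e * real_of_int k)) *
      (\<integral>\<^sup>+y\<in>ball x (2 powr real_of_int k). f y \<partial>lborel) \<partial>count_space UNIV)"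
    by (subst nn_integral_count_space_swap[OF countableI_type lborel.sigma_finite_measure_axioms])
       (auto simp: nn_integral_cmult)
  finally show ?thesis .
qed

text \<open>
  Only scales up to the stopping scale at level 2^m contribute, so for g > 0 this geometric sum is
  comparable to its last term.
\<close>

definition scale_sum :: "('a::euclidean_space \<Rightarrow> ennreal) \<Rightarrow> real \<Rightarrow> int \<Rightarrow> 'a \<Rightarrow> ennreal" where
  "scale_sum f g m x = (\<integral>\<^sup>+k. ennreal (2 powr (g * real_of_int k)) *
      indicator {k. ennreal (2 powr real_of_int m) < Leb.average f k x} k \<partial>count_space UNIV)"

lemma scale_sum_measurable [measurable]:
  assumes [measurable]: "f \<in> borel_measurable borel"
  shows "scale_sum f g m \<in> borel_measurable borel"
proof -
  have "(\<lambda>x. ennreal (2 powr (g * real_of_int k)) *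
      indicator {x. ennreal (2 powr real_of_int m) < Leb.average f k x} x) \<in> borel_measurable borel" for k
    by measurable
  then show ?thesis
    unfolding scale_sum_def by (intro borel_measurable_nn_integral_count_space) (auto simp: indicator_def)
qed

text \<open>In the sum over scales k, each average over the ball of radius 2^k is expanded into the
  levels 2^m below it (\<open>epowr_le_dyadic_sum\<close> with exponent 1). Exchanging the two sums
  leaves, for each level, the scales whose average exceeds it.\<close>

lemma riesz_le_levels:
  fixes f :: "'a::euclidean_space \<Rightarrow> ennreal" and e :: real
  assumes [measurable]: "f \<in> borel_measurable borel" and e: "e > 0"
  shows "riesz e f x \<le> (\<integral>\<^sup>+m. ennreal (2 powr (e + 1) * unit_ball_vol DIM('a) * 2 powr real_of_int m)
       * scale_sum f (real DIM('a) - e) m x \<partial>count_space UNIV)"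
proof -
  let ?w = "unit_ball_vol (real DIM('a))"
  let ?c = "\<lambda>m k. ennreal (2 powr (e + 1) * ?w * 2 powr real_of_int m) * (ennreal (2 powr ((real DIM('a) - e) * real_of_int k)) *
      indicator {k. ennreal (2 powr real_of_int m) < Leb.average f k x} k)"
  have "riesz e f x \<le> (\<integral>\<^sup>+k. ennreal (2 powr (e - e * real_of_int k)) *
      (\<integral>\<^sup>+y\<in>ball x (2 powr real_of_int k). f y \<partial>lborel) \<partial>count_space UNIV)"
    using e by (intro riesz_le_dyadic) auto
  also have "\<dots> \<le> (\<integral>\<^sup>+k. (\<integral>\<^sup>+m. ?c m k \<partial>count_space UNIV) \<partial>count_space UNIV)"
  proof (intro nn_integral_mono)
    fix k :: int
    let ?F = "Leb.average f k x"
    have eq: "2 powr (e - e * real_of_int k) * (?w * (2 powr real_of_int k) powr DIM('a))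
        = 2 powr e * ?w * 2 powr ((real DIM('a) - e) * real_of_int k)"
    proof -
      have "2 powr (e - e * real_of_int k) * (2 powr real_of_int k) powr DIM('a) = 2 powr e * (2::real) powr ((real DIM('a) - e) * real_of_int k)"
        by (simp add: powr_powr powr_add[symmetric] algebra_simps)
      then show ?thesis by (simp add: mult_ac)
    qed
    have "ennreal (2 powr (e - e * real_of_int k)) * (\<integral>\<^sup>+y\<in>ball x (2 powr real_of_int k). f y \<partial>lborel)
       = ennreal (2 powr e * ?w * 2 powr ((real DIM('a) - e) * real_of_int k)) * epowr ?F 1"
      unfolding Leb.nn_integral_eq_average eq[symmetric]
      by (simp add: emeasure_lborel_ball_eq ennreal_mult mult_ac)
    also have "\<dots> \<le> ennreal (2 powr e * ?w * 2 powr ((real DIM('a) - e) * real_of_int k)) *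
        (\<integral>\<^sup>+m. ennreal (2 powr (1 * (real_of_int m + 1))) * indicator {m. ennreal (2 powr real_of_int m) < ?F} m \<partial>count_space UNIV)"
      by (intro mult_left_mono epowr_le_dyadic_sum) auto
    also have "\<dots> = (\<integral>\<^sup>+m. ?c m k \<partial>count_space UNIV)"
      by (subst nn_integral_cmult[symmetric])
         (auto intro!: nn_integral_cong simp: indicator_def ennreal_mult[symmetric] powr_add mult_ac)
    finally show "ennreal (2 powr (e - e * real_of_int k)) * (\<integral>\<^sup>+y\<in>ball x (2 powr real_of_int k). f y \<partial>lborel)
       \<le> (\<integral>\<^sup>+m. ?c m k \<partial>count_space UNIV)" .
  qed
  also have "\<dots> = (\<integral>\<^sup>+m. (\<integral>\<^sup>+k. ?c m k \<partial>count_space UNIV) \<partial>count_space UNIV)"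
    by (rule nn_integral_count_space_swap) (auto intro: sigma_finite_measure_count_space)
  also have "\<dots> = (\<integral>\<^sup>+m. ennreal (2 powr (e + 1) * ?w * 2 powr real_of_int m)
       * scale_sum f (real DIM('a) - e) m x \<partial>count_space UNIV)"
    unfolding scale_sum_def by (simp add: nn_integral_cmult)
  finally show ?thesis .
qed

text \<open>Produces the sparse family of one level m, with E j the ball minus the set where the
  maximal function exceeds 2^(m+N). The bounds 2^(m-n) < M f \<le> 2^(m+N) on E j are what later
  limits the overlap between different levels. G is arbitrary here because it carries the test
  function of the bilinear form together with its weight.\<close>

lemma level_covering:
  fixes f G :: "'a::euclidean_space \<Rightarrow> ennreal" and m :: int and g :: real
  assumes [measurable]: "f \<in> borel_measurable borel" "G \<in> borel_measurable borel"
    and fin: "(\<integral>\<^sup>+y. f y \<partial>lborel) < top" and g: "g > 0"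
  defines "N \<equiv> 4 * int DIM('a) + 1"
  obtains J and \<kappa> :: "'a \<Rightarrow> int" and E :: "'a \<Rightarrow> 'a set"
  where "countable J"
    and "\<And>j. j \<in> J \<Longrightarrow> ennreal (2 powr real_of_int m) < Leb.average f (\<kappa> j) j"
    and "\<And>j. j \<in> J \<Longrightarrow> E j \<in> sets borel"
    and "\<And>j. j \<in> J \<Longrightarrow> E j \<subseteq> ball j (2 powr \<kappa> j)"
    and "\<And>j. j \<in> J \<Longrightarrow> measure lborel (ball j (2 powr \<kappa> j)) \<le> 2 * measure lborel (E j)"
    and "\<And>j. j \<in> J \<Longrightarrow> E j \<subseteq> {x. ennreal (2 powr (real_of_int m - DIM('a))) < Leb.maximal f x \<and>
            Leb.maximal f x \<le> ennreal (2 powr real_of_int (m + N))}"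
    and "\<And>i j. i \<in> J \<Longrightarrow> j \<in> J \<Longrightarrow> i \<noteq> j \<Longrightarrow> E i \<inter> E j = {}"
    and "(\<integral>\<^sup>+x. scale_sum f g m x * G x \<partial>lborel) \<le>
      (\<integral>\<^sup>+j. ennreal (5 powr g / (1 - 2 powr (- g)) * 2 powr (g * real_of_int (\<kappa> j))) *
         (\<integral>\<^sup>+x\<in>ball j (2 powr (real_of_int (\<kappa> j) + 3)). G x \<partial>lborel) \<partial>count_space J)"
proof -
  define \<Omega> where "\<Omega> = {x. ennreal (2 powr real_of_int m) < Leb.maximal f x}"
  obtain K where K: "\<And>x k. ennreal (2 powr real_of_int m) < Leb.average f k x \<Longrightarrow> k \<le> K"
    using Leb_average_bounded_scale[OF fin, of m] by blast
  have "\<exists>k. ennreal (2 powr real_of_int m) < Leb.average f k x \<and>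
      (\<forall>k'. ennreal (2 powr real_of_int m) < Leb.average f k' x \<longrightarrow> k' \<le> k)" if x\<Omega>: "x \<in> \<Omega>" for x
  proof -
    \<comment> \<open>The admissible scales are bounded above by K; counting downwards from K turns
      the largest one into a \<open>LEAST\<close> natural number.\<close>
    let ?P = "\<lambda>i. ennreal (2 powr real_of_int m) < Leb.average f (K - int i) x"
    obtain k where k: "ennreal (2 powr real_of_int m) < Leb.average f k x"
      using x\<Omega> by (auto simp: \<Omega>_def Leb.maximal_def less_SUP_iff)
    have ex: "?P (nat (K - k))" using k K[OF k] by simp
    define i where "i = (LEAST i. ?P i)"
    have "?P i" unfolding i_def by (rule LeastI[of ?P, OF ex])
    moreover have "k' \<le> K - int i" if k': "ennreal (2 powr real_of_int m) < Leb.average f k' x" for k'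
    proof -
      have "i \<le> nat (K - k')" unfolding i_def using k' K[OF k'] by (intro Least_le) simp
      then show ?thesis using K[OF k'] by linarith
    qed
    ultimately show ?thesis by blast
  qed
  then obtain \<kappa> where \<kappa>: "\<And>x. x \<in> \<Omega> \<Longrightarrow> ennreal (2 powr real_of_int m) < Leb.average f (\<kappa> x) x"
      and \<kappa>_max: "\<And>x k. x \<in> \<Omega> \<Longrightarrow> ennreal (2 powr real_of_int m) < Leb.average f k x \<Longrightarrow> k \<le> \<kappa> x"
    by metis
  define r where "r x = 2 powr real_of_int (\<kappa> x)" for x
  have r_pos [simp]: "r x > 0" for x by (simp add: r_def)
  have r: "0 < r x \<and> r x \<le> 2 powr K" if "x \<in> \<Omega>" for x
    using K[OF \<kappa>[OF that]] by (auto simp: r_def)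
  obtain J where J: "countable J" "J \<subseteq> \<Omega>"
      and disj: "pairwise (\<lambda>i j. disjnt (cball i (r i)) (cball j (r j))) J"
      and cov: "\<And>i. i \<in> \<Omega> \<Longrightarrow> \<exists>j. j \<in> J \<and> \<not> disjnt (cball i (r i)) (cball j (r j)) \<and> cball i (r i) \<subseteq> ball j (5 * r j)"
    by (rule Vitali_covering_lemma_cballs_balls[where a="\<lambda>x. x", OF r]) (assumption, rule that)
  define \<Omega>' where "\<Omega>' = {x. ennreal (2 powr real_of_int (m + N)) < Leb.maximal f x}"
  define E where "E j = ball j (r j) - \<Omega>'" for j
  have [measurable]: "\<Omega> \<in> sets borel" "\<Omega>' \<in> sets borel" "E j \<in> sets borel" for j
    unfolding \<Omega>_def \<Omega>'_def E_def by measurable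
  have large: "measure lborel (ball j (r j)) \<le> 2 * measure lborel (E j)" if j: "j \<in> J" for j
  proof -
    \<comment> \<open>This is 2B_j. If x in B_j has an average above 2^(m+N) at scale k, then k is
      below the stopping scale of j: otherwise shifting to the centre would give a larger scale at j
      with average above 2^m. The ball around x then lies in 2B_j, so the weak type inequality may
      be applied to f restricted to 2B_j, whose mass is at most 2^m |2B_j| by maximality of the
      stopping scale.\<close>
    let ?B = "ball j (2 powr real_of_int (\<kappa> j + 1))"
    let ?f = "\<lambda>y. f y * indicator ?B y"
    have j\<Omega>: "j \<in> \<Omega>" using j J by auto
    have top: "Leb.average f k j \<le> ennreal (2 powr real_of_int m)" if "k > \<kappa> j" for k
      using \<kappa>_max[OF j\<Omega>, of k] that by (meson not_le)
    have sub: "ball j (r j) \<inter> \<Omega>' \<subseteq> {x. ennreal (2 powr real_of_int (m + N)) < Leb.maximal ?f x}"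
    proof safe
      fix x assume x: "x \<in> ball j (r j)" "x \<in> \<Omega>'"
      then obtain k where k: "ennreal (2 powr real_of_int (m + N)) < Leb.average f k x"
        by (auto simp: \<Omega>'_def Leb.maximal_def less_SUP_iff)
      have "k < \<kappa> j"
      proof (rule ccontr)
        assume "\<not> k < \<kappa> j"
        then have "2 powr real_of_int (\<kappa> j) \<le> 2 powr real_of_int k" by simp
        moreover have "dist x j < 2 powr real_of_int (\<kappa> j)"
          using x by (simp add: r_def dist_commute)
        ultimately have "dist x j < 2 powr real_of_int k" by linarith
        then have "Leb.average f k x \<le> ennreal (2 powr DIM('a)) * Leb.average f (k + 1) j"
          by (rule Leb_average_shift)
        also have "\<dots> \<le> ennreal (2 powr DIM('a)) * ennreal (2 powr real_of_int m)"
          using \<open>\<not> k < \<kappa> j\<close> by (intro mult_left_mono top) auto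
        also have "\<dots> = ennreal (2 powr (real DIM('a) + real_of_int m))"
          by (simp add: ennreal_mult[symmetric] powr_add)
        also have "\<dots> \<le> ennreal (2 powr real_of_int (m + N))"
          by (intro ennreal_leI powr_mono) (auto simp: N_def)
        finally show False using k by simp
      qed
      then have "2 powr real_of_int k \<le> 2 powr real_of_int (\<kappa> j)" by simp
      moreover have "dist x j < 2 powr real_of_int (\<kappa> j)"
        using x by (simp add: r_def dist_commute)
      ultimately have "dist x j + 2 powr real_of_int k \<le> 2 powr real_of_int (\<kappa> j) + 2 powr real_of_int (\<kappa> j)"
        by linarith
      then have "ball x (2 powr real_of_int k) \<subseteq> ball j (2 powr real_of_int (\<kappa> j) + 2 powr real_of_int (\<kappa> j))"
        by (subst ball_subset_ball_iff) blast
      then have "ball x (2 powr real_of_int k) \<subseteq> ?B"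
        by (simp add: powr_add mult.commute)
      then have "Leb.average f k x = Leb.average ?f k x"
        unfolding Leb.average_def
        by (intro arg_cong2[where f="(/)"] nn_integral_cong) (auto simp: indicator_def)
      also have "\<dots> \<le> Leb.maximal ?f x" by (rule Leb.average_le_maximal)
      finally show "ennreal (2 powr real_of_int (m + N)) < Leb.maximal ?f x"
        using k by simp
    qed
    have [measurable]: "?f \<in> borel_measurable borel" by measurable
    let ?w = "unit_ball_vol (real DIM('a))"
    let ?M = "emeasure lborel (ball j (r j) \<inter> \<Omega>')"
    have "ennreal (2 powr real_of_int (m + N)) * ?M \<le> ennreal (2 powr real_of_int (m + N)) *
        emeasure lborel {x. ennreal (2 powr real_of_int (m + N)) < Leb.maximal ?f x}"
      using sub by (intro mult_left_mono emeasure_mono) auto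
    also have "\<dots> \<le> ennreal ((2 ^ DIM('a)) ^ 3) * (\<integral>\<^sup>+y\<in>?B. f y \<partial>lborel)"
      by (rule Leb.weak_type) auto
    also have "\<dots> = ennreal ((2 ^ DIM('a)) ^ 3) * (Leb.average f (\<kappa> j + 1) j * emeasure lborel ?B)"
      by (simp only: Leb.nn_integral_eq_average)
    also have "\<dots> \<le> ennreal ((2 ^ DIM('a)) ^ 3) * (ennreal (2 powr real_of_int m) * emeasure lborel ?B)"
      by (intro mult_left_mono mult_right_mono top) auto
    also have "emeasure lborel ?B = ennreal (2 powr DIM('a)) * emeasure lborel (ball j (r j))"
      by (simp add: emeasure_lborel_ball_eq ennreal_mult[symmetric] r_def powr_add powr_mult mult_ac)
    also have "emeasure lborel (ball j (r j)) = ennreal (measure lborel (ball j (r j)))"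
      using emeasure_lborel_ball_finite[of j "r j"] by (intro emeasure_eq_ennreal_measure) auto
    also have "?M = ennreal (measure lborel (ball j (r j) \<inter> \<Omega>'))"
      using emeasure_lborel_ball_finite[of j "r j"] emeasure_mono[of "ball j (r j) \<inter> \<Omega>'" "ball j (r j)" lborel]
      by (intro emeasure_eq_ennreal_measure) (auto simp: top_unique)
    finally have "2 powr real_of_int (m + N) * measure lborel (ball j (r j) \<inter> \<Omega>')
       \<le> (2 ^ DIM('a)) ^ 3 * (2 powr real_of_int m * (2 powr DIM('a) * measure lborel (ball j (r j))))"
      by (simp add: ennreal_mult[symmetric])
    \<comment> \<open>N = 4n + 1 is chosen for this identity: 3n from the weak type constant, n from
      the volume of 2B_j relative to B_j, and 1 for the factor 1/2.\<close>
    also have "\<dots> = 2 powr real_of_int (m + N) * (measure lborel (ball j (r j)) / 2)"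
    proof -
      have "((2::real) ^ DIM('a)) ^ 3 = 2 powr (3 * real DIM('a))"
        by (simp add: powr_realpow[symmetric] powr_powr mult.commute)
      then have "((2::real) ^ DIM('a)) ^ 3 * 2 powr real_of_int m * 2 powr DIM('a) * 2 = 2 powr real_of_int (m + N)"
        by (simp add: N_def powr_add[symmetric] powr_mult_base algebra_simps)
      then show ?thesis by (simp only: mult.assoc[symmetric]) simp
    qed
    finally have half: "measure lborel (ball j (r j) \<inter> \<Omega>') \<le> measure lborel (ball j (r j)) / 2"
      by simp
    have "measure lborel (E j) = measure lborel (ball j (r j)) - measure lborel (ball j (r j) \<inter> \<Omega>')"
      unfolding E_def using emeasure_lborel_ball_finite[of j "r j"]
      by (subst measure_Diff[symmetric]) (auto simp: Diff_Int)
    with half show ?thesis by simp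
  qed
  \<comment> \<open>Moving the centre of the average from j to x costs the factor 2^n, hence the
    level m - n.\<close>
  have lower: "ennreal (2 powr (real_of_int m - DIM('a))) < Leb.maximal f x" if j: "j \<in> J" and x: "x \<in> ball j (r j)" for j x
  proof (rule ccontr)
    assume "\<not> ?thesis"
    then have le: "Leb.average f (\<kappa> j + 1) x \<le> ennreal (2 powr (real_of_int m - DIM('a)))"
      using Leb.average_le_maximal[of f "\<kappa> j + 1" x] by (auto simp: not_less intro: order_trans)
    have "ennreal (2 powr real_of_int m) < Leb.average f (\<kappa> j) j" using \<kappa> j J by auto
    also have "\<dots> \<le> ennreal (2 powr DIM('a)) * Leb.average f (\<kappa> j + 1) x"
      using x by (intro Leb_average_shift) (simp add: r_def)
    also have "\<dots> \<le> ennreal (2 powr DIM('a)) * ennreal (2 powr (real_of_int m - DIM('a)))"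
      using le by (rule mult_left_mono) simp
    also have "\<dots> = ennreal (2 powr real_of_int m)"
      by (simp add: ennreal_mult[symmetric] powr_add[symmetric])
    finally show False by simp
  qed
  let ?c = "\<lambda>j. ennreal (5 powr g / (1 - 2 powr (- g)) * 2 powr (g * real_of_int (\<kappa> j)))"
  let ?B8 = "\<lambda>j. ball j (2 powr (real_of_int (\<kappa> j) + 3))"
  \<comment> \<open>A point x of \<Omega> whose own ball was not selected has that ball inside some
    5B_j. Its stopping radius is then at most 5 times that of j, which bounds its scale sum by
    \<open>?c j\<close>. The dilation 5 is rounded up to 8 to keep radii dyadic.\<close>
  let ?A = "\<lambda>j. ?B8 j \<inter> {x. scale_sum f g m x \<le> ?c j}"
  have lt: "2 powr (- g) < (1::real)" using g powr_less_mono[of "- g" 0 2] by simp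
  have cover: "\<Omega> \<subseteq> (\<Union>j\<in>J. ?A j)"
  proof
    fix x assume x: "x \<in> \<Omega>"
    obtain j where j: "j \<in> J" "cball x (r x) \<subseteq> ball j (5 * r j)" using cov[OF x] by auto
    then have "dist x j + r x < 5 * r j"
      using r_pos[of x] unfolding cball_subset_ball_iff by linarith
    then have d: "dist j x < 8 * r j" and rr: "r x \<le> 5 * r j"
      using r_pos[of x] r_pos[of j] zero_le_dist[of x j] unfolding dist_commute[of j x] by linarith+
    have "scale_sum f g m x \<le> (\<integral>\<^sup>+k. ennreal (2 powr (g * real_of_int k)) * indicator {..\<kappa> x} k \<partial>count_space UNIV)"
      unfolding scale_sum_def using \<kappa>_max[OF x]
      by (intro nn_integral_mono mult_left_mono) (auto simp: indicator_def)
    also have "\<dots> = ennreal (2 powr (g * real_of_int (\<kappa> x)) / (1 - 2 powr (- g)))"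
      using nn_integral_geometric_atMost[OF g, of "\<kappa> x"] by (simp add: nn_integral_count_space_indicator)
    also have "\<dots> \<le> ?c j"
    proof (intro ennreal_leI)
      have "2 powr (g * real_of_int (\<kappa> x)) = r x powr g" by (simp add: r_def powr_powr mult.commute)
      also have "\<dots> \<le> (5 * r j) powr g" using rr g by (intro powr_mono2) (auto simp: less_imp_le)
      also have "\<dots> = 5 powr g * 2 powr (g * real_of_int (\<kappa> j))"
        by (simp add: r_def powr_mult powr_powr mult.commute)
      finally show "2 powr (g * real_of_int (\<kappa> x)) / (1 - 2 powr (- g)) \<le> 5 powr g / (1 - 2 powr (- g)) * 2 powr (g * real_of_int (\<kappa> j))"
        using lt by (simp add: divide_right_mono)
    qed
    finally have "x \<in> ?A j" using d by (simp add: r_def powr_add mult.commute)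
    then show "x \<in> (\<Union>j\<in>J. ?A j)" using j by blast
  qed
  have zero: "scale_sum f g m x = 0" if "x \<notin> \<Omega>" for x
  proof -
    have "\<not> ennreal (2 powr real_of_int m) < Leb.average f k x" for k
      using that Leb.average_le_maximal[of f k x] by (auto simp: \<Omega>_def)
    then show ?thesis by (simp add: scale_sum_def)
  qed
  show ?thesis
  proof (rule that)
    show "countable J" by fact
    show "ennreal (2 powr real_of_int m) < Leb.average f (\<kappa> j) j" if "j \<in> J" for j
      using that J \<kappa> by auto
    show "E j \<in> sets borel" for j by measurable
    show "E j \<subseteq> ball j (2 powr \<kappa> j)" for j by (auto simp: E_def r_def)
    show "measure lborel (ball j (2 powr \<kappa> j)) \<le> 2 * measure lborel (E j)" if "j \<in> J" for j
      using large[OF that] by (simp only: r_def)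
    show "E j \<subseteq> {x. ennreal (2 powr (real_of_int m - DIM('a))) < Leb.maximal f x \<and>
            Leb.maximal f x \<le> ennreal (2 powr real_of_int (m + N))}" if "j \<in> J" for j
      using lower[OF that] by (auto simp: E_def \<Omega>'_def not_less)
    show "E i \<inter> E j = {}" if "i \<in> J" "j \<in> J" "i \<noteq> j" for i j
    proof -
      have "disjnt (cball i (r i)) (cball j (r j))" using disj that by (auto simp: pairwise_def)
      then show ?thesis
        using ball_subset_cball[of i "r i"] ball_subset_cball[of j "r j"] unfolding disjnt_def E_def by blast
    qed
    have "(\<integral>\<^sup>+x. scale_sum f g m x * G x \<partial>lborel) = (\<integral>\<^sup>+x\<in>\<Omega>. (scale_sum f g m x * G x) \<partial>lborel)"
      using zero by (intro nn_integral_cong) (auto simp: indicator_def)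
    also have "\<dots> \<le> (\<integral>\<^sup>+j. (\<integral>\<^sup>+x\<in>?A j. (scale_sum f g m x * G x) \<partial>lborel) \<partial>count_space J)"
      using J cover by (intro nn_integral_UN_le lborel.sigma_finite_measure_axioms) auto
    also have "\<dots> \<le> (\<integral>\<^sup>+j. ?c j * (\<integral>\<^sup>+x\<in>?B8 j. G x \<partial>lborel) \<partial>count_space J)"
    proof (intro nn_integral_mono)
      fix j
      have "(\<integral>\<^sup>+x\<in>?A j. (scale_sum f g m x * G x) \<partial>lborel) \<le> (\<integral>\<^sup>+x. ?c j * (G x * indicator (?B8 j) x) \<partial>lborel)"
        by (intro nn_integral_mono) (auto simp: indicator_def intro: mult_right_mono)
      also have "\<dots> = ?c j * (\<integral>\<^sup>+x\<in>?B8 j. G x \<partial>lborel)"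
        by (rule nn_integral_cmult) measurable
      finally show "(\<integral>\<^sup>+x\<in>?A j. (scale_sum f g m x * G x) \<partial>lborel) \<le> ?c j * (\<integral>\<^sup>+x\<in>?B8 j. G x \<partial>lborel)" .
    qed
    finally show "(\<integral>\<^sup>+x. scale_sum f g m x * G x \<partial>lborel) \<le> (\<integral>\<^sup>+j. ?c j * (\<integral>\<^sup>+x\<in>?B8 j. G x \<partial>lborel) \<partial>count_space J)" .
  qed
qed

section \<open>The bilinear estimate\<close>

text \<open>Every point of E sees the mean over the whole ball, up to the factor
  \<open>D\<^sup>2\<close>, in its own maximal function; raise to the power s and integrate over E.
  H is any lower bound of the integral of h, so that the mass on a small ball may be compared with a
  larger one.\<close>

lemma (in doubling_measure) mean_power_le_maximal:
  fixes k :: int and s H :: real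
  assumes [measurable]: "h \<in> borel_measurable borel" "E \<in> sets borel"
    and E: "E \<subseteq> ball z (2 powr k)" and s: "s > 0" and H: "H \<ge> 0"
    and HB: "ennreal H \<le> (\<integral>\<^sup>+y\<in>ball z (2 powr k). h y \<partial>\<nu>)"
  shows "ennreal ((H / measure \<nu> (ball z (2 powr k))) powr s) * emeasure \<nu> E
     \<le> ennreal (D powr (2 * s)) * (\<integral>\<^sup>+x\<in>E. epowr (maximal h x) s \<partial>\<nu>)"
proof -
  let ?m = "measure \<nu> (ball z (2 powr real_of_int k))"
  have m: "emeasure \<nu> (ball z (2 powr real_of_int k)) = ennreal ?m"
    using ball_finite[of z "2 powr real_of_int k"] by (intro emeasure_eq_ennreal_measure) auto
  then have m0: "?m > 0" using ball_pos[of "2 powr real_of_int k" z] by simp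
  have "ennreal ((H / ?m) powr s) * emeasure \<nu> E = (\<integral>\<^sup>+x. ennreal ((H / ?m) powr s) * indicator E x \<partial>\<nu>)"
    by (simp add: nn_integral_cmult)
  also have "\<dots> \<le> (\<integral>\<^sup>+x. ennreal (D powr (2 * s)) * (epowr (maximal h x) s * indicator E x) \<partial>\<nu>)"
  proof (intro nn_integral_mono)
    fix x
    show "ennreal ((H / ?m) powr s) * indicator E x \<le> ennreal (D powr (2 * s)) * (epowr (maximal h x) s * indicator E x)"
    proof (cases "x \<in> E")
      case True
      then have "dist z x < 2 powr k" using E by auto
      from nn_integral_ball_le_maximal[OF this, of h] HB
      have "ennreal H \<le> ennreal (D\<^sup>2) * ennreal ?m * maximal h x" by (simp add: m)
      then have "ennreal H / ennreal ?m \<le> ennreal (D\<^sup>2) * maximal h x"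
        using m0 by (intro divide_le_posI_ennreal) (auto simp: mult_ac)
      then have "ennreal (H / ?m) \<le> ennreal (D\<^sup>2) * maximal h x"
        using m0 H by (simp add: divide_ennreal)
      then have "epowr (ennreal (H / ?m)) s \<le> epowr (ennreal (D\<^sup>2) * maximal h x) s"
        using s by (intro epowr_mono) auto
      moreover have "(D\<^sup>2) powr s = D powr (2 * s)"
        using D_pos by (simp add: powr_powr[symmetric])
      ultimately have "ennreal ((H / ?m) powr s) \<le> ennreal (D powr (2 * s)) * epowr (maximal h x) s"
        using s H m0 D_pos by (simp add: epowr_mult epowr_ennreal')
      then show ?thesis using True by simp
    qed simp
  qed
  also have "\<dots> = ennreal (D powr (2 * s)) * (\<integral>\<^sup>+x\<in>E. epowr (maximal h x) s \<partial>\<nu>)"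
    by (rule nn_integral_cmult) measurable
  finally show ?thesis .
qed

lemma ennreal_le_one_add_epowr: "s \<ge> 1 \<Longrightarrow> x \<le> 1 + epowr x s"
proof (cases x)
  case (real r)
  assume s: "s \<ge> 1"
  have "r \<le> 1 + r powr s"
  proof (cases "r \<le> 1")
    case False
    then have "r powr 1 \<le> r powr s" using s by (intro powr_mono) auto
    then show ?thesis using False by simp
  qed (use real in \<open>auto intro: add_increasing2\<close>)
  then show ?thesis
    using real s by (simp add: epowr_ennreal' ennreal_1[symmetric] ennreal_plus[symmetric] ennreal_leI del: ennreal_1 ennreal_plus)
qed simp

context dual_weights
begin

text \<open>
  With a = 1/q and b = 1/p' these are the exponents p and q'.
\<close>

definition "sp = 1 / (1 - b)"
definition "st = 1 / (1 - a)"

lemma exponents: "sp > 1" "st > 1"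
  using a_pos b_pos ab_less by (auto simp: sp_def st_def)

text \<open>Both maximal functions in a single density with respect to Lebesgue measure, so that the
  disjoint sets E j have to be summed only once.\<close>

definition maximal_power :: "('a \<Rightarrow> ennreal) \<Rightarrow> ('a \<Rightarrow> ennreal) \<Rightarrow> 'a \<Rightarrow> ennreal" where
  "maximal_power h g x = ennreal (v x) * epowr (V.maximal h x) sp + ennreal (u x) * epowr (U.maximal g x) st"

lemma maximal_power_measurable [measurable]:
  assumes [measurable]: "h \<in> borel_measurable borel" "g \<in> borel_measurable borel"
  shows "maximal_power h g \<in> borel_measurable borel"
  unfolding maximal_power_def by measurable

lemma set_nn_integral_maximal_power:
  assumes [measurable]: "h \<in> borel_measurable borel" "g \<in> borel_measurable borel" "E \<in> sets borel"
  shows "(\<integral>\<^sup>+x\<in>E. maximal_power h g x \<partial>lborel) = (\<integral>\<^sup>+x\<in>E. epowr (V.maximal h x) sp \<partial>V) + (\<integral>\<^sup>+x\<in>E. epowr (U.maximal g x) st \<partial>U)"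
proof -
  have "(\<integral>\<^sup>+x\<in>E. epowr (V.maximal h x) sp \<partial>V) = (\<integral>\<^sup>+x. ennreal (v x) * (epowr (V.maximal h x) sp * indicator E x) \<partial>lborel)"
    by (rule nn_integral_density) measurable
  moreover have "(\<integral>\<^sup>+x\<in>E. epowr (U.maximal g x) st \<partial>U) = (\<integral>\<^sup>+x. ennreal (u x) * (epowr (U.maximal g x) st * indicator E x) \<partial>lborel)"
    by (rule nn_integral_density) measurable
  moreover have "(\<integral>\<^sup>+x\<in>E. maximal_power h g x \<partial>lborel)
      = (\<integral>\<^sup>+x. ennreal (v x) * (epowr (V.maximal h x) sp * indicator E x) + ennreal (u x) * (epowr (U.maximal g x) st * indicator E x) \<partial>lborel)"
    by (intro nn_integral_cong) (simp add: maximal_power_def distrib_right mult.assoc)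
  ultimately show ?thesis
    by (subst (asm) nn_integral_add) simp_all
qed

lemma nn_integral_maximal_power:
  "\<exists>C>0. \<forall>h\<in>borel_measurable borel. \<forall>g\<in>borel_measurable borel.
     (\<integral>\<^sup>+x. epowr (h x) sp \<partial>V) \<le> 1 \<longrightarrow> (\<integral>\<^sup>+x. epowr (g x) st \<partial>U) \<le> 1 \<longrightarrow>
     (\<integral>\<^sup>+x. epowr (U.maximal g x) st \<partial>U) \<le> ennreal C \<and> (\<integral>\<^sup>+x. maximal_power h g x \<partial>lborel) \<le> ennreal C"
proof -
  obtain C1 where C1: "C1 > 0" "\<And>h. h \<in> borel_measurable borel \<Longrightarrow>
    (\<integral>\<^sup>+x. epowr (V.maximal h x) sp \<partial>V) \<le> ennreal C1 * (\<integral>\<^sup>+x. epowr (h x) sp \<partial>V)"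
    using V.strong_type[OF exponents(1)] by blast
  obtain C2 where C2: "C2 > 0" "\<And>g. g \<in> borel_measurable borel \<Longrightarrow>
    (\<integral>\<^sup>+x. epowr (U.maximal g x) st \<partial>U) \<le> ennreal C2 * (\<integral>\<^sup>+x. epowr (g x) st \<partial>U)"
    using U.strong_type[OF exponents(2)] by blast
  show ?thesis
  proof (intro exI[of _ "C1 + C2"] conjI ballI impI)
    fix h g :: "'a \<Rightarrow> ennreal"
    assume [measurable]: "h \<in> borel_measurable borel" "g \<in> borel_measurable borel"
      and le: "(\<integral>\<^sup>+x. epowr (h x) sp \<partial>V) \<le> 1" "(\<integral>\<^sup>+x. epowr (g x) st \<partial>U) \<le> 1"
    have 1: "(\<integral>\<^sup>+x. epowr (V.maximal h x) sp \<partial>V) \<le> ennreal C1"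
      using order_trans[OF C1(2) mult_left_mono[OF le(1)]] by simp
    have 2: "(\<integral>\<^sup>+x. epowr (U.maximal g x) st \<partial>U) \<le> ennreal C2"
      using order_trans[OF C2(2) mult_left_mono[OF le(2)]] by simp
    show "(\<integral>\<^sup>+x. epowr (U.maximal g x) st \<partial>U) \<le> ennreal (C1 + C2)"
      using 2 C1(1) by (elim order_trans) (simp add: ennreal_leI)
    show "(\<integral>\<^sup>+x. maximal_power h g x \<partial>lborel) \<le> ennreal (C1 + C2)"
      using set_nn_integral_maximal_power[of h g UNIV] add_mono[OF 1 2] C1(1) C2(1) by simp
  qed (use C1 C2 in auto)
qed

text \<open>
  Replaces Hoelder's inequality for sums: q' is at most p' because a + b < 1, so the power p' of Y can be
  lowered to q' at the cost of a power of the a priori bound.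
\<close>

lemma product_le_power_sum:
  fixes X Y y Ymax :: real
  assumes nn: "X \<ge> 0" "Y \<ge> 0" and Y: "Y powr st \<le> Ymax"
  shows "X * Y \<le> X powr sp + Ymax powr ((1 - a) / b - 1) * Y powr st"
proof (cases "Y = 0")
  case False
  then have Y0: "Y > 0" using nn by simp
  have "1 / sp + 1 / (1 / b) = 1" "1 / b > 1" using a_pos b_pos ab_less by (auto simp: sp_def)
  from Youngs_inequality[OF exponents(1) this(2,1) nn]
  have "X * Y \<le> X powr sp / sp + Y powr (1 / b) / (1 / b)" .
  also have "\<dots> \<le> X powr sp + Y powr (1 / b)"
    using exponents(1) \<open>1 / b > 1\<close> b_pos ab_less a_pos
    by (intro add_mono) (auto simp: divide_le_eq mult_le_cancel_left1 mult_left_le)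
  \<comment> \<open>st (1 - a) = 1 gives 1/b = st ((1 - a)/b - 1) + st, and the surplus exponent is
    non-negative because a + b < 1.\<close>
  also have "Y powr (1 / b) = Y powr (st * ((1 - a) / b - 1)) * Y powr st"
  proof -
    have "st * ((1 - a) / b - 1) + st = 1 / b"
    proof -
      have "st * (1 - a) = 1" using b_pos ab_less by (simp add: st_def)
      moreover have "st * ((1 - a) / b - 1) + st = st * (1 - a) / b" by (simp add: algebra_simps)
      ultimately show ?thesis by simp
    qed
    then show ?thesis by (simp add: powr_add[symmetric])
  qed
  also have "Y powr (st * ((1 - a) / b - 1)) = (Y powr st) powr ((1 - a) / b - 1)"
    by (simp add: powr_powr)
  also have "\<dots> * Y powr st \<le> Ymax powr ((1 - a) / b - 1) * Y powr st"
    using Y a_pos b_pos ab_less by (intro mult_right_mono powr_mono2) (auto simp: field_simps)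
  finally show ?thesis by simp
qed simp

text \<open>The contribution of one ball of the sparse family. The A condition on the eightfold ball
  trades the power of the radius for U^(-a) V^(-b). What remains is a product X Y in which X^sp and
  Y^st are the masses of the eightfold ball times powers of the means of h and g. By
  \<open>weight_comparison\<close> these masses are carried by E up to constants, and on E the means
  lie below the maximal functions.\<close>

lemma local_term_bound:
  obtains C where "C > 0"
    and "\<And>h g z k E. \<lbrakk>h \<in> borel_measurable borel; g \<in> borel_measurable borel;
      (\<integral>\<^sup>+x. epowr (h x) sp \<partial>V) \<le> 1; (\<integral>\<^sup>+x. epowr (g x) st \<partial>U) \<le> 1;
      E \<in> sets borel; E \<subseteq> ball z (2 powr real_of_int k);
      measure lborel (ball z (2 powr real_of_int k)) \<le> 2 * measure lborel E\<rbrakk> \<Longrightarrow>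
        ennreal (2 powr (- (DIM('a) * (a + b)) * real_of_int k)) * (\<integral>\<^sup>+x\<in>ball z (2 powr real_of_int k). h x \<partial>V) *
          (\<integral>\<^sup>+x\<in>ball z (2 powr (real_of_int k + 3)). g x \<partial>U)
        \<le> ennreal C * (\<integral>\<^sup>+x\<in>E. maximal_power h g x \<partial>lborel)"
proof -
  obtain CP where CP: "CP > 0" "\<And>h g. h \<in> borel_measurable borel \<Longrightarrow> g \<in> borel_measurable borel \<Longrightarrow>
     (\<integral>\<^sup>+x. epowr (h x) sp \<partial>V) \<le> 1 \<Longrightarrow> (\<integral>\<^sup>+x. epowr (g x) st \<partial>U) \<le> 1 \<Longrightarrow>
     (\<integral>\<^sup>+x. epowr (U.maximal g x) st \<partial>U) \<le> ennreal CP"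
    using nn_integral_maximal_power by blast
  define c where "c = a + b"
  have c: "c > 0" using a_pos b_pos by (simp add: c_def)
  let ?n = "real DIM('a)"
  define w where "w = unit_ball_vol ?n"
  have w: "w > 0" by (simp add: w_def)
  \<comment> \<open>\<open>K1\<close> is the constant of the A condition on the ball of radius 8
    2^k. In \<open>KU\<close> and \<open>KV\<close>, 2 8^n bounds the volume of that ball relative
    to E. \<open>Y0\<close> below comes from \<open>product_le_power_sum\<close>, with the a priori
    bound MU CP for Y^st that the normalization of g provides.\<close>
  define K1 where "K1 = C0 * w powr c * 8 powr (?n * c)"
  define KU where "KU = (C0 * (2 * 8 powr ?n) powr (a + b)) powr (1 / a)"
  define KV where "KV = (C0 * (2 * 8 powr ?n) powr (a + b)) powr (1 / b)"
  define MU where "MU = KU * DU powr (2 * st)"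
  define MV where "MV = KV * DV powr (2 * sp)"
  define Y0 where "Y0 = (MU * CP) powr ((1 - a) / b - 1)"
  have K1: "K1 > 0" using C0_pos w by (simp add: K1_def)
  have KUV: "KU > 0" "KV > 0" using C0_pos by (auto simp: KU_def KV_def)
  have MUV: "MU > 0" "MV > 0" using KUV U.D_pos V.D_pos by (auto simp: MU_def MV_def)
  define C where "C = K1 * (MV + Y0 * MU)"
  have "Y0 \<ge> 0" by (simp add: Y0_def)
  have C: "C > 0" using K1 MUV \<open>Y0 \<ge> 0\<close> by (auto simp: C_def intro!: mult_pos_pos add_pos_nonneg)
  show ?thesis
  proof (rule that[OF C])
    fix h g :: "'a \<Rightarrow> ennreal" and z :: 'a and k :: int and E :: "'a set"
    assume [measurable]: "h \<in> borel_measurable borel" "g \<in> borel_measurable borel" "E \<in> sets borel"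
      and h: "(\<integral>\<^sup>+x. epowr (h x) sp \<partial>V) \<le> 1" and g: "(\<integral>\<^sup>+x. epowr (g x) st \<partial>U) \<le> 1"
      and E: "E \<subseteq> ball z (2 powr k)" and large: "measure lborel (ball z (2 powr k)) \<le> 2 * measure lborel E"
    let ?B = "ball z (2 powr real_of_int k)"
    let ?B8 = "ball z (2 powr real_of_int (k + 3))"
    have r8: "2 powr real_of_int (k + 3) = 8 * 2 powr real_of_int k" by (simp add: powr_add)
    have sub: "?B \<subseteq> ?B8" unfolding r8 by (intro subset_ball) simp
    have E8: "E \<subseteq> ?B8" using E sub by auto
    have L8: "measure lborel ?B8 = w * 8 powr ?n * (2 powr real_of_int k) powr ?n"
      unfolding w_def r8 by (subst measure_lborel_ball) (auto simp: powr_mult)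
    also have "\<dots> = 8 powr ?n * measure lborel ?B"
      unfolding w_def by (subst measure_lborel_ball) (auto simp: mult_ac)
    also have "\<dots> \<le> (2 * 8 powr ?n) * measure lborel E"
      using large by simp
    finally have large8: "measure lborel ?B8 \<le> (2 * 8 powr ?n) * measure lborel E" .
    define U8 V8 where "U8 = measure U ?B8" and "V8 = measure V ?B8"
    have UV8: "U8 > 0" "V8 > 0" unfolding U8_def V8_def by (auto intro!: ball_measure_pos)
    have UE: "U8 \<le> KU * measure U E" and VE: "V8 \<le> KV * measure V E"
      unfolding U8_def V8_def KU_def KV_def using large8 E8 by (auto intro!: weight_comparison)
    have EU: "emeasure U E = ennreal (measure U E)" and EV: "emeasure V E = ennreal (measure V E)"
      using emeasure_mono[OF E8, of U] emeasure_mono[OF E8, of V] u_finite[of z "2 powr real_of_int (k + 3)"]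
        v_finite[of z "2 powr real_of_int (k + 3)"]
      by (auto intro!: emeasure_eq_ennreal_measure simp: top_unique)
    have finite_mean: "(\<integral>\<^sup>+x\<in>?B8. \<phi> x \<partial>M) < top"
      if M: "sets M = sets borel" "emeasure M ?B8 < top" and \<phi>[measurable]: "\<phi> \<in> borel_measurable borel"
        and s: "(\<integral>\<^sup>+x. epowr (\<phi> x) s \<partial>M) \<le> 1" "s \<ge> 1" for M \<phi> s
    proof -
      have [measurable_cong]: "sets M = sets borel" by fact
      have "(\<integral>\<^sup>+x\<in>?B8. \<phi> x \<partial>M) \<le> (\<integral>\<^sup>+x. indicator ?B8 x + epowr (\<phi> x) s \<partial>M)"
        using ennreal_le_one_add_epowr[OF s(2)] by (intro nn_integral_mono) (auto simp: indicator_def)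
      also have "\<dots> = emeasure M ?B8 + (\<integral>\<^sup>+x. epowr (\<phi> x) s \<partial>M)"
        by (subst nn_integral_add) auto
      also have "\<dots> < top" using M s(1) by (auto simp: less_top[symmetric] top_unique)
      finally show ?thesis .
    qed
    have "(\<integral>\<^sup>+x\<in>?B. h x \<partial>V) \<le> (\<integral>\<^sup>+x\<in>?B8. h x \<partial>V)"
      using sub by (intro nn_integral_mono) (auto simp: indicator_def)
    moreover have "(\<integral>\<^sup>+x\<in>?B8. h x \<partial>V) < top"
      using h exponents v_finite by (intro finite_mean[where s=sp]) auto
    ultimately obtain H where H: "(\<integral>\<^sup>+x\<in>?B. h x \<partial>V) = ennreal H" "H \<ge> 0" and HB8: "ennreal H \<le> (\<integral>\<^sup>+x\<in>?B8. h x \<partial>V)"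
      by (cases "\<integral>\<^sup>+x\<in>?B. h x \<partial>V") (auto simp: top_unique)
    have "(\<integral>\<^sup>+x\<in>?B8. g x \<partial>U) < top"
      using g exponents u_finite by (intro finite_mean[where s=st]) auto
    then obtain G where G: "(\<integral>\<^sup>+x\<in>?B8. g x \<partial>U) = ennreal G" "G \<ge> 0"
      by (cases "\<integral>\<^sup>+x\<in>?B8. g x \<partial>U") auto
    \<comment> \<open>Normalized so that X Y = H G / (U8^a V8^b) while sp (1 - b) = st (1 - a) = 1.
      H is the integral of h over the small ball, yet it is averaged over the large one, so that a
      single ball enters the A condition.\<close>
    define X where "X = V8 powr (1 - b) * (H / V8)"
    define Y where "Y = U8 powr (1 - a) * (G / U8)"
    have XY0: "X \<ge> 0" "Y \<ge> 0" using H G UV8 by (auto simp: X_def Y_def)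
    have Xp: "X powr sp = V8 * (H / V8) powr sp"
      unfolding X_def powr_mult powr_powr using ab_less a_pos UV8 by (simp add: sp_def)
    have Yt: "Y powr st = U8 * (G / U8) powr st"
      unfolding Y_def powr_mult powr_powr using ab_less b_pos UV8 by (simp add: st_def)
    let ?IV = "\<integral>\<^sup>+x\<in>E. epowr (V.maximal h x) sp \<partial>V"
    let ?IU = "\<integral>\<^sup>+x\<in>E. epowr (U.maximal g x) st \<partial>U"
    have X_le: "ennreal (X powr sp) \<le> ennreal MV * ?IV"
    proof -
      have "ennreal (X powr sp) \<le> ennreal (KV * measure V E * (H / V8) powr sp)"
        unfolding Xp using VE by (intro ennreal_leI mult_right_mono) auto
      also have "\<dots> = ennreal KV * (ennreal ((H / V8) powr sp) * emeasure V E)"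
        using KUV by (simp add: EV ennreal_mult[symmetric] mult_ac)
      also have "\<dots> \<le> ennreal KV * (ennreal (DV powr (2 * sp)) * ?IV)"
        unfolding V8_def using exponents H HB8 E8 by (intro mult_left_mono V.mean_power_le_maximal) auto
      finally show ?thesis using KUV by (simp add: ennreal_mult_mult MV_def)
    qed
    have Y_le: "ennreal (Y powr st) \<le> ennreal MU * ?IU"
    proof -
      have "ennreal (Y powr st) \<le> ennreal (KU * measure U E * (G / U8) powr st)"
        unfolding Yt using UE by (intro ennreal_leI mult_right_mono) auto
      also have "\<dots> = ennreal KU * (ennreal ((G / U8) powr st) * emeasure U E)"
        using KUV by (simp add: EU ennreal_mult[symmetric] mult_ac)
      also have "\<dots> \<le> ennreal KU * (ennreal (DU powr (2 * st)) * ?IU)"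
        unfolding U8_def using exponents G E8 by (intro mult_left_mono U.mean_power_le_maximal) auto
      finally show ?thesis using KUV by (simp add: ennreal_mult_mult MU_def)
    qed
    also have "?IU \<le> (\<integral>\<^sup>+x. epowr (U.maximal g x) st \<partial>U)"
      by (intro nn_integral_mono) (auto simp: indicator_def)
    also have "\<dots> \<le> ennreal CP" using CP(2)[OF _ _ h g] by simp
    finally have "ennreal (Y powr st) \<le> ennreal (MU * CP)"
      using MUV CP by (simp add: ennreal_mult mult_left_mono)
    then have "Y powr st \<le> MU * CP" using MUV CP by (simp add: ennreal_le_iff)
    from product_le_power_sum[OF XY0 this]
    have XY: "X * Y \<le> X powr sp + Y0 * Y powr st" by (simp add: Y0_def)
    have "U8 powr a * V8 powr b \<le> C0 * measure lborel ?B8 powr (a + b)"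
      unfolding U8_def V8_def by (rule A_condition) simp
    also have "\<dots> = K1 * 2 powr (?n * c * real_of_int k)"
      unfolding L8 K1_def c_def[symmetric] using w by (simp add: powr_mult powr_powr mult_ac)
    finally have "2 powr (- (?n * c) * real_of_int k) \<le> K1 / (U8 powr a * V8 powr b)"
      using UV8 by (simp add: powr_minus field_simps)
    then have "2 powr (- (?n * c) * real_of_int k) * (H * G) \<le> K1 / (U8 powr a * V8 powr b) * (H * G)"
      using H G by (intro mult_right_mono) auto
    also have "\<dots> = K1 * (X * Y)"
      using UV8 by (simp add: X_def Y_def powr_diff field_simps)
    also have "\<dots> \<le> K1 * (X powr sp + Y0 * Y powr st)"
      using XY K1 by (intro mult_left_mono) auto
    finally have "ennreal (2 powr (- (?n * c) * real_of_int k) * (H * G)) \<le> ennreal (K1 * (X powr sp + Y0 * Y powr st))"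
      by (rule ennreal_leI)
    also have "\<dots> = ennreal K1 * (ennreal (X powr sp) + ennreal Y0 * ennreal (Y powr st))"
      using K1 \<open>Y0 \<ge> 0\<close> by (simp add: ennreal_mult)
    also have "\<dots> \<le> ennreal K1 * (ennreal MV * ?IV + ennreal Y0 * (ennreal MU * ?IU))"
      by (intro mult_left_mono add_mono X_le Y_le) auto
    also have "\<dots> \<le> ennreal K1 * (ennreal (MV + Y0 * MU) * ?IV + ennreal (MV + Y0 * MU) * ?IU)"
    proof -
      have "ennreal Y0 * (ennreal MU * ?IU) = ennreal (Y0 * MU) * ?IU"
        using MUV \<open>Y0 \<ge> 0\<close> by (intro ennreal_mult_mult) auto
      moreover have "ennreal MV \<le> ennreal (MV + Y0 * MU)" "ennreal (Y0 * MU) \<le> ennreal (MV + Y0 * MU)"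
        using MUV \<open>Y0 \<ge> 0\<close> by (auto intro!: ennreal_leI)
      ultimately show ?thesis
        by (simp only:) (intro mult_left_mono add_mono mult_right_mono zero_le)
    qed
    also have "\<dots> = ennreal C * (\<integral>\<^sup>+x\<in>E. maximal_power h g x \<partial>lborel)"
    proof -
      have "MV + Y0 * MU \<ge> 0" using MUV \<open>Y0 \<ge> 0\<close> by simp
      then have "ennreal C = ennreal K1 * ennreal (MV + Y0 * MU)"
        unfolding C_def using K1 by (intro ennreal_mult) auto
      then show ?thesis
        by (simp only: set_nn_integral_maximal_power[OF \<open>h \<in> _\<close> \<open>g \<in> _\<close> \<open>E \<in> _\<close>] distrib_left mult.assoc)
    qed
    finally have fin: "ennreal (2 powr (- (?n * c) * real_of_int k) * (H * G)) \<le> ennreal C * (\<integral>\<^sup>+x\<in>E. maximal_power h g x \<partial>lborel)" .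
    then show "ennreal (2 powr (- (DIM('a) * (a + b)) * real_of_int k)) * (\<integral>\<^sup>+x\<in>ball z (2 powr k). h x \<partial>V) *
          (\<integral>\<^sup>+x\<in>ball z (2 powr (real_of_int k + 3)). g x \<partial>U)
        \<le> ennreal C * (\<integral>\<^sup>+x\<in>E. maximal_power h g x \<partial>lborel)"
    proof -
      have e: "real_of_int (k + 3) = real_of_int k + 3" by simp
      have "ennreal (2 powr (- (?n * c) * real_of_int k) * (H * G)) = ennreal (2 powr (- (?n * c) * real_of_int k)) * ennreal H * ennreal G"
        using H G by (simp add: ennreal_mult mult.assoc)
      then show ?thesis
        using fin unfolding H(1)[symmetric] G(1)[symmetric] e c_def by (simp only:)
    qed
  qed
qed

end

section \<open>The weighted norm inequality for the Riesz potential\<close>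

lemma riesz_cmult:
  assumes [measurable]: "f \<in> borel_measurable borel"
  shows "riesz e (\<lambda>y. c * f y) x = c * riesz e f x"
  unfolding riesz_def by (subst nn_integral_cmult[symmetric]) (auto intro!: nn_integral_cong simp: mult_ac)

text \<open>Two admissible levels m and m1 satisfy m - i < m1 + j and m1 - i < m + j, so they differ
  by less than i + j. For F = 0 or F = \<infinity> no level is admissible.\<close>

lemma dyadic_shell_count:
  fixes F :: ennreal and i j :: nat
  shows "(\<integral>\<^sup>+m. indicator {m::int. ennreal (2 powr (real_of_int m - real i)) < F \<and> F \<le> ennreal (2 powr (real_of_int m + real j))} m
      \<partial>count_space UNIV) \<le> ennreal (real (2 * (i + j) + 1))" (is "(\<integral>\<^sup>+m. indicator ?S m \<partial>_) \<le> _")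
proof (cases "?S = {}")
  case False
  then obtain m1 where m1: "m1 \<in> ?S" by auto
  have "?S \<subseteq> {m1 - int (i + j) .. m1 + int (i + j)}"
  proof
    fix m assume m: "m \<in> ?S"
    have "ennreal (2 powr (real_of_int m - real i)) < ennreal (2 powr (real_of_int m1 + real j))"
         "ennreal (2 powr (real_of_int m1 - real i)) < ennreal (2 powr (real_of_int m + real j))"
      using m m1 by (auto intro: less_le_trans)
    then show "m \<in> {m1 - int (i + j) .. m1 + int (i + j)}"
      by (auto simp: ennreal_less_iff)
  qed
  then have "(\<integral>\<^sup>+m. indicator ?S m \<partial>count_space UNIV) \<le> (\<integral>\<^sup>+m. indicator {m1 - int (i + j) .. m1 + int (i + j)} m \<partial>count_space UNIV)"
    by (intro nn_integral_mono) (auto simp: indicator_def)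
  also have "\<dots> = ennreal (real (card {m1 - int (i + j) .. m1 + int (i + j)}))"
    by (simp add: ennreal_of_nat_eq_real_of_nat)
  also have "card {m1 - int (i + j) .. m1 + int (i + j)} = 2 * (i + j) + 1" by simp
  finally show ?thesis .
qed simp

context dual_weights
begin

text \<open>The weighted norm inequality in dual form: writing the function as v h turns its
  L^p(w^p) norm into the L^sp norm of h over V, and g runs over the unit ball of the dual of L^q
  over U. The finite integral of h makes the stopping scales of v h exist.\<close>

lemma bilinear_bound:
  obtains C where "C > 0"
    and "\<And>h g. \<lbrakk>h \<in> borel_measurable borel; g \<in> borel_measurable borel;
      (\<integral>\<^sup>+x. epowr (h x) sp \<partial>V) \<le> 1; (\<integral>\<^sup>+x. epowr (g x) st \<partial>U) \<le> 1; (\<integral>\<^sup>+x. h x \<partial>V) < top\<rbrakk> \<Longrightarrow>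
     (\<integral>\<^sup>+x. riesz (DIM('a) * (a + b)) (\<lambda>y. ennreal (v y) * h y) x * g x \<partial>U) \<le> ennreal C"
proof -
  let ?n = "real DIM('a)"
  define e where "e = ?n * (a + b)"
  define \<gamma> where "\<gamma> = ?n - e"
  have e: "e > 0" using a_pos b_pos by (simp add: e_def)
  have \<gamma>: "\<gamma> > 0" using ab_less by (simp add: \<gamma>_def e_def)
  define w where "w = unit_ball_vol ?n"
  have w: "w > 0" by (simp add: w_def)
  obtain CT where CT: "CT > 0" and local_term: "\<And>h g z k E. h \<in> borel_measurable borel \<Longrightarrow> g \<in> borel_measurable borel \<Longrightarrow>
     (\<integral>\<^sup>+x. epowr (h x) sp \<partial>V) \<le> 1 \<Longrightarrow> (\<integral>\<^sup>+x. epowr (g x) st \<partial>U) \<le> 1 \<Longrightarrow> E \<in> sets borel \<Longrightarrow> E \<subseteq> ball z (2 powr real_of_int k) \<Longrightarrow>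
        measure lborel (ball z (2 powr real_of_int k)) \<le> 2 * measure lborel E \<Longrightarrow>
        ennreal (2 powr (- (DIM('a) * (a + b)) * real_of_int k)) * (\<integral>\<^sup>+x\<in>ball z (2 powr real_of_int k). h x \<partial>V) *
          (\<integral>\<^sup>+x\<in>ball z (2 powr (real_of_int k + 3)). g x \<partial>U)
        \<le> ennreal CT * (\<integral>\<^sup>+x\<in>E. maximal_power h g x \<partial>lborel)"
    by (rule local_term_bound) (rule that)
  note local_term = local_term[folded e_def]
  obtain CP where CP: "CP > 0" and total: "\<And>h g. h \<in> borel_measurable borel \<Longrightarrow> g \<in> borel_measurable borel \<Longrightarrow>
     (\<integral>\<^sup>+x. epowr (h x) sp \<partial>V) \<le> 1 \<Longrightarrow> (\<integral>\<^sup>+x. epowr (g x) st \<partial>U) \<le> 1 \<Longrightarrow>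
     (\<integral>\<^sup>+x. maximal_power h g x \<partial>lborel) \<le> ennreal CP"
    using nn_integral_maximal_power by blast
  have lt: "2 powr (- \<gamma>) < (1::real)" using \<gamma> powr_less_mono[of "- \<gamma>" 0 2] by simp
  define A where "A = 2 powr (e + 1) * w"
  define B where "B = 5 powr \<gamma> / (1 - 2 powr (- \<gamma>))"
  have AB: "A > 0" "B > 0" using w lt by (auto simp: A_def B_def)
  \<comment> \<open>The number of levels m whose strip from 2^(m-n) to 2^(m+4n+1) can contain a
    given value of the maximal function.\<close>
  define M where "M = real (2 * (DIM('a) + (4 * DIM('a) + 1)) + 1)"
  define C where "C = A * B / w * CT * (M * CP)"
  have M: "M > 0" by (simp add: M_def)
  show ?thesis
  proof (rule that)
    show "C > 0" using AB w CT CP M by (simp add: C_def)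
    fix h g :: "'a \<Rightarrow> ennreal"
    assume [measurable]: "h \<in> borel_measurable borel" "g \<in> borel_measurable borel"
      and h: "(\<integral>\<^sup>+x. epowr (h x) sp \<partial>V) \<le> 1" and g: "(\<integral>\<^sup>+x. epowr (g x) st \<partial>U) \<le> 1"
      and h_fin: "(\<integral>\<^sup>+x. h x \<partial>V) < top"
    define f where "f y = ennreal (v y) * h y" for y
    define G where "G y = ennreal (u y) * g y" for y
    have [measurable]: "f \<in> borel_measurable borel" "G \<in> borel_measurable borel"
      unfolding f_def G_def by measurable
    have f_fin: "(\<integral>\<^sup>+y. f y \<partial>lborel) < top"
      using h_fin by (simp add: nn_integral_density f_def)
    have f_ball: "(\<integral>\<^sup>+x\<in>ball z r. f x \<partial>lborel) = (\<integral>\<^sup>+x\<in>ball z r. h x \<partial>V)" for z r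
      by (simp add: nn_integral_density f_def mult.assoc)
    have G_ball: "(\<integral>\<^sup>+x\<in>ball z r. G x \<partial>lborel) = (\<integral>\<^sup>+x\<in>ball z r. g x \<partial>U)" for z r
      by (simp add: nn_integral_density G_def mult.assoc)
    let ?P = "maximal_power h g"
    let ?S = "\<lambda>m. {x. ennreal (2 powr (real_of_int m - DIM('a))) < Leb.maximal f x \<and>
            Leb.maximal f x \<le> ennreal (2 powr (real_of_int m + real (4 * DIM('a) + 1)))}"
    have level: "ennreal (A * 2 powr real_of_int m) * (\<integral>\<^sup>+x. scale_sum f \<gamma> m x * G x \<partial>lborel)
        \<le> ennreal (A * B / w * CT) * (\<integral>\<^sup>+x\<in>?S m. ?P x \<partial>lborel)" for m
    proof -
      obtain J and \<kappa> :: "'a \<Rightarrow> int" and E :: "'a \<Rightarrow> 'a set"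
        where J: "countable J"
        and avg: "\<And>j. j \<in> J \<Longrightarrow> ennreal (2 powr real_of_int m) < Leb.average f (\<kappa> j) j"
        and E_meas: "\<And>j. j \<in> J \<Longrightarrow> E j \<in> sets borel"
        and E_sub: "\<And>j. j \<in> J \<Longrightarrow> E j \<subseteq> ball j (2 powr \<kappa> j)"
        and E_large: "\<And>j. j \<in> J \<Longrightarrow> measure lborel (ball j (2 powr \<kappa> j)) \<le> 2 * measure lborel (E j)"
        and E_level: "\<And>j. j \<in> J \<Longrightarrow> E j \<subseteq> {x. ennreal (2 powr (real_of_int m - DIM('a))) < Leb.maximal f x \<and>
            Leb.maximal f x \<le> ennreal (2 powr real_of_int (m + (4 * int DIM('a) + 1)))}"
        and E_disj: "\<And>i j. i \<in> J \<Longrightarrow> j \<in> J \<Longrightarrow> i \<noteq> j \<Longrightarrow> E i \<inter> E j = {}"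
        and sum_le: "(\<integral>\<^sup>+x. scale_sum f \<gamma> m x * G x \<partial>lborel) \<le>
          (\<integral>\<^sup>+j. ennreal (5 powr \<gamma> / (1 - 2 powr (- \<gamma>)) * 2 powr (\<gamma> * real_of_int (\<kappa> j))) *
         (\<integral>\<^sup>+x\<in>ball j (2 powr (real_of_int (\<kappa> j) + 3)). G x \<partial>lborel) \<partial>count_space J)"
        using level_covering[OF \<open>f \<in> _\<close> \<open>G \<in> _\<close> f_fin \<gamma>, of m] by blast
      have E_level': "E j \<subseteq> ?S m" if "j \<in> J" for j
      proof -
        have "real_of_int (m + (4 * int DIM('a) + 1)) = real_of_int m + real (4 * DIM('a) + 1)" by simp
        then show ?thesis using E_level[OF that] by (simp only:)
      qed
      have "ennreal (A * 2 powr real_of_int m) * (\<integral>\<^sup>+x. scale_sum f \<gamma> m x * G x \<partial>lborel)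
        \<le> ennreal (A * 2 powr real_of_int m) * (\<integral>\<^sup>+j. ennreal (B * 2 powr (\<gamma> * real_of_int (\<kappa> j))) *
         (\<integral>\<^sup>+x\<in>ball j (2 powr (real_of_int (\<kappa> j) + 3)). G x \<partial>lborel) \<partial>count_space J)"
        unfolding B_def by (intro mult_left_mono sum_le) auto
      also have "\<dots> = (\<integral>\<^sup>+j. ennreal (A * 2 powr real_of_int m) * (ennreal (B * 2 powr (\<gamma> * real_of_int (\<kappa> j))) *
         (\<integral>\<^sup>+x\<in>ball j (2 powr (real_of_int (\<kappa> j) + 3)). G x \<partial>lborel)) \<partial>count_space J)"
        by (rule nn_integral_cmult[symmetric]) simp
      also have "\<dots> \<le> (\<integral>\<^sup>+j. ennreal (A * B / w * CT) * (\<integral>\<^sup>+x\<in>E j. ?P x \<partial>lborel) \<partial>count_space J)"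
      proof (intro nn_integral_mono)
        fix j assume "j \<in> space (count_space J)"
        then have j: "j \<in> J" by simp
        let ?k = "real_of_int (\<kappa> j)"
        let ?B = "\<integral>\<^sup>+x\<in>ball j (2 powr ?k). h x \<partial>V" and ?B8 = "\<integral>\<^sup>+x\<in>ball j (2 powr (?k + 3)). g x \<partial>U"
        \<comment> \<open>The stopping condition replaces 2^m |B_j| by the mass of f on B_j. As
          \<gamma> = n - e, the factor 2^m 2^(\<gamma> k) becomes 2^(- e k) times this mass, which
          is the form treated by \<open>local_term_bound\<close>.\<close>
        have "ennreal (2 powr real_of_int m) * emeasure lborel (ball j (2 powr ?k)) \<le> ?B"
          unfolding f_ball[symmetric] Leb.nn_integral_eq_average using avg[OF j] by (intro mult_right_mono) auto
        then have "ennreal (2 powr real_of_int m * (w * 2 powr (?n * ?k))) \<le> ?B"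
          by (simp add: emeasure_lborel_ball_eq ennreal_mult[symmetric] powr_powr w_def mult.commute[of ?k])
        then have "ennreal (A * B / w * 2 powr (- e * ?k)) * ennreal (2 powr real_of_int m * (w * 2 powr (?n * ?k)))
            \<le> ennreal (A * B / w * 2 powr (- e * ?k)) * ?B"
          by (rule mult_left_mono) simp
        also have "ennreal (A * B / w * 2 powr (- e * ?k)) * ennreal (2 powr real_of_int m * (w * 2 powr (?n * ?k)))
            = ennreal (A * 2 powr real_of_int m * (B * 2 powr (\<gamma> * ?k)))"
        proof -
          have "2 powr (\<gamma> * ?k) = 2 powr (- e * ?k) * (2::real) powr (?n * ?k)"
            by (simp add: \<gamma>_def powr_add[symmetric] algebra_simps)
          then show ?thesis
            using AB w by (subst ennreal_mult[symmetric]) (auto simp: field_simps)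
        qed
        finally have le: "ennreal (A * 2 powr real_of_int m * (B * 2 powr (\<gamma> * ?k))) \<le> ennreal (A * B / w * 2 powr (- e * ?k)) * ?B" .
        have "ennreal (A * 2 powr real_of_int m) * (ennreal (B * 2 powr (\<gamma> * ?k)) * ?B8)
           = ennreal (A * 2 powr real_of_int m * (B * 2 powr (\<gamma> * ?k))) * ?B8"
          using AB by (intro ennreal_mult_mult) auto
        also have "\<dots> \<le> ennreal (A * B / w * 2 powr (- e * ?k)) * ?B * ?B8"
          using le by (rule mult_right_mono) simp
        also have "\<dots> = ennreal (A * B / w) * (ennreal (2 powr (- e * ?k)) * ?B * ?B8)"
        proof -
          have "ennreal (A * B / w * 2 powr (- e * ?k)) = ennreal (A * B / w) * ennreal (2 powr (- e * ?k))"
            using AB w by (intro ennreal_mult) auto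
          then show ?thesis by (simp only: mult.assoc)
        qed
        also have "\<dots> \<le> ennreal (A * B / w) * (ennreal CT * (\<integral>\<^sup>+x\<in>E j. ?P x \<partial>lborel))"
          using j h g by (intro mult_left_mono local_term E_meas E_sub E_large) auto
        also have "\<dots> = ennreal (A * B / w * CT) * (\<integral>\<^sup>+x\<in>E j. ?P x \<partial>lborel)"
          using AB w CT by (intro ennreal_mult_mult) auto
        finally show "ennreal (A * 2 powr real_of_int m) * (ennreal (B * 2 powr (\<gamma> * ?k)) *
            (\<integral>\<^sup>+x\<in>ball j (2 powr (?k + 3)). G x \<partial>lborel)) \<le> ennreal (A * B / w * CT) * (\<integral>\<^sup>+x\<in>E j. ?P x \<partial>lborel)"
          by (simp only: G_ball)
      qed
      also have "\<dots> = ennreal (A * B / w * CT) * (\<integral>\<^sup>+j. (\<integral>\<^sup>+x\<in>E j. ?P x \<partial>lborel) \<partial>count_space J)"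
        by (rule nn_integral_cmult) simp
      also have "\<dots> \<le> ennreal (A * B / w * CT) * (\<integral>\<^sup>+x\<in>?S m. ?P x \<partial>lborel)"
        using J E_meas E_disj E_level' by (intro mult_left_mono nn_integral_disjoint_le lborel.sigma_finite_measure_axioms) auto
      finally show ?thesis .
    qed
    have "(\<integral>\<^sup>+m. (\<integral>\<^sup>+x\<in>?S m. ?P x \<partial>lborel) \<partial>count_space UNIV) = (\<integral>\<^sup>+x. (\<integral>\<^sup>+m. ?P x * indicator (?S m) x \<partial>count_space UNIV) \<partial>lborel)"
      by (rule nn_integral_count_space_swap[OF countableI_type lborel.sigma_finite_measure_axioms, symmetric]) measurable
    also have "\<dots> \<le> (\<integral>\<^sup>+x. ennreal M * ?P x \<partial>lborel)"
    proof (intro nn_integral_mono)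
      fix x
      let ?T = "{m::int. ennreal (2 powr (real_of_int m - real DIM('a))) < Leb.maximal f x \<and>
          Leb.maximal f x \<le> ennreal (2 powr (real_of_int m + real (4 * DIM('a) + 1)))}"
      have "(\<integral>\<^sup>+m. ?P x * indicator (?S m) x \<partial>count_space UNIV) = ?P x * (\<integral>\<^sup>+m. indicator ?T m \<partial>count_space UNIV)"
        by (subst nn_integral_cmult[symmetric]) (auto intro!: nn_integral_cong simp: indicator_def)
      also have "\<dots> \<le> ?P x * ennreal M"
        unfolding M_def by (intro mult_left_mono dyadic_shell_count) simp
      finally show "(\<integral>\<^sup>+m. ?P x * indicator (?S m) x \<partial>count_space UNIV) \<le> ennreal M * ?P x"
        by (simp only: mult.commute)
    qed
    also have "\<dots> = ennreal M * (\<integral>\<^sup>+x. ?P x \<partial>lborel)"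
      by (rule nn_integral_cmult) simp
    also have "\<dots> \<le> ennreal M * ennreal CP"
      using h g by (intro mult_left_mono total) auto
    finally have inner: "(\<integral>\<^sup>+m. (\<integral>\<^sup>+x\<in>?S m. ?P x \<partial>lborel) \<partial>count_space UNIV) \<le> ennreal M * ennreal CP" .
    have "(\<integral>\<^sup>+x. riesz e f x * g x \<partial>U) = (\<integral>\<^sup>+x. riesz e f x * G x \<partial>lborel)"
      by (simp add: nn_integral_density G_def mult_ac)
    also have "\<dots> \<le> (\<integral>\<^sup>+x. (\<integral>\<^sup>+m. ennreal (A * 2 powr real_of_int m) * (scale_sum f \<gamma> m x * G x) \<partial>count_space UNIV) \<partial>lborel)"
    proof (intro nn_integral_mono)
      fix x
      have "riesz e f x * G x \<le> (\<integral>\<^sup>+m. ennreal (A * 2 powr real_of_int m) * scale_sum f \<gamma> m x \<partial>count_space UNIV) * G x"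
        unfolding A_def \<gamma>_def w_def by (intro mult_right_mono riesz_le_levels e) auto
      then show "riesz e f x * G x \<le> (\<integral>\<^sup>+m. ennreal (A * 2 powr real_of_int m) * (scale_sum f \<gamma> m x * G x) \<partial>count_space UNIV)"
        by (simp add: nn_integral_multc[symmetric] mult.assoc)
    qed
    also have "\<dots> = (\<integral>\<^sup>+m. ennreal (A * 2 powr real_of_int m) * (\<integral>\<^sup>+x. scale_sum f \<gamma> m x * G x \<partial>lborel) \<partial>count_space UNIV)"
      by (subst nn_integral_count_space_swap[OF countableI_type lborel.sigma_finite_measure_axioms]) (auto simp: nn_integral_cmult)
    also have "\<dots> \<le> (\<integral>\<^sup>+m. ennreal (A * B / w * CT) * (\<integral>\<^sup>+x\<in>?S m. ?P x \<partial>lborel) \<partial>count_space UNIV)"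
      by (intro nn_integral_mono level)
    also have "\<dots> = ennreal (A * B / w * CT) * (\<integral>\<^sup>+m. (\<integral>\<^sup>+x\<in>?S m. ?P x \<partial>lborel) \<partial>count_space UNIV)"
      by (rule nn_integral_cmult) simp
    also have "\<dots> \<le> ennreal (A * B / w * CT) * (ennreal M * ennreal CP)"
      using inner by (rule mult_left_mono) simp
    also have "ennreal (A * B / w * CT) * (ennreal M * ennreal CP) = ennreal C"
      unfolding C_def using AB w CT M CP by (subst ennreal_mult[of "A * B / w * CT"], simp, simp, subst ennreal_mult[of M]) auto
    finally show "(\<integral>\<^sup>+x. riesz (DIM('a) * (a + b)) (\<lambda>y. ennreal (v y) * h y) x * g x \<partial>U) \<le> ennreal C"
      unfolding e_def f_def .
  qed
qed

text \<open>From the bilinear form to a norm by duality. The potential may be infinite, so the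
  extremal test function is built from bounded truncations G N of compact support. The resulting
  bound is independent of N and passes to the limit by monotone convergence.\<close>

lemma riesz_normalized_bound:
  obtains C where "C > 0"
    and "\<And>h. \<lbrakk>h \<in> borel_measurable borel; (\<integral>\<^sup>+x. epowr (h x) sp \<partial>V) \<le> 1; (\<integral>\<^sup>+x. h x \<partial>V) < top\<rbrakk> \<Longrightarrow>
     (\<integral>\<^sup>+x. epowr (riesz (DIM('a) * (a + b)) (\<lambda>y. ennreal (v y) * h y) x) (1 / a) \<partial>U) \<le> ennreal C"
proof -
  obtain C where C: "C > 0" and bilinear: "\<And>h g. \<lbrakk>h \<in> borel_measurable borel; g \<in> borel_measurable borel;
      (\<integral>\<^sup>+x. epowr (h x) sp \<partial>V) \<le> 1; (\<integral>\<^sup>+x. epowr (g x) st \<partial>U) \<le> 1; (\<integral>\<^sup>+x. h x \<partial>V) < top\<rbrakk> \<Longrightarrow>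
     (\<integral>\<^sup>+x. riesz (DIM('a) * (a + b)) (\<lambda>y. ennreal (v y) * h y) x * g x \<partial>U) \<le> ennreal C"
    by (rule bilinear_bound) (rule that)
  define q where "q = 1 / a"
  have a1: "a < 1" using ab_less b_pos by simp
  have q: "q > 1" using a_pos a1 by (simp add: q_def)
  show ?thesis
  proof (rule that)
    show "C powr q > 0" using C by simp
    fix h :: "'a \<Rightarrow> ennreal"
    assume [measurable]: "h \<in> borel_measurable borel" and h: "(\<integral>\<^sup>+x. epowr (h x) sp \<partial>V) \<le> 1" and fin: "(\<integral>\<^sup>+x. h x \<partial>V) < top"
    define F where "F = riesz (DIM('a) * (a + b)) (\<lambda>y. ennreal (v y) * h y)"
    have [measurable]: "F \<in> borel_measurable borel" unfolding F_def by measurable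
    define G where "G N x = min (F x) (ennreal (real N)) * indicator (ball 0 (real N)) x" for N :: nat and x
    have [measurable]: "G N \<in> borel_measurable borel" for N unfolding G_def by measurable
    have trunc: "(\<integral>\<^sup>+x. epowr (G N x) q \<partial>U) \<le> ennreal (C powr q)" for N
    proof -
      have "(\<integral>\<^sup>+x. epowr (G N x) q \<partial>U) \<le> (\<integral>\<^sup>+x. ennreal (real N powr q) * indicator (ball 0 (real N)) x \<partial>U)"
      proof (intro nn_integral_mono)
        fix x
        have "epowr (min (F x) (ennreal (real N))) q \<le> epowr (ennreal (real N)) q"
          using q by (intro epowr_mono) auto
        then show "epowr (G N x) q \<le> ennreal (real N powr q) * indicator (ball 0 (real N)) x"
          using q by (auto simp: G_def indicator_def epowr_ennreal')
      qed
      also have "\<dots> = ennreal (real N powr q) * emeasure U (ball 0 (real N))"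
        by (simp add: nn_integral_cmult)
      also have "\<dots> < top" using u_finite by (simp add: ennreal_mult_less_top)
      finally obtain X where X: "(\<integral>\<^sup>+x. epowr (G N x) q \<partial>U) = ennreal X" "X \<ge> 0"
        by (cases "\<integral>\<^sup>+x. epowr (G N x) q \<partial>U") auto
      show ?thesis
      proof (cases "X = 0")
        case False
        then have X0: "X > 0" using X by simp
        \<comment> \<open>the extremal function of the duality between L^q and its dual, normalized; truncation makes X finite\<close>
        define g where "g x = ennreal (X powr (a - 1)) * epowr (G N x) (q - 1)" for x
        have [measurable]: "g \<in> borel_measurable borel" unfolding g_def by measurable
        have st: "(q - 1) * st = q" "(a - 1) * st = - 1"
          using a_pos a1 by (auto simp: q_def st_def field_simps)
        have "(\<integral>\<^sup>+x. epowr (g x) st \<partial>U) = (\<integral>\<^sup>+x. ennreal (1 / X) * epowr (G N x) q \<partial>U)"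
          using exponents q X0
          by (intro nn_integral_cong) (simp add: g_def epowr_mult epowr_epowr epowr_ennreal' powr_powr st powr_minus_divide)
        also have "\<dots> = ennreal (1 / X) * ennreal X"
          by (subst nn_integral_cmult) (auto simp: X(1))
        also have "\<dots> = 1" using X0 by (simp add: ennreal_mult[symmetric])
        finally have g1: "(\<integral>\<^sup>+x. epowr (g x) st \<partial>U) \<le> 1" by simp
        have "ennreal (X powr a) = ennreal (X powr (a - 1)) * ennreal X"
          using X0 by (simp add: ennreal_mult[symmetric] powr_diff)
        also have "\<dots> = (\<integral>\<^sup>+x. ennreal (X powr (a - 1)) * epowr (G N x) q \<partial>U)"
          by (subst nn_integral_cmult) (auto simp: X(1))
        also have "\<dots> \<le> (\<integral>\<^sup>+x. F x * g x \<partial>U)"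
        proof (intro nn_integral_mono)
          fix x
          have "epowr (G N x) q \<le> G N x * epowr (G N x) (q - 1)"
          proof (cases "G N x")
            case (real r)
            then have "r powr q = r * r powr (q - 1)"
              using powr_mult_base[of r "q - 1"] by (cases "r = 0") auto
            then show ?thesis using real q by (simp add: epowr_ennreal' ennreal_mult)
          qed (use q in auto)
          also have "\<dots> \<le> F x * epowr (G N x) (q - 1)"
            by (intro mult_right_mono) (auto simp: G_def indicator_def)
          finally have "ennreal (X powr (a - 1)) * epowr (G N x) q \<le> ennreal (X powr (a - 1)) * (F x * epowr (G N x) (q - 1))"
            by (rule mult_left_mono) simp
          then show "ennreal (X powr (a - 1)) * epowr (G N x) q \<le> F x * g x"
            unfolding g_def by (simp only: mult_ac)
        qed
        also have "\<dots> \<le> ennreal C"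
          unfolding F_def using h g1 fin by (intro bilinear) auto
        finally have "X powr a \<le> C" using C by (simp add: ennreal_le_iff)
        then have "(X powr a) powr q \<le> C powr q" using q by (intro powr_mono2) auto
        then show ?thesis using X X0 a_pos by (simp add: powr_powr q_def ennreal_leI)
      qed (simp add: X)
    qed
    have "(\<integral>\<^sup>+x. epowr (F x) q \<partial>U) \<le> (\<integral>\<^sup>+x. (SUP N. epowr (G N x) q) \<partial>U)"
    proof (intro nn_integral_mono)
      fix x :: 'a
      obtain N0 :: nat where N0: "norm x < real N0" using reals_Archimedean2 by blast
      show "epowr (F x) q \<le> (SUP N. epowr (G N x) q)"
      proof (cases "F x")
        case (real r)
        obtain N1 :: nat where "r \<le> real N1" using real_arch_simple by blast
        then have "G (max N0 N1) x = F x"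
          using N0 real by (auto simp: G_def indicator_def min_def ennreal_leI)
        then show ?thesis by (metis SUP_upper UNIV_I)
      next
        case top
        have "of_nat N \<le> (SUP N. epowr (G N x) q)" for N
        proof -
          define M where "M = max N0 (max N 1)"
          have "real N \<le> real M powr 1" by (simp add: M_def)
          also have "\<dots> \<le> real M powr q" using q by (intro powr_mono) (auto simp: M_def)
          finally have "ennreal (real N) \<le> ennreal (real M powr q)" by (rule ennreal_leI)
          also have "\<dots> = epowr (G M x) q"
            using N0 top q by (auto simp: G_def indicator_def epowr_ennreal' M_def)
          also have "\<dots> \<le> (SUP N. epowr (G N x) q)" by (rule SUP_upper) simp
          finally show ?thesis by (simp add: ennreal_of_nat_eq_real_of_nat)
        qed
        then have "(SUP N. of_nat N) \<le> (SUP N. epowr (G N x) q)" by (intro SUP_least)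
        then have "(SUP N. epowr (G N x) q) = top"
          unfolding ennreal_SUP_of_nat_eq_top top_unique .
        then show ?thesis by (simp only: top_greatest)
      qed
    qed
    also have "\<dots> = (SUP N. \<integral>\<^sup>+x. epowr (G N x) q \<partial>U)"
    proof (rule nn_integral_monotone_convergence_SUP)
      show "incseq (\<lambda>N x. epowr (G N x) q)"
      proof (intro incseq_SucI le_funI epowr_mono)
        fix N :: nat and x :: 'a
        have "min (F x) (ennreal (real N)) \<le> min (F x) (ennreal (real (Suc N)))"
          by (intro min.mono ennreal_leI) auto
        moreover have "indicator (ball 0 (real N)) x \<le> (indicator (ball 0 (real (Suc N))) x :: ennreal)"
          by (auto simp: indicator_def)
        ultimately show "G N x \<le> G (Suc N) x"
          unfolding G_def by (intro mult_mono) auto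
      qed (use q in auto)
    qed measurable
    also have "\<dots> \<le> ennreal (C powr q)" by (intro SUP_least trunc)
    finally show "(\<integral>\<^sup>+x. epowr (riesz (DIM('a) * (a + b)) (\<lambda>y. ennreal (v y) * h y) x) (1 / a) \<partial>U) \<le> ennreal (C powr q)"
      unfolding F_def q_def .
  qed
qed

text \<open>The Muckenhoupt-Wheeden inequality: with v = w^(-p') and sp = p the weight on the right
  is v^(1-p) = w^p. It follows from the normalized bound by the substitution \<phi> = v h and
  homogeneity.\<close>

theorem riesz_weighted_bound:
  obtains C where "C > 0"
    and "\<And>\<phi>. \<lbrakk>\<phi> \<in> borel_measurable borel; (\<integral>\<^sup>+x. \<phi> x \<partial>lborel) < top\<rbrakk> \<Longrightarrow>
      epowr (\<integral>\<^sup>+x. ennreal (u x) * epowr (riesz (DIM('a) * (a + b)) \<phi> x) (1 / a) \<partial>lborel) a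
      \<le> ennreal C * epowr (\<integral>\<^sup>+x. ennreal (v x powr (1 - sp)) * epowr (\<phi> x) sp \<partial>lborel) (1 / sp)"
proof -
  obtain C where C: "C > 0" and bound: "\<And>h. \<lbrakk>h \<in> borel_measurable borel; (\<integral>\<^sup>+x. epowr (h x) sp \<partial>V) \<le> 1; (\<integral>\<^sup>+x. h x \<partial>V) < top\<rbrakk> \<Longrightarrow>
     (\<integral>\<^sup>+x. epowr (riesz (DIM('a) * (a + b)) (\<lambda>y. ennreal (v y) * h y) x) (1 / a) \<partial>U) \<le> ennreal C"
    by (rule riesz_normalized_bound) (rule that)
  let ?e = "DIM('a) * (a + b)"
  have sp: "sp > 0" using exponents by simp
  show ?thesis
  proof (rule that)
    show "C powr a > 0" using C by simp
    fix \<phi> :: "'a \<Rightarrow> ennreal"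
    assume [measurable]: "\<phi> \<in> borel_measurable borel" and fin: "(\<integral>\<^sup>+x. \<phi> x \<partial>lborel) < top"
    define h where "h x = ennreal (1 / v x) * \<phi> x" for x
    have [measurable]: "h \<in> borel_measurable borel" unfolding h_def by measurable
    have \<phi>: "\<phi> x = ennreal (v x) * h x" for x
      using v_pos[of x] by (simp add: h_def ennreal_mult_mult)
    have h_power: "ennreal (v x) * epowr (h x) sp = ennreal (v x powr (1 - sp)) * epowr (\<phi> x) sp" for x
    proof -
      have "v x * (1 / v x) powr sp = v x powr (1 - sp)"
        using v_pos[of x] by (simp add: powr_divide powr_diff)
      then show ?thesis
        using v_pos[of x] sp
        by (simp add: h_def epowr_mult epowr_ennreal ennreal_mult_mult del: powr_divide)
    qed
    let ?I = "\<integral>\<^sup>+x. ennreal (v x powr (1 - sp)) * epowr (\<phi> x) sp \<partial>lborel"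
    have I: "?I = (\<integral>\<^sup>+x. epowr (h x) sp \<partial>V)"
      by (simp add: nn_integral_density h_power)
    have U_eq: "(\<integral>\<^sup>+x. ennreal (u x) * epowr (riesz ?e f x) (1 / a) \<partial>lborel) = (\<integral>\<^sup>+x. epowr (riesz ?e f x) (1 / a) \<partial>U)"
      if [measurable]: "f \<in> borel_measurable borel" for f
      by (simp add: nn_integral_density)
    have h_fin: "(\<integral>\<^sup>+x. h x \<partial>V) < top"
      using fin by (simp add: nn_integral_density \<phi>[symmetric])
    show "epowr (\<integral>\<^sup>+x. ennreal (u x) * epowr (riesz ?e \<phi> x) (1 / a) \<partial>lborel) a
      \<le> ennreal (C powr a) * epowr ?I (1 / sp)"
    proof (cases ?I)
      case top
      then show ?thesis using C sp by (simp add: ennreal_mult_top)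
    next
      case (real A)
      show ?thesis
      \<comment> \<open>Norm zero cannot be normalized; then \<phi> vanishes almost everywhere, and
        so does its potential at every point.\<close>
      proof (cases "A = 0")
        case True
        then have "?I = 0" using real by simp
        then have "AE x in lborel. ennreal (v x powr (1 - sp)) * epowr (\<phi> x) sp = 0"
          by (subst (asm) nn_integral_0_iff_AE) auto
        moreover have "v x \<noteq> 0" for x using v_pos[of x] by simp
        ultimately have "AE x in lborel. \<phi> x = 0"
          using sp by (auto elim!: eventually_mono simp: epowr_eq_0_iff ennreal_eq_0_iff)
        then have "riesz ?e \<phi> x = 0" for x
          unfolding riesz_def by (subst nn_integral_0_iff_AE) (auto elim!: eventually_mono)
        then show ?thesis using a_pos by simp
      next
        case False
        then have A: "A > 0" using real by simp
        define B where "B = A powr (1 / sp)"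
        have B: "B > 0" using A by (simp add: B_def)
        define h' where "h' x = ennreal (1 / B) * h x" for x
        have [measurable]: "h' \<in> borel_measurable borel" unfolding h'_def by measurable
        have "(\<integral>\<^sup>+x. epowr (h' x) sp \<partial>V) = (\<integral>\<^sup>+x. ennreal (1 / A) * epowr (h x) sp \<partial>V)"
          using sp A by (intro nn_integral_cong) (simp add: h'_def B_def epowr_mult epowr_ennreal powr_divide powr_powr)
        also have "\<dots> = ennreal (1 / A) * ennreal A"
          using real I by (subst nn_integral_cmult) auto
        finally have "(\<integral>\<^sup>+x. epowr (h' x) sp \<partial>V) \<le> 1"
          using A by (simp add: ennreal_mult[symmetric])
        moreover have "(\<integral>\<^sup>+x. h' x \<partial>V) < top"
          unfolding h'_def using h_fin by (subst nn_integral_cmult) (auto simp: ennreal_mult_less_top)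
        ultimately have b: "(\<integral>\<^sup>+x. epowr (riesz ?e (\<lambda>y. ennreal (v y) * h' y) x) (1 / a) \<partial>U) \<le> ennreal C"
          by (intro bound) auto
        have "(\<lambda>y. ennreal (v y) * h' y) = (\<lambda>y. ennreal (1 / B) * \<phi> y)"
          by (simp add: h'_def \<phi> mult_ac fun_eq_iff)
        then have r: "riesz ?e (\<lambda>y. ennreal (v y) * h' y) x = ennreal (1 / B) * riesz ?e \<phi> x" for x
          by (simp add: riesz_cmult)
        have "(\<integral>\<^sup>+x. epowr (riesz ?e \<phi> x) (1 / a) \<partial>U) = (\<integral>\<^sup>+x. epowr (ennreal B * (ennreal (1 / B) * riesz ?e \<phi> x)) (1 / a) \<partial>U)"
          using B by (simp add: ennreal_mult_mult)
        also have "\<dots> = (\<integral>\<^sup>+x. ennreal (B powr (1 / a)) * epowr (riesz ?e (\<lambda>y. ennreal (v y) * h' y) x) (1 / a) \<partial>U)"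
          using B a_pos unfolding r by (intro nn_integral_cong) (subst epowr_mult, auto simp: epowr_ennreal)
        also have "\<dots> = ennreal (B powr (1 / a)) * (\<integral>\<^sup>+x. epowr (riesz ?e (\<lambda>y. ennreal (v y) * h' y) x) (1 / a) \<partial>U)"
          by (rule nn_integral_cmult) measurable
        also have "\<dots> \<le> ennreal (B powr (1 / a)) * ennreal C"
          by (intro mult_left_mono b) auto
        finally have "epowr (\<integral>\<^sup>+x. epowr (riesz ?e \<phi> x) (1 / a) \<partial>U) a \<le> epowr (ennreal (B powr (1 / a)) * ennreal C) a"
          using a_pos by (intro epowr_mono) auto
        also have "\<dots> = ennreal (C powr a) * ennreal B"
          using a_pos B C by (simp add: epowr_mult epowr_ennreal powr_powr mult.commute)
        also have "ennreal B = epowr ?I (1 / sp)"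
          using real A by (simp add: epowr_ennreal B_def)
        finally show ?thesis by (simp add: U_eq)
      qed
    qed
  qed
qed

end

section \<open>Convexity in mixed norms\<close>

text \<open>The tangent to x^\<sigma> at m lies below the graph. Its negative constant term stands
  on the right because \<open>ennreal\<close> has no negative numbers.\<close>

lemma epowr_tangent:
  fixes m \<sigma> :: real
  assumes "m > 0" "\<sigma> \<ge> 1"
  shows "ennreal (\<sigma> * m powr (\<sigma> - 1)) * x \<le> epowr x \<sigma> + ennreal ((\<sigma> - 1) * m powr \<sigma>)"
proof (cases "\<sigma> = 1")
  case False
  then have s: "\<sigma> > 1" using assms by simp
  show ?thesis
  proof (cases x)
    case (real r)
    have "1 / \<sigma> + 1 / (\<sigma> / (\<sigma> - 1)) = 1" using s by (simp add: field_simps)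
    moreover have "\<sigma> / (\<sigma> - 1) > 1" using s by (simp add: field_simps)
    ultimately have "r * m powr (\<sigma> - 1) \<le> r powr \<sigma> / \<sigma> + (m powr (\<sigma> - 1)) powr (\<sigma> / (\<sigma> - 1)) / (\<sigma> / (\<sigma> - 1))"
      using real s by (intro Youngs_inequality) auto
    also have "(m powr (\<sigma> - 1)) powr (\<sigma> / (\<sigma> - 1)) = m powr \<sigma>"
      using s by (simp add: powr_powr)
    finally have "\<sigma> * m powr (\<sigma> - 1) * r \<le> r powr \<sigma> + (\<sigma> - 1) * m powr \<sigma>"
      using s by (simp add: field_simps)
    then show ?thesis
      using real s by (simp add: epowr_ennreal' ennreal_mult[symmetric] ennreal_plus[symmetric] ennreal_leI del: ennreal_plus)
  next
    case top
    then show ?thesis using s by simp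
  qed
qed (use assms in simp)

text \<open>Jensen's inequality for countable convex combinations, by averaging the tangent
  inequality at the mean. If the mean is infinite, the tangent at 1 already forces the right-hand
  side to be infinite.\<close>

lemma epowr_suminf_convex:
  fixes c :: "nat \<Rightarrow> real" and x :: "nat \<Rightarrow> ennreal" and \<sigma> :: real
  assumes \<sigma>: "\<sigma> \<ge> 1" and c: "\<And>j. c j \<ge> 0" "c sums 1"
  shows "epowr (\<Sum>j. ennreal (c j) * x j) \<sigma> \<le> (\<Sum>j. ennreal (c j) * epowr (x j) \<sigma>)" (is "epowr ?m \<sigma> \<le> ?R")
proof -
  have one: "(\<Sum>j. ennreal (c j)) = 1"
    using suminf_ennreal_eq[OF c] by simp
  have tangent: "ennreal (\<sigma> * m powr (\<sigma> - 1)) * ?m \<le> ?R + ennreal ((\<sigma> - 1) * m powr \<sigma>)" if m: "m > 0" for m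
  proof -
    have "ennreal (\<sigma> * m powr (\<sigma> - 1)) * ?m = (\<Sum>j. ennreal (c j) * (ennreal (\<sigma> * m powr (\<sigma> - 1)) * x j))"
      by (simp add: ennreal_suminf_cmult[symmetric] mult_ac del: ennreal_suminf_cmult)
    also have "\<dots> \<le> (\<Sum>j. ennreal (c j) * (epowr (x j) \<sigma> + ennreal ((\<sigma> - 1) * m powr \<sigma>)))"
      using m \<sigma> by (intro suminf_le mult_left_mono epowr_tangent) auto
    also have "\<dots> = ?R + ennreal ((\<sigma> - 1) * m powr \<sigma>)"
      by (simp add: distrib_left suminf_add[symmetric] one)
    finally show ?thesis .
  qed
  show ?thesis
  proof (cases ?m)
    case (real m)
    show ?thesis
    proof (cases "m = 0")
      case False
      then have m: "m > 0" using real by simp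
      show ?thesis
      proof (cases ?R)
        case (real R)
        have "ennreal (\<sigma> * m powr (\<sigma> - 1)) * ennreal m \<le> ennreal R + ennreal ((\<sigma> - 1) * m powr \<sigma>)"
          using tangent[OF m] unfolding \<open>?m = ennreal m\<close> real .
        then have "\<sigma> * m powr (\<sigma> - 1) * m \<le> R + (\<sigma> - 1) * m powr \<sigma>"
          using \<sigma> m real by (simp add: ennreal_mult[symmetric] ennreal_plus[symmetric] ennreal_le_iff del: ennreal_plus)
        moreover have "m powr (\<sigma> - 1) * m = m powr \<sigma>"
          using m by (simp add: powr_diff)
        ultimately have "m powr \<sigma> \<le> R" by (simp add: algebra_simps)
        then show ?thesis using \<open>?m = ennreal m\<close> real m by (simp add: epowr_ennreal ennreal_leI)
      qed simp
    qed (use real \<sigma> in simp)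
  next
    case top
    have "?R + ennreal (\<sigma> - 1) = top"
      using tangent[of 1] \<sigma> unfolding top by (simp add: ennreal_mult_top top_unique)
    then have "?R = top" by simp
    then show ?thesis by (simp only: top_greatest)
  qed
qed

text \<open>Takes the place of Minkowski's inequality for infinite sums. As all h j share the bound
  N, convexity with the weights c j / S is enough for finite s; for s = \<infinity> the bounds hold
  almost everywhere simultaneously.\<close>

lemma Lnorm_le_suminf:
  fixes c :: "nat \<Rightarrow> real" and h :: "nat \<Rightarrow> 'a \<Rightarrow> ennreal"
  assumes s: "1 \<le> s"
    and [measurable]: "\<And>j. h j \<in> borel_measurable M" "G \<in> borel_measurable M"
    and c: "\<And>j. c j \<ge> 0" "c sums S" "S > 0"
    and N: "\<And>j. Lnorm s M (h j) \<le> N"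
    and G: "\<And>y. G y \<le> (\<Sum>j. ennreal (c j) * h j y)"
  shows "Lnorm s M G \<le> ennreal S * N"
proof -
  have sum_c: "(\<Sum>j. ennreal (c j)) = ennreal S"
    using c(3) by (intro suminf_ennreal_eq c) 
  show ?thesis
  proof (cases s)
    case top
    have "AE y in M. \<forall>j. h j y \<le> N"
    proof (subst AE_all_countable, intro allI)
      fix j
      show "AE y in M. h j y \<le> N"
        using esssup_AE[of "h j" M] N[of j] top by (auto simp: Lnorm_def elim!: eventually_mono)
    qed
    then have "AE y in M. G y \<le> ennreal S * N"
    proof (rule eventually_mono)
      fix y assume "\<forall>j. h j y \<le> N"
      then have "(\<Sum>j. ennreal (c j) * h j y) \<le> (\<Sum>j. ennreal (c j) * N)"
        by (intro suminf_le mult_left_mono) auto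
      also have "\<dots> = ennreal S * N" by (simp add: sum_c)
      finally show "G y \<le> ennreal S * N" using G[of y] by simp
    qed
    then have "esssup M G \<le> ennreal S * N" by (intro esssup_I) auto
    then show ?thesis using top by (simp add: Lnorm_def)
  next
    case (real \<sigma>)
    then have "ennreal 1 \<le> ennreal \<sigma>" using s by simp
  then have \<sigma>: "\<sigma> \<ge> 1" using real by (simp only: ennreal_le_iff)
    have Ln: "Lnorm s M g = epowr (\<integral>\<^sup>+y. epowr (g y) \<sigma> \<partial>M) (1 / \<sigma>)" for g
      using real by (simp add: Lnorm_def)
    have hN: "(\<integral>\<^sup>+y. epowr (h j y) \<sigma> \<partial>M) \<le> epowr N \<sigma>" for j
    proof -
      have "epowr (epowr (\<integral>\<^sup>+y. epowr (h j y) \<sigma> \<partial>M) (1 / \<sigma>)) \<sigma> \<le> epowr N \<sigma>"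
        using N[of j] \<sigma> unfolding Ln by (intro epowr_mono) auto
      then show ?thesis using \<sigma> by (simp add: epowr_inverse_exponents')
    qed
    have c': "(\<lambda>j. c j / S) sums 1" using sums_divide[OF c(2), of S] c(3) by simp
    have "(\<integral>\<^sup>+y. epowr (G y) \<sigma> \<partial>M) \<le> (\<integral>\<^sup>+y. ennreal (S powr \<sigma>) * (\<Sum>j. ennreal (c j / S) * epowr (h j y) \<sigma>) \<partial>M)"
    proof (intro nn_integral_mono)
      fix y
      have "ennreal (c j) * h j y = ennreal S * (ennreal (c j / S) * h j y)" for j
        using c(1,3) by (subst ennreal_mult_mult) auto
      then have "G y \<le> ennreal S * (\<Sum>j. ennreal (c j / S) * h j y)"
        using G[of y] by simp
      then have "epowr (G y) \<sigma> \<le> epowr (ennreal S * (\<Sum>j. ennreal (c j / S) * h j y)) \<sigma>"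
        using \<sigma> by (intro epowr_mono) auto
      also have "\<dots> = ennreal (S powr \<sigma>) * epowr (\<Sum>j. ennreal (c j / S) * h j y) \<sigma>"
        using \<sigma> c(3) by (simp add: epowr_mult epowr_ennreal)
      also have "\<dots> \<le> ennreal (S powr \<sigma>) * (\<Sum>j. ennreal (c j / S) * epowr (h j y) \<sigma>)"
        using c(1,3) by (intro mult_left_mono epowr_suminf_convex \<sigma> c') auto
      finally show "epowr (G y) \<sigma> \<le> ennreal (S powr \<sigma>) * (\<Sum>j. ennreal (c j / S) * epowr (h j y) \<sigma>)" .
    qed
    also have "\<dots> = ennreal (S powr \<sigma>) * (\<Sum>j. ennreal (c j / S) * (\<integral>\<^sup>+y. epowr (h j y) \<sigma> \<partial>M))"
      by (simp add: nn_integral_cmult nn_integral_suminf)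
    also have "\<dots> \<le> ennreal (S powr \<sigma>) * (\<Sum>j. ennreal (c j / S) * epowr N \<sigma>)"
      by (intro mult_left_mono suminf_le hN) auto
    also have "\<dots> = ennreal (S powr \<sigma>) * epowr N \<sigma>"
    proof -
      have "(\<Sum>j. ennreal (c j / S)) = ennreal 1"
        using c(1,3) by (intro suminf_ennreal_eq c') simp
      then show ?thesis by simp
    qed
    also have "\<dots> = epowr (ennreal S * N) \<sigma>"
      using \<sigma> c(3) by (simp add: epowr_mult epowr_ennreal)
    finally have "epowr (\<integral>\<^sup>+y. epowr (G y) \<sigma> \<partial>M) (1 / \<sigma>) \<le> epowr (epowr (ennreal S * N) \<sigma>) (1 / \<sigma>)"
      using \<sigma> by (intro epowr_mono) auto
    also have "\<dots> = ennreal S * N" using \<sigma> by (simp add: epowr_inverse_exponents)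
    finally show ?thesis by (simp add: Ln)
  qed
qed

lemma AE_finite_of_Lnorm:
  assumes s: "1 \<le> s" and [measurable]: "G \<in> borel_measurable M" and fin: "Lnorm s M G < top"
  shows "AE y in M. G y < top"
proof (cases s)
  case top
  then show ?thesis
    using esssup_AE[of G M] fin by (auto simp: Lnorm_def elim!: eventually_mono intro: le_less_trans)
next
  case (real \<sigma>)
  then have "ennreal 1 \<le> ennreal \<sigma>" using s by simp
  then have \<sigma>: "\<sigma> \<ge> 1" using real by (simp only: ennreal_le_iff)
  then have "(\<integral>\<^sup>+y. epowr (G y) \<sigma> \<partial>M) < top"
    using fin real by (simp add: Lnorm_def epowr_less_top_iff)
  then have "AE y in M. epowr (G y) \<sigma> \<noteq> \<infinity>"
    by (intro nn_integral_PInf_AE) auto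
  then show ?thesis
    using \<sigma> by (auto elim!: eventually_mono simp: epowr_less_top_iff less_top)
qed

lemma epowr_add_le:
  assumes "s > 0"
  shows "epowr (x + y) s \<le> ennreal (2 powr s) * (epowr x s + epowr y s)"
proof -
  have "x + y \<le> ennreal 2 * max x y" 
  proof -
    have "x + y \<le> max x y + max x y" by (intro add_mono) auto
    also have "\<dots> = ennreal 2 * max x y" by (simp add: mult_2[symmetric])
    finally show ?thesis .
  qed
  then have "epowr (x + y) s \<le> epowr (ennreal 2 * max x y) s"
    using assms by (intro epowr_mono) auto
  also have "\<dots> = ennreal (2 powr s) * epowr (max x y) s"
    using assms by (simp only: epowr_mult epowr_ennreal zero_less_numeral)
  also have "epowr (max x y) s \<le> epowr x s + epowr y s"
    by (cases "x \<le> y") (auto simp: max_def add_increasing add_increasing2)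
  finally show ?thesis by (simp add: mult_left_mono)
qed

section \<open>Local estimates of the Riesz potential\<close>

text \<open>If 2^(i+1) r \<le> |y - z| < 2^(i+2) r, then |x - z| \<ge> 2^(i+1) r - r \<ge> 2^i r for
  x in the ball, which bounds the kernel on that shell.\<close>

lemma riesz_far_le:
  fixes \<phi> :: "'a::euclidean_space \<Rightarrow> ennreal" and e r :: real
  assumes [measurable]: "\<phi> \<in> borel_measurable borel" and e: "e > 0" and r: "r > 0" and x: "x \<in> ball y r"
  shows "riesz e (\<lambda>z. \<phi> z * indicator (- ball y (2 * r)) z) x
    \<le> (\<Sum>i. ennreal ((2 ^ i * r) powr (- e)) * (\<integral>\<^sup>+z\<in>ball y (2 ^ (i + 2) * r). \<phi> z \<partial>lborel))"
proof -
  have "riesz e (\<lambda>z. \<phi> z * indicator (- ball y (2 * r)) z) x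
    \<le> (\<integral>\<^sup>+z. (\<Sum>i. ennreal ((2 ^ i * r) powr (- e)) * (\<phi> z * indicator (ball y (2 ^ (i + 2) * r)) z)) \<partial>lborel)"
    unfolding riesz_def
  proof (intro nn_integral_mono)
    fix z
    show "ennreal (dist x z powr (- e)) * (\<phi> z * indicator (- ball y (2 * r)) z)
       \<le> (\<Sum>i. ennreal ((2 ^ i * r) powr (- e)) * (\<phi> z * indicator (ball y (2 ^ (i + 2) * r)) z))"
    proof (cases "z \<in> ball y (2 * r)")
      case False
      then have z: "dist y z \<ge> 2 * r" by simp
      obtain n :: nat where "dist y z / r < 2 ^ n" using real_arch_pow[of 2 "dist y z / r"] by auto
      then have "dist y z < 2 ^ n * r" using r by (simp add: pos_divide_less_eq)
      also have "\<dots> \<le> 2 ^ (n + 2) * r" using r by simp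
      finally have "dist y z < 2 ^ (n + 2) * r" .
      then have ex: "\<exists>n. dist y z < 2 ^ (n + 2) * r" by blast
      \<comment> \<open>Minimality gives the lower end of the shell; for i = 0 it is the assumption
        that z lies outside the doubled ball.\<close>
      define i where "i = (LEAST n. dist y z < 2 ^ (n + 2) * r)"
      have i: "dist y z < 2 ^ (i + 2) * r" unfolding i_def using ex by (rule LeastI_ex)
      have "2 ^ (i + 1) * r \<le> dist y z"
      proof (cases i)
        case (Suc m)
        then have "m < i" by simp
        then have "\<not> dist y z < 2 ^ (m + 2) * r"
          using not_less_Least[of m "\<lambda>n. dist y z < 2 ^ (n + 2) * r"] unfolding i_def by blast
        then show ?thesis using Suc by simp
      qed (use z in simp)
      moreover have "r \<le> 2 ^ i * r" using r by simp
      moreover have "dist y z \<le> dist x z + dist y x" by (metis dist_commute dist_triangle add.commute)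
      moreover have "dist y x < r" using x by simp
      ultimately have "2 ^ i * r \<le> dist x z" by simp
      then have "dist x z powr (- e) \<le> (2 ^ i * r) powr (- e)"
        using r e by (intro powr_mono2') auto
      then have "ennreal (dist x z powr (- e)) * (\<phi> z * indicator (- ball y (2 * r)) z)
        \<le> ennreal ((2 ^ i * r) powr (- e)) * (\<phi> z * indicator (ball y (2 ^ (i + 2) * r)) z)"
        using i False by (intro mult_mono ennreal_leI) auto
      also have "\<dots> \<le> (\<Sum>i. ennreal ((2 ^ i * r) powr (- e)) * (\<phi> z * indicator (ball y (2 ^ (i + 2) * r)) z))"
        using nn_integral_ge_point[of i UNIV "\<lambda>i. ennreal ((2 ^ i * r) powr (- e)) * (\<phi> z * indicator (ball y (2 ^ (i + 2) * r)) z)"]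
        by (simp only: nn_integral_count_space_nat UNIV_I)
      finally show ?thesis .
    qed simp
  qed
  also have "\<dots> = (\<Sum>i. ennreal ((2 ^ i * r) powr (- e)) * (\<integral>\<^sup>+z\<in>ball y (2 ^ (i + 2) * r). \<phi> z \<partial>lborel))"
    by (subst nn_integral_suminf) (auto simp: nn_integral_cmult)
  finally show ?thesis .
qed

context dual_weights
begin

text \<open>The L^p(w^p) norm of \<phi> on the ball, since v^(1-sp) = w^p.\<close>

definition local_norm :: "('a \<Rightarrow> ennreal) \<Rightarrow> 'a \<Rightarrow> real \<Rightarrow> ennreal" where
  "local_norm \<phi> y r = epowr (\<integral>\<^sup>+x\<in>ball y r. ennreal (v x powr (1 - sp)) * epowr (\<phi> x) sp \<partial>lborel) (1 / sp)"

text \<open>Where \<phi> is finite, \<phi> = (v^(1-sp) \<phi>^sp)^(1/sp) v^(1-1/sp), and the second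
  exponent is b. This is Hoelder's inequality for these two factors.\<close>

lemma local_holder:
  assumes [measurable]: "\<phi> \<in> borel_measurable borel" and r: "r > 0"
  shows "(\<integral>\<^sup>+x\<in>ball y r. \<phi> x \<partial>lborel) \<le> local_norm \<phi> y r * ennreal (measure V (ball y r) powr b)"
proof -
  let ?B = "ball y r"
  let ?I = "\<integral>\<^sup>+x\<in>?B. ennreal (v x powr (1 - sp)) * epowr (\<phi> x) sp \<partial>lborel"
  have sp: "sp > 1" "1 - 1 / sp = b" using exponents by (auto simp: sp_def)
  have vpos: "measure V ?B > 0" using ball_measure_pos(2)[OF r] .
  have v0: "v x \<noteq> 0" for x using v_pos[of x] by simp
  show ?thesis
  proof (cases ?I)
    case top
    then show ?thesis using sp vpos by (simp add: local_norm_def ennreal_top_mult)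
  next
    case (real A)
    show ?thesis
    \<comment> \<open>The interpolation lemma asks for positive bounds, so the case of norm zero is
      settled directly.\<close>
    proof (cases "A = 0")
      case True
      then have "?I = 0" using real by simp
      then have "AE x in lborel. ennreal (v x powr (1 - sp)) * epowr (\<phi> x) sp * indicator ?B x = 0"
        by (subst (asm) nn_integral_0_iff_AE) auto
      then have "AE x in lborel. \<phi> x * indicator ?B x = 0"
        using sp v0 by (auto elim!: eventually_mono simp: epowr_eq_0_iff ennreal_eq_0_iff indicator_def)
      then have "(\<integral>\<^sup>+x\<in>?B. \<phi> x \<partial>lborel) = 0"
        by (subst nn_integral_0_iff_AE) auto
      then show ?thesis by simp
    next
      case False
      then have A: "A > 0" using real by simp
      have "AE x in lborel. ennreal (v x powr (1 - sp)) * epowr (\<phi> x) sp * indicator ?B x \<noteq> \<infinity>"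
        using real by (intro nn_integral_PInf_AE) auto
      then have fin: "AE x in lborel. x \<in> ?B \<longrightarrow> \<phi> x < top"
        using sp v0 by (auto elim!: eventually_mono simp: ennreal_mult_eq_top_iff epowr_less_top_iff[of sp] less_top indicator_def)
      define \<psi> where "\<psi> x = enn2real (\<phi> x)" for x
      have [measurable]: "\<psi> \<in> borel_measurable borel" unfolding \<psi>_def by measurable
      have [measurable]: "?B \<in> sets borel" by simp
      have \<psi>_nonneg: "\<psi> x \<ge> 0" for x by (simp add: \<psi>_def)
      have \<phi>\<psi>: "\<phi> x = ennreal (\<psi> x)" if "\<phi> x < top" for x
        using that by (simp add: \<psi>_def ennreal_enn2real)
      have pointwise: "\<phi> x * indicator ?B x = ennreal ((v x powr (1 - sp) * \<psi> x powr sp * indicator ?B x) powr (1 / sp) *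
          (v x * indicator ?B x) powr (1 - 1 / sp))" if *: "x \<in> ?B \<longrightarrow> \<phi> x < top" for x
      proof (cases "x \<in> ?B")
        case True
        have "(v x powr (1 - sp) * \<psi> x powr sp) powr (1 / sp) * v x powr (1 - 1 / sp)
          = v x powr ((1 - sp) / sp + (1 - 1 / sp)) * \<psi> x"
          unfolding powr_mult powr_powr powr_add using sp(1) \<psi>_nonneg[of x] by simp
        also have "(1 - sp) / sp + (1 - 1 / sp) = 0" using sp(1) by (simp add: field_simps)
        finally show ?thesis using True * v0 by (simp add: \<phi>\<psi>)
      qed simp
      have "(\<integral>\<^sup>+x\<in>?B. \<phi> x \<partial>lborel) = (\<integral>\<^sup>+x. ennreal ((v x powr (1 - sp) * \<psi> x powr sp * indicator ?B x) powr (1 / sp) *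
          (v x * indicator ?B x) powr (1 - 1 / sp)) \<partial>lborel)"
      proof (rule nn_integral_cong_AE)
        show "AE x in lborel. \<phi> x * indicator ?B x = ennreal ((v x powr (1 - sp) * \<psi> x powr sp * indicator ?B x) powr (1 / sp) *
          (v x * indicator ?B x) powr (1 - 1 / sp))"
          using fin by eventually_elim (rule pointwise)
      qed
      also have "\<dots> \<le> ennreal (A powr (1 / sp) * measure V ?B powr (1 - 1 / sp))"
      proof (rule nn_integral_powr_interpolation_le)
        have "(\<integral>\<^sup>+x. ennreal (v x powr (1 - sp) * \<psi> x powr sp * indicator ?B x) \<partial>lborel) = ?I"
        proof (rule nn_integral_cong_AE)
          have pt: "ennreal (v x powr (1 - sp) * \<psi> x powr sp * indicator ?B x) = ennreal (v x powr (1 - sp)) * epowr (\<phi> x) sp * indicator ?B x"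
            if "x \<in> ?B \<longrightarrow> \<phi> x < top" for x
            using that \<psi>_nonneg[of x] sp(1) by (cases "x \<in> ?B") (auto simp: \<phi>\<psi> epowr_ennreal' ennreal_mult)
          show "AE x in lborel. ennreal (v x powr (1 - sp) * \<psi> x powr sp * indicator ?B x)
             = ennreal (v x powr (1 - sp)) * epowr (\<phi> x) sp * indicator ?B x"
            using fin by eventually_elim (rule pt)
        qed
        then show "(\<integral>\<^sup>+x. ennreal (v x powr (1 - sp) * \<psi> x powr sp * indicator ?B x) \<partial>lborel) \<le> ennreal A"
          using real by simp
        have "(\<integral>\<^sup>+x. ennreal (v x * indicator ?B x) \<partial>lborel) = emeasure V ?B"
          using v_pos by (subst emeasure_density) (auto intro!: nn_integral_cong simp: indicator_def)
        then show "(\<integral>\<^sup>+x. ennreal (v x * indicator ?B x) \<partial>lborel) \<le> ennreal (measure V ?B)"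
          using v_finite[of y r] by (simp add: emeasure_eq_ennreal_measure less_top[symmetric])
      qed (use sp v_pos A vpos in \<open>auto simp: less_imp_le \<psi>_nonneg\<close>)
      also have "\<dots> = local_norm \<phi> y r * ennreal (measure V ?B powr b)"
        using real A by (simp add: local_norm_def epowr_ennreal sp(2) ennreal_mult)
      finally show ?thesis .
    qed
  qed
qed

text \<open>The near part on 2B is paid for by the term j = 1, whose factor (U(B)/U(2B))^a is
  bounded below by doubling. The shells of the far part give the terms with j \<ge> 2.\<close>

lemma local_riesz_bound:
  obtains K where "K > 0"
    and "\<And>\<phi> y r. \<lbrakk>\<phi> \<in> borel_measurable borel; r > 0\<rbrakk> \<Longrightarrow>
      epowr (\<integral>\<^sup>+x\<in>ball y r. ennreal (u x) * epowr (riesz (DIM('a) * (a + b)) \<phi> x) (1 / a) \<partial>lborel) a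
      \<le> ennreal K * (\<Sum>j. ennreal ((measure U (ball y r) / measure U (ball y (2 ^ j * r))) powr a) * local_norm \<phi> y (2 ^ j * r))"
proof -
  define e where "e = DIM('a) * (a + b)"
  define q where "q = 1 / a"
  have e: "e > 0" using a_pos b_pos by (simp add: e_def)
  have q: "q > 0" "a * q = 1" "q * a = 1" using a_pos by (auto simp: q_def)
  obtain C1 where C1: "C1 > 0" and MW: "\<And>\<phi>. \<lbrakk>\<phi> \<in> borel_measurable borel; (\<integral>\<^sup>+x. \<phi> x \<partial>lborel) < top\<rbrakk> \<Longrightarrow>
      epowr (\<integral>\<^sup>+x. ennreal (u x) * epowr (riesz (DIM('a) * (a + b)) \<phi> x) (1 / a) \<partial>lborel) a
      \<le> ennreal C1 * epowr (\<integral>\<^sup>+x. ennreal (v x powr (1 - sp)) * epowr (\<phi> x) sp \<partial>lborel) (1 / sp)"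
    by (rule riesz_weighted_bound) (rule that)
  define w where "w = unit_ball_vol (real DIM('a))"
  have w: "w > 0" by (simp add: w_def)
  define K2 where "K2 = C0 * w powr (a + b) * 4 powr e"
  \<comment> \<open>The factor 2 is (2^q)^a, from splitting the q-th power inside the integral; 2^a
    comes from splitting the outer power a.\<close>
  define K where "K = 2 * 2 powr a * (C1 * DU powr a + K2)"
  have K2: "K2 > 0" using C0_pos w by (simp add: K2_def)
  have DU: "DU > 0" by (rule U.D_pos)
  show ?thesis
  proof (rule that)
    show "K > 0" unfolding K_def using C1 K2 DU by (intro mult_pos_pos add_pos_pos) auto
    fix \<phi> :: "'a \<Rightarrow> ennreal" and y :: 'a and r :: real
    assume [measurable]: "\<phi> \<in> borel_measurable borel" and r: "r > 0"
    let ?m = "\<lambda>R. measure U (ball y R)"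
    let ?t = "\<lambda>j. ennreal ((?m r / ?m (2 ^ j * r)) powr a) * local_norm \<phi> y (2 ^ j * r)"
    let ?\<Sigma> = "\<Sum>j. ?t j"
    have m_pos: "?m R > 0" if "R > 0" for R using ball_measure_pos(1)[OF that] .
    have term_le: "?t j \<le> ?\<Sigma>" for j
      using nn_integral_ge_point[of j UNIV ?t] by (simp only: nn_integral_count_space_nat UNIV_I)
    define \<phi>1 where "\<phi>1 z = \<phi> z * indicator (ball y (2 * r)) z" for z
    define \<phi>2 where "\<phi>2 z = \<phi> z * indicator (- ball y (2 * r)) z" for z
    have [measurable]: "\<phi>1 \<in> borel_measurable borel" "\<phi>2 \<in> borel_measurable borel"
      unfolding \<phi>1_def \<phi>2_def by measurable
    have split: "riesz e \<phi> x = riesz e \<phi>1 x + riesz e \<phi>2 x" for x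
      unfolding riesz_def by (subst nn_integral_add[symmetric])
        (auto intro!: nn_integral_cong simp: \<phi>1_def \<phi>2_def indicator_def)
    define I1 where "I1 = (\<integral>\<^sup>+x. ennreal (u x) * epowr (riesz e \<phi>1 x) q \<partial>lborel)"
    define I2 where "I2 = (\<integral>\<^sup>+x\<in>ball y r. ennreal (u x) * epowr (riesz e \<phi>2 x) q \<partial>lborel)"
    have near: "epowr I1 a \<le> ennreal (C1 * DU powr a) * ?\<Sigma>"
    proof -
      have "epowr I1 a \<le> ennreal C1 * local_norm \<phi> y (2 * r)"
      \<comment> \<open>A finite local norm makes \<phi>1 integrable by Hoelder's inequality, as the
        weighted bound for the potential requires.\<close>
      proof (cases "local_norm \<phi> y (2 * r) = top")
        case True
        then show ?thesis using C1 by (simp add: ennreal_mult_top)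
      next
        case False
        have "(\<integral>\<^sup>+x. \<phi>1 x \<partial>lborel) \<le> local_norm \<phi> y (2 * r) * ennreal (measure V (ball y (2 * r)) powr b)"
          unfolding \<phi>1_def using r by (intro local_holder) auto
        also have "\<dots> < top" using False by (simp add: ennreal_mult_less_top less_top)
        finally have "epowr I1 a \<le> ennreal C1 * epowr (\<integral>\<^sup>+x. ennreal (v x powr (1 - sp)) * epowr (\<phi>1 x) sp \<partial>lborel) (1 / sp)"
          unfolding I1_def e_def q_def by (intro MW) auto
        also have "(\<integral>\<^sup>+x. ennreal (v x powr (1 - sp)) * epowr (\<phi>1 x) sp \<partial>lborel)
           = (\<integral>\<^sup>+x\<in>ball y (2 * r). ennreal (v x powr (1 - sp)) * epowr (\<phi> x) sp \<partial>lborel)"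
          using exponents by (intro nn_integral_cong) (auto simp: \<phi>1_def indicator_def)
        finally show ?thesis by (simp add: local_norm_def)
      qed
      also have "\<dots> \<le> ennreal C1 * (ennreal (DU powr a) * ?t 1)"
      proof (intro mult_left_mono)
        have "?m (2 * r) \<le> DU * ?m r" by (rule doubling_U_V(1)[OF r])
        then have "1 \<le> DU * (?m r / ?m (2 * r))"
          using m_pos[of "2 * r"] r by (simp add: field_simps)
        then have "1 powr a \<le> (DU * (?m r / ?m (2 * r))) powr a"
          using a_pos by (intro powr_mono2) auto
        then have "1 \<le> ennreal (DU powr a * (?m r / ?m (2 * r)) powr a)"
          by (simp add: powr_mult powr_divide)
        then have "1 * local_norm \<phi> y (2 * r) \<le> ennreal (DU powr a * (?m r / ?m (2 * r)) powr a) * local_norm \<phi> y (2 * r)"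
          by (rule mult_right_mono) simp
        then show "local_norm \<phi> y (2 * r) \<le> ennreal (DU powr a) * ?t 1"
          by (simp add: ennreal_mult_mult)
      qed simp
      also have "\<dots> \<le> ennreal C1 * (ennreal (DU powr a) * ?\<Sigma>)"
        by (intro mult_left_mono term_le) auto
      also have "\<dots> = ennreal (C1 * DU powr a) * ?\<Sigma>"
        using C1 by (intro ennreal_mult_mult) auto
      finally show ?thesis .
    qed
    have far: "epowr I2 a \<le> ennreal K2 * ?\<Sigma>"
    proof -
      let ?R = "\<lambda>i. 2 ^ (i + 2) * r"
      \<comment> \<open>A bound of the far potential that is uniform over the ball. On the ball of
        radius 4 2^i r the A condition gives V^b \<le> C0 |B|^(a+b) U^(-a); the volume power cancels
        the kernel (2^i r)^(-e) up to 4^e, which is contained in \<open>K2\<close>.\<close>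
      define S where "S = (\<Sum>i. ennreal (K2 * ?m (?R i) powr (- a)) * local_norm \<phi> y (?R i))"
      have S: "riesz e \<phi>2 x \<le> S" if x: "x \<in> ball y r" for x
      proof -
        have "riesz e \<phi>2 x \<le> (\<Sum>i. ennreal ((2 ^ i * r) powr (- e)) * (\<integral>\<^sup>+z\<in>ball y (?R i). \<phi> z \<partial>lborel))"
          unfolding \<phi>2_def by (rule riesz_far_le[OF _ e r x]) measurable
        also have "\<dots> \<le> S"
          unfolding S_def
        proof (intro suminf_le)
          fix i
          have R: "?R i > 0" using r by simp
          have "?m (?R i) powr a * measure V (ball y (?R i)) powr b \<le> C0 * measure lborel (ball y (?R i)) powr (a + b)"
            by (rule A_condition[OF R])
          also have "measure lborel (ball y (?R i)) = w * (4 * (2 ^ i * r)) powr DIM('a)"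
            using r unfolding w_def by (subst measure_lborel_ball) (auto simp: mult.assoc)
          also have "C0 * (w * (4 * (2 ^ i * r)) powr DIM('a)) powr (a + b) = K2 * (2 ^ i * r) powr e"
            using w r unfolding K2_def e_def powr_mult powr_powr by (simp only: mult_ac)
          finally have "(2 ^ i * r) powr (- e) * measure V (ball y (?R i)) powr b \<le> K2 * ?m (?R i) powr (- a)"
            using m_pos[OF R] r by (simp add: powr_minus field_simps)
          then have "ennreal ((2 ^ i * r) powr (- e)) * ennreal (measure V (ball y (?R i)) powr b) \<le> ennreal (K2 * ?m (?R i) powr (- a))"
            by (simp add: ennreal_mult[symmetric] ennreal_leI)
          then have "local_norm \<phi> y (?R i) * (ennreal ((2 ^ i * r) powr (- e)) * ennreal (measure V (ball y (?R i)) powr b))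
             \<le> local_norm \<phi> y (?R i) * ennreal (K2 * ?m (?R i) powr (- a))"
            by (rule mult_left_mono) simp
          moreover have "ennreal ((2 ^ i * r) powr (- e)) * (\<integral>\<^sup>+z\<in>ball y (?R i). \<phi> z \<partial>lborel)
             \<le> ennreal ((2 ^ i * r) powr (- e)) * (local_norm \<phi> y (?R i) * ennreal (measure V (ball y (?R i)) powr b))"
            using R by (intro mult_left_mono local_holder) auto
          ultimately show "ennreal ((2 ^ i * r) powr (- e)) * (\<integral>\<^sup>+z\<in>ball y (?R i). \<phi> z \<partial>lborel)
             \<le> ennreal (K2 * ?m (?R i) powr (- a)) * local_norm \<phi> y (?R i)"
            by (elim order_trans) (simp only: mult_ac)
        qed auto
        finally show ?thesis .
      qed
      have "I2 \<le> (\<integral>\<^sup>+x. epowr S q * (ennreal (u x) * indicator (ball y r) x) \<partial>lborel)"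
        unfolding I2_def
      proof (intro nn_integral_mono)
        fix x
        show "ennreal (u x) * epowr (riesz e \<phi>2 x) q * indicator (ball y r) x \<le> epowr S q * (ennreal (u x) * indicator (ball y r) x)"
        proof (cases "x \<in> ball y r")
          case True
          then have "ennreal (u x) * epowr (riesz e \<phi>2 x) q \<le> ennreal (u x) * epowr S q"
            using S q by (intro mult_left_mono epowr_mono) auto
          then show ?thesis using True by (simp add: mult.commute)
        qed simp
      qed
      also have "\<dots> = epowr S q * (\<integral>\<^sup>+x. ennreal (u x) * indicator (ball y r) x \<partial>lborel)"
        by (rule nn_integral_cmult) measurable
      also have "(\<integral>\<^sup>+x. ennreal (u x) * indicator (ball y r) x \<partial>lborel) = emeasure U (ball y r)"
        by (simp add: emeasure_density)
      also have "\<dots> = ennreal (?m r)"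
        using u_finite[of y r] by (intro emeasure_eq_ennreal_measure) auto
      finally have "epowr I2 a \<le> epowr (epowr S q * ennreal (?m r)) a"
        using a_pos by (intro epowr_mono) auto
      also have "\<dots> = S * ennreal (?m r powr a)"
        using a_pos q m_pos[OF r] by (simp add: epowr_mult epowr_epowr epowr_ennreal)
      also have "\<dots> = (\<Sum>i. ennreal K2 * ?t (i + 2))"
      proof -
        have "ennreal (K2 * ?m (?R i) powr (- a)) * local_norm \<phi> y (?R i) * ennreal (?m r powr a) = ennreal K2 * ?t (i + 2)" for i
        proof -
          have R: "?R i > 0" using r by simp
          have eq: "?m r powr a * (K2 * ?m (?R i) powr (- a)) = K2 * (?m r / ?m (?R i)) powr a"
            using m_pos[OF r] m_pos[OF R] by (simp add: powr_divide powr_minus field_simps)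
          have "ennreal (K2 * ?m (?R i) powr (- a)) * local_norm \<phi> y (?R i) * ennreal (?m r powr a)
            = ennreal (?m r powr a) * (ennreal (K2 * ?m (?R i) powr (- a)) * local_norm \<phi> y (?R i))"
            by (simp only: mult_ac)
          also have "\<dots> = ennreal (K2 * (?m r / ?m (?R i)) powr a) * local_norm \<phi> y (?R i)"
            using K2 unfolding eq[symmetric] by (intro ennreal_mult_mult) auto
          also have "\<dots> = ennreal K2 * ?t (i + 2)"
            using K2 by (subst ennreal_mult_mult) auto
          finally show ?thesis .
        qed
        then show ?thesis unfolding S_def by (simp only: ennreal_suminf_multc[symmetric])
      qed
      also have "\<dots> = ennreal K2 * (\<Sum>i. ?t (i + 2))" by (rule ennreal_suminf_cmult)
      also have "\<dots> \<le> ennreal K2 * ?\<Sigma>"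
        using suminf_offset[of ?t 2] by (intro mult_left_mono) (auto simp: add_increasing)
      finally show ?thesis .
    qed
    have "(\<integral>\<^sup>+x\<in>ball y r. ennreal (u x) * epowr (riesz e \<phi> x) q \<partial>lborel)
      \<le> (\<integral>\<^sup>+x. ennreal (2 powr q) * (ennreal (u x) * epowr (riesz e \<phi>1 x) q + ennreal (u x) * epowr (riesz e \<phi>2 x) q * indicator (ball y r) x) \<partial>lborel)"
    proof (intro nn_integral_mono)
      fix x
      show "ennreal (u x) * epowr (riesz e \<phi> x) q * indicator (ball y r) x \<le> ennreal (2 powr q) * (ennreal (u x) * epowr (riesz e \<phi>1 x) q + ennreal (u x) * epowr (riesz e \<phi>2 x) q * indicator (ball y r) x)"
      proof (cases "x \<in> ball y r")
        case True
        have "ennreal (u x) * epowr (riesz e \<phi> x) q \<le> ennreal (u x) * (ennreal (2 powr q) * (epowr (riesz e \<phi>1 x) q + epowr (riesz e \<phi>2 x) q))"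
          unfolding split using q by (intro mult_left_mono epowr_add_le) auto
        also have "\<dots> = ennreal (2 powr q) * (ennreal (u x) * epowr (riesz e \<phi>1 x) q + ennreal (u x) * epowr (riesz e \<phi>2 x) q)"
          by (simp only: distrib_left mult_ac)
        finally show ?thesis using True by simp
      qed simp
    qed
    also have "\<dots> = ennreal (2 powr q) * (I1 + I2)"
      unfolding I1_def I2_def by (simp add: nn_integral_cmult nn_integral_add)
    finally have "epowr (\<integral>\<^sup>+x\<in>ball y r. ennreal (u x) * epowr (riesz e \<phi> x) q \<partial>lborel) a \<le> epowr (ennreal (2 powr q) * (I1 + I2)) a"
      using a_pos by (intro epowr_mono) auto
    also have "\<dots> = ennreal 2 * epowr (I1 + I2) a"
      using a_pos q by (simp add: epowr_mult epowr_ennreal powr_powr)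
    also have "\<dots> \<le> ennreal 2 * (ennreal (2 powr a) * (epowr I1 a + epowr I2 a))"
      using a_pos by (intro mult_left_mono epowr_add_le) auto
    also have "\<dots> \<le> ennreal 2 * (ennreal (2 powr a) * (ennreal (C1 * DU powr a) * ?\<Sigma> + ennreal K2 * ?\<Sigma>))"
      by (intro mult_left_mono add_mono near far) auto
    also have "\<dots> = ennreal K * ?\<Sigma>"
    proof -
      have "ennreal (C1 * DU powr a) * ?\<Sigma> + ennreal K2 * ?\<Sigma> = ennreal (C1 * DU powr a + K2) * ?\<Sigma>"
        using C1 K2 by (subst ennreal_plus) (auto simp: distrib_right)
      moreover have "ennreal 2 * (ennreal (2 powr a) * (ennreal (C1 * DU powr a + K2) * ?\<Sigma>)) = ennreal K * ?\<Sigma>"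
      proof -
        have triple: "ennreal x * (ennreal y * (ennreal z * Z)) = ennreal (x * y * z) * Z" if "x \<ge> 0" "y \<ge> 0" "z \<ge> 0" for x y z Z
          using that by (simp add: ennreal_mult mult.assoc)
        show ?thesis unfolding K_def by (rule triple) (use C1 K2 in auto)
      qed
      ultimately show ?thesis by (simp only:)
    qed
    finally show "epowr (\<integral>\<^sup>+x\<in>ball y r. ennreal (u x) * epowr (riesz (DIM('a) * (a + b)) \<phi> x) (1 / a) \<partial>lborel) a \<le> ennreal K * ?\<Sigma>"
      unfolding e_def q_def .
  qed
qed

text \<open>With m_j = U(2^j B), the identity m_0^(\<eta>-a) (m_0/m_j)^a = (m_0/m_j)^\<eta>
  m_j^(\<eta>-a) moves the weight factor onto the large ball. Iterated reverse doubling gives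
  m_0/m_j \<le> \<delta>^j, so c j = K \<delta>^(\<eta> j) is summable.\<close>

lemma weighted_local_riesz_bound:
  assumes \<eta>: "\<eta> > 0"
  obtains c S where "\<And>j::nat. c j \<ge> (0::real)" "c sums S" "S > 0"
    and "\<And>\<phi> y r. \<lbrakk>\<phi> \<in> borel_measurable borel; r > 0\<rbrakk> \<Longrightarrow>
      ennreal (measure U (ball y r) powr (\<eta> - a)) *
      epowr (\<integral>\<^sup>+x\<in>ball y r. ennreal (u x) * epowr (riesz (DIM('a) * (a + b)) \<phi> x) (1 / a) \<partial>lborel) a
      \<le> (\<Sum>j. ennreal (c j) * (ennreal (measure U (ball y (2 ^ j * r)) powr (\<eta> - a)) * local_norm \<phi> y (2 ^ j * r)))"
proof -
  obtain K where K: "K > 0" and bound: "\<And>\<phi> y r. \<lbrakk>\<phi> \<in> borel_measurable borel; r > 0\<rbrakk> \<Longrightarrow>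
      epowr (\<integral>\<^sup>+x\<in>ball y r. ennreal (u x) * epowr (riesz (DIM('a) * (a + b)) \<phi> x) (1 / a) \<partial>lborel) a
      \<le> ennreal K * (\<Sum>j. ennreal ((measure U (ball y r) / measure U (ball y (2 ^ j * r))) powr a) * local_norm \<phi> y (2 ^ j * r))"
    by (rule local_riesz_bound) (rule that)
  obtain \<delta> where \<delta>: "0 < \<delta>" "\<delta> < 1" "\<And>x r. r > 0 \<Longrightarrow> measure U (ball x r) \<le> \<delta> * measure U (ball x (2 * r))"
    using reverse_doubling by blast
  have iter: "measure U (ball x r) \<le> \<delta> ^ j * measure U (ball x (2 ^ j * r))" if "r > 0" for x r j
  proof (induction j)
    case (Suc j)
    have "measure U (ball x (2 ^ j * r)) \<le> \<delta> * measure U (ball x (2 ^ Suc j * r))"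
      using \<delta>(3)[of "2 ^ j * r" x] that by (simp add: mult.assoc)
    then have "\<delta> ^ j * measure U (ball x (2 ^ j * r)) \<le> \<delta> ^ j * (\<delta> * measure U (ball x (2 ^ Suc j * r)))"
      using \<delta> by (intro mult_left_mono) auto
    then show ?case using Suc by (simp add: mult_ac)
  qed simp
  define \<rho> where "\<rho> = \<delta> powr \<eta>"
  have \<rho>: "0 < \<rho>" "\<rho> < 1"
    using \<delta> \<eta> powr_less_mono2[of \<eta> \<delta> 1] by (auto simp: \<rho>_def)
  show ?thesis
  proof (rule that)
    show "K * \<rho> ^ j \<ge> 0" for j using K \<rho> by simp
    show "(\<lambda>j. K * \<rho> ^ j) sums (K * (1 / (1 - \<rho>)))"
      using \<rho> by (intro sums_mult geometric_sums) auto
    show "K * (1 / (1 - \<rho>)) > 0" using K \<rho> by simp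
    fix \<phi> :: "'a \<Rightarrow> ennreal" and y :: 'a and r :: real
    assume \<phi>: "\<phi> \<in> borel_measurable borel" and r: "r > 0"
    let ?m = "\<lambda>R. measure U (ball y R)"
    have m_pos: "?m R > 0" if "R > 0" for R using ball_measure_pos(1)[OF that] .
    have "ennreal (?m r powr (\<eta> - a)) *
      epowr (\<integral>\<^sup>+x\<in>ball y r. ennreal (u x) * epowr (riesz (DIM('a) * (a + b)) \<phi> x) (1 / a) \<partial>lborel) a
      \<le> ennreal (?m r powr (\<eta> - a)) * (ennreal K * (\<Sum>j. ennreal ((?m r / ?m (2 ^ j * r)) powr a) * local_norm \<phi> y (2 ^ j * r)))"
      by (intro mult_left_mono bound \<phi> r) auto
    also have "\<dots> = (\<Sum>j. ennreal (?m r powr (\<eta> - a)) * (ennreal K * (ennreal ((?m r / ?m (2 ^ j * r)) powr a) * local_norm \<phi> y (2 ^ j * r))))"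
      by simp
    also have "\<dots> \<le> (\<Sum>j. ennreal (K * \<rho> ^ j) * (ennreal (?m (2 ^ j * r) powr (\<eta> - a)) * local_norm \<phi> y (2 ^ j * r)))"
    proof (intro suminf_le)
      fix j
      have R: "2 ^ j * r > 0" using r by simp
      have "?m r / ?m (2 ^ j * r) \<le> \<delta> ^ j"
        using iter[OF r, of y j] m_pos[OF R] by (simp add: divide_le_eq)
      then have "(?m r / ?m (2 ^ j * r)) powr \<eta> \<le> (\<delta> ^ j) powr \<eta>"
        using \<eta> by (intro powr_mono2) auto
      also have "\<dots> = \<rho> ^ j"
        using \<delta> by (simp add: \<rho>_def powr_realpow[symmetric] powr_powr mult.commute)
      finally have le: "(?m r / ?m (2 ^ j * r)) powr \<eta> * ?m (2 ^ j * r) powr (\<eta> - a) \<le> \<rho> ^ j * ?m (2 ^ j * r) powr (\<eta> - a)"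
        by (rule mult_right_mono) simp
      have "?m r powr (\<eta> - a) * (?m r / ?m (2 ^ j * r)) powr a = (?m r / ?m (2 ^ j * r)) powr \<eta> * ?m (2 ^ j * r) powr (\<eta> - a)"
        using m_pos[OF r] m_pos[OF R] by (simp add: powr_divide powr_diff)
      with le have "?m r powr (\<eta> - a) * (K * (?m r / ?m (2 ^ j * r)) powr a) \<le> K * \<rho> ^ j * ?m (2 ^ j * r) powr (\<eta> - a)"
        using K by (simp add: mult.left_commute mult.assoc)
      then have "ennreal (?m r powr (\<eta> - a) * (K * (?m r / ?m (2 ^ j * r)) powr a)) * local_norm \<phi> y (2 ^ j * r)
         \<le> ennreal (K * \<rho> ^ j * ?m (2 ^ j * r) powr (\<eta> - a)) * local_norm \<phi> y (2 ^ j * r)"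
        by (intro mult_right_mono ennreal_leI) auto
      also have "\<dots> = ennreal (K * \<rho> ^ j) * (ennreal (?m (2 ^ j * r) powr (\<eta> - a)) * local_norm \<phi> y (2 ^ j * r))"
        using K \<rho> by (intro ennreal_mult_mult[symmetric]) auto
      also have "ennreal (?m r powr (\<eta> - a) * (K * (?m r / ?m (2 ^ j * r)) powr a)) * local_norm \<phi> y (2 ^ j * r)
         = ennreal (?m r powr (\<eta> - a)) * (ennreal K * (ennreal ((?m r / ?m (2 ^ j * r)) powr a) * local_norm \<phi> y (2 ^ j * r)))"
        using K by (subst (2) ennreal_mult_mult, auto, subst ennreal_mult_mult, auto)
      finally show "ennreal (?m r powr (\<eta> - a)) * (ennreal K * (ennreal ((?m r / ?m (2 ^ j * r)) powr a) * local_norm \<phi> y (2 ^ j * r)))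
        \<le> ennreal (K * \<rho> ^ j) * (ennreal (?m (2 ^ j * r) powr (\<eta> - a)) * local_norm \<phi> y (2 ^ j * r))" .
    qed auto
    finally show "ennreal (?m r powr (\<eta> - a)) *
      epowr (\<integral>\<^sup>+x\<in>ball y r. ennreal (u x) * epowr (riesz (DIM('a) * (a + b)) \<phi> x) (1 / a) \<partial>lborel) a
      \<le> (\<Sum>j. ennreal (K * \<rho> ^ j) * (ennreal (?m (2 ^ j * r) powr (\<eta> - a)) * local_norm \<phi> y (2 ^ j * r)))" .
  qed
qed

end

section \<open>Kernels with a Gaussian bound\<close>

text \<open>z^s exp(-z) is largest at z = s, which is the inequality ln(z/s) \<le> z/s - 1.\<close>

lemma exp_minus_le_powr:
  fixes s z :: real
  assumes "s > 0" "z > 0"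
  shows "exp (- z) \<le> s powr s * z powr (- s)"
proof -
  have "ln (z / s) \<le> z / s - 1" using assms by (intro ln_le_minus_one) auto
  then have "s * (ln z - ln s) \<le> s * (z / s - 1)"
    using assms by (intro mult_left_mono) (auto simp: ln_div)
  also have "\<dots> = z - s" using assms by (simp add: right_diff_distrib)
  finally have "- z \<le> s * ln s + (- s) * ln z" using assms by (simp add: algebra_simps)
  then have "exp (- z) \<le> exp (s * ln s + (- s) * ln z)" by simp
  then show ?thesis using assms by (simp add: powr_def exp_add[symmetric])
qed

text \<open>Split at t = d^2. Below, the exponential is at most a constant times (t/d^2)^(n/2),
  which leaves d^(-n) t^(\<gamma>/2-1), integrable at 0 because \<gamma> > 0. Above, it is at most
  1, and t^((\<gamma>-n)/2-1) is integrable at infinity because \<gamma> < n.\<close>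

lemma gaussian_time_integral:
  fixes n \<gamma> A :: real
  assumes \<gamma>: "0 < \<gamma>" "\<gamma> < n" and A: "A > 0"
  obtains C where "C > 0"
    and "\<And>d. d > 0 \<Longrightarrow> (\<integral>\<^sup>+t\<in>{0<..}. ennreal (t powr (- n / 2) * exp (- A * d\<^sup>2 / t) * t powr (\<gamma> / 2 - 1)) \<partial>lborel)
       \<le> ennreal (C * d powr (\<gamma> - n))"
proof -
  define K where "K = (n / 2) powr (n / 2) * A powr (- (n / 2))"
  have K: "K > 0" using \<gamma> A by (simp add: K_def)
  define C where "C = K * (2 / \<gamma>) + 2 / (n - \<gamma>)"
  show ?thesis
  proof (rule that)
    show "C > 0" unfolding C_def using K \<gamma> by (intro add_pos_pos mult_pos_pos) auto
    fix d :: real assume d: "d > 0"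
    have d2: "d\<^sup>2 powr x = d powr (2 * x)" for x
    proof -
      have "d\<^sup>2 = d powr 2" using d by simp
      then show ?thesis by (simp only: powr_powr)
    qed
    let ?a = "\<gamma> / 2 - 1" and ?b = "(\<gamma> - n) / 2 - 1"
    let ?f = "\<lambda>t. ennreal (K * d powr (- n)) * (ennreal (t powr ?a) * indicator {0..d\<^sup>2} t) + ennreal (t powr ?b) * indicator {d\<^sup>2..} t"
    have "(\<integral>\<^sup>+t\<in>{0<..}. ennreal (t powr (- n / 2) * exp (- A * d\<^sup>2 / t) * t powr (\<gamma> / 2 - 1)) \<partial>lborel) \<le> (\<integral>\<^sup>+t. ?f t \<partial>lborel)"
    proof (intro nn_integral_mono)
      fix t :: real
      show "ennreal (t powr (- n / 2) * exp (- A * d\<^sup>2 / t) * t powr (\<gamma> / 2 - 1)) * indicator {0<..} t \<le> ?f t"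
      proof (cases "t > 0")
        case True
        have tb: "t powr (- n / 2) * t powr ?a = t powr ?b"
        proof -
          have "- n / 2 + ?a = ?b" by (simp add: field_simps)
          then show ?thesis by (simp only: powr_add[symmetric])
        qed
        show ?thesis
        proof (cases "t \<le> d\<^sup>2")
          case le: True
          have "exp (- (A * d\<^sup>2 / t)) \<le> (n / 2) powr (n / 2) * (A * d\<^sup>2 / t) powr (- (n / 2))"
            using A d True \<gamma> by (intro exp_minus_le_powr) auto
          also have "(A * d\<^sup>2 / t) powr (- (n / 2)) = A powr (- (n / 2)) * d powr (- n) * t powr (n / 2)"
          proof -
            have "(A * d\<^sup>2 / t) powr (- (n / 2)) = A powr (- (n / 2)) * d powr (2 * - (n / 2)) / t powr (- (n / 2))"
              by (simp only: powr_divide powr_mult d2)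
            moreover have "2 * - (n / 2) = - n" by simp
            ultimately show ?thesis by (simp only: powr_minus_divide[of t]) simp
          qed
          finally have "exp (- A * d\<^sup>2 / t) \<le> K * d powr (- n) * t powr (n / 2)"
            by (simp add: K_def mult.assoc)
          then have "t powr (- n / 2) * exp (- A * d\<^sup>2 / t) * t powr ?a \<le> t powr (- n / 2) * (K * d powr (- n) * t powr (n / 2)) * t powr ?a"
            by (intro mult_right_mono mult_left_mono) auto
          also have "\<dots> = K * d powr (- n) * t powr ?a"
            using True by (simp add: powr_minus)
          finally have "ennreal (t powr (- n / 2) * exp (- A * d\<^sup>2 / t) * t powr ?a) \<le> ennreal (K * d powr (- n)) * ennreal (t powr ?a)"
            using K by (simp add: ennreal_mult[symmetric] ennreal_leI)
          then show ?thesis using True le by (simp add: add_increasing2)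
        next
          case False
          have "exp (- A * d\<^sup>2 / t) \<le> 1" using A True by simp
          then have "t powr (- n / 2) * exp (- A * d\<^sup>2 / t) * t powr ?a \<le> t powr (- n / 2) * 1 * t powr ?a"
            by (intro mult_right_mono mult_left_mono) auto
          then have "t powr (- n / 2) * exp (- A * d\<^sup>2 / t) * t powr ?a \<le> t powr ?b"
            using tb by simp
          then show ?thesis using True False by (simp add: ennreal_leI)
        qed
      qed simp
    qed
    also have "\<dots> = ennreal (K * d powr (- n)) * (\<integral>\<^sup>+t. ennreal (t powr ?a) * indicator {0..d\<^sup>2} t \<partial>lborel)
        + (\<integral>\<^sup>+t. ennreal (t powr ?b) * indicator {d\<^sup>2..} t \<partial>lborel)"
      by (simp add: nn_integral_add nn_integral_cmult)
    also have "(\<integral>\<^sup>+t. ennreal (t powr ?a) * indicator {0..d\<^sup>2} t \<partial>lborel) = ennreal (d\<^sup>2 powr (?a + 1) / (?a + 1))"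
      using \<gamma> d by (intro nn_integral_has_integral_lebesgue' has_integral_powr_from_0) auto
    also have "(\<integral>\<^sup>+t. ennreal (t powr ?b) * indicator {d\<^sup>2..} t \<partial>lborel) = ennreal (- (d\<^sup>2 powr (?b + 1)) / (?b + 1))"
      using \<gamma> d by (intro nn_integral_has_integral_lebesgue' has_integral_powr_to_inf) auto
    also have "ennreal (K * d powr (- n)) * ennreal (d\<^sup>2 powr (?a + 1) / (?a + 1)) + ennreal (- (d\<^sup>2 powr (?b + 1)) / (?b + 1))
       = ennreal (C * d powr (\<gamma> - n))"
    proof -
      have 1: "d\<^sup>2 powr (?a + 1) / (?a + 1) = d powr \<gamma> * (2 / \<gamma>)" using \<gamma> by (simp add: d2)
      have 2: "- (d\<^sup>2 powr (?b + 1)) / (?b + 1) = d powr (\<gamma> - n) * (2 / (n - \<gamma>))"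
      proof -
        have e: "?b + 1 = (\<gamma> - n) / 2" by simp
        have "d\<^sup>2 powr (?b + 1) = d powr (\<gamma> - n)" unfolding e d2 by (rule arg_cong[where f="\<lambda>z. d powr z"]) (simp add: field_simps)
        moreover have "- X / ((\<gamma> - n) / 2) = X * (2 / (n - \<gamma>))" for X
          using \<gamma> by (simp add: field_simps)
        ultimately show ?thesis by (simp only: e)
      qed
      have 3: "d powr (- n) * d powr \<gamma> = d powr (\<gamma> - n)" by (simp add: powr_add[symmetric])
      have "K * d powr (- n) * (d powr \<gamma> * (2 / \<gamma>)) + d powr (\<gamma> - n) * (2 / (n - \<gamma>)) = C * d powr (\<gamma> - n)"
        unfolding C_def 3[symmetric] by (simp add: algebra_simps)
      then show ?thesis
        unfolding 1 2 using K \<gamma> by (subst ennreal_mult[symmetric], simp, simp, subst ennreal_plus[symmetric]) auto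
    qed
    finally show "(\<integral>\<^sup>+t\<in>{0<..}. ennreal (t powr (- n / 2) * exp (- A * d\<^sup>2 / t) * t powr (\<gamma> / 2 - 1)) \<partial>lborel)
       \<le> ennreal (C * d powr (\<gamma> - n))" .
  qed
qed

text \<open>The iterated integral with absolute values inside. It dominates the fractional integral,
  and its finiteness at x is the criterion for convergence there.\<close>

definition absolute_potential ::
  "(real \<Rightarrow> real^'n \<Rightarrow> real^'n \<Rightarrow> complex) \<Rightarrow> real \<Rightarrow> (real^'n \<Rightarrow> complex) \<Rightarrow> real^'n \<Rightarrow> ennreal" where
  "absolute_potential k \<gamma> f x =
     (\<integral>\<^sup>+t\<in>{0<..}. (\<integral>\<^sup>+y. ennreal (norm (k t x y * f y)) \<partial>lborel) * ennreal (t powr (\<gamma> / 2 - 1)) \<partial>lborel)"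

text \<open>The kernel is replaced by its Gaussian majorant before the integrals are exchanged, so
  that Tonelli's theorem meets only Borel functions and the bound holds at every x.\<close>

lemma absolute_potential_le_riesz:
  fixes k :: "real \<Rightarrow> real^'n \<Rightarrow> real^'n \<Rightarrow> complex"
  assumes k: "gaussian_upper_bound k" and \<gamma>: "0 < \<gamma>" "\<gamma> < real CARD('n)"
  obtains C where "C > 0"
    and "\<And>f \<phi> x. \<phi> \<in> borel_measurable borel \<Longrightarrow> (AE y in lborel. ennreal (norm (f y)) = \<phi> y) \<Longrightarrow>
      absolute_potential k \<gamma> f x \<le> ennreal C * riesz (real CARD('n) - \<gamma>) \<phi> x"
proof -
  let ?n = "real CARD('n)"
  obtain C0 A where C0: "C0 > 0" and A: "A > 0"
    and gauss: "\<And>t x y. t > 0 \<Longrightarrow> norm (k t x y) \<le> C0 * t powr (- ?n / 2) * exp (- A * (norm (x - y))\<^sup>2 / t)"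
    using k unfolding gaussian_upper_bound_def by blast
  obtain C1 where C1: "C1 > 0" and time: "\<And>d. d > 0 \<Longrightarrow>
      (\<integral>\<^sup>+t\<in>{0<..}. ennreal (t powr (- ?n / 2) * exp (- A * d\<^sup>2 / t) * t powr (\<gamma> / 2 - 1)) \<partial>lborel) \<le> ennreal (C1 * d powr (\<gamma> - ?n))"
    by (rule gaussian_time_integral[OF \<gamma> A]) (rule that)
  show ?thesis
  proof (rule that)
    show "C0 * C1 > 0" using C0 C1 by simp
    fix f :: "real^'n \<Rightarrow> complex" and \<phi> :: "real^'n \<Rightarrow> ennreal" and x :: "real^'n"
    assume [measurable]: "\<phi> \<in> borel_measurable borel" and f\<phi>: "AE y in lborel. ennreal (norm (f y)) = \<phi> y"
    let ?g = "\<lambda>t y. t powr (- ?n / 2) * exp (- A * (dist x y)\<^sup>2 / t) * t powr (\<gamma> / 2 - 1)"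
    have "absolute_potential k \<gamma> f x \<le> (\<integral>\<^sup>+t. (\<integral>\<^sup>+y. ennreal C0 * (\<phi> y * (ennreal (?g t y) * indicator {0<..} t)) \<partial>lborel) \<partial>lborel)"
      unfolding absolute_potential_def
    proof (intro nn_integral_mono)
      fix t :: real
      show "(\<integral>\<^sup>+y. ennreal (norm (k t x y * f y)) \<partial>lborel) * ennreal (t powr (\<gamma> / 2 - 1)) * indicator {0<..} t
         \<le> (\<integral>\<^sup>+y. ennreal C0 * (\<phi> y * (ennreal (?g t y) * indicator {0<..} t)) \<partial>lborel)"
      proof (cases "t > 0")
        case t: True
        let ?h = "\<lambda>y. C0 * (t powr (- ?n / 2) * exp (- A * (dist x y)\<^sup>2 / t))"
        have "(\<integral>\<^sup>+y. ennreal (norm (k t x y * f y)) \<partial>lborel) \<le> (\<integral>\<^sup>+y. ennreal (?h y) * \<phi> y \<partial>lborel)"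
        proof (rule nn_integral_mono_AE, use f\<phi> in eventually_elim)
          fix y assume "ennreal (norm (f y)) = \<phi> y"
          moreover have "ennreal (norm (k t x y)) \<le> ennreal (?h y)"
            using gauss[OF t, of x y] by (intro ennreal_leI) (simp add: dist_norm mult.assoc)
          ultimately show "ennreal (norm (k t x y * f y)) \<le> ennreal (?h y) * \<phi> y"
            by (simp add: norm_mult ennreal_mult) (metis mult_right_mono zero_le)
        qed
        then have "(\<integral>\<^sup>+y. ennreal (norm (k t x y * f y)) \<partial>lborel) * ennreal (t powr (\<gamma> / 2 - 1))
          \<le> (\<integral>\<^sup>+y. ennreal (?h y) * \<phi> y \<partial>lborel) * ennreal (t powr (\<gamma> / 2 - 1))"
          by (rule mult_right_mono) simp
        also have "\<dots> = (\<integral>\<^sup>+y. ennreal (?h y) * \<phi> y * ennreal (t powr (\<gamma> / 2 - 1)) \<partial>lborel)"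
          by (rule nn_integral_multc[symmetric]) measurable
        also have "\<dots> = (\<integral>\<^sup>+y. ennreal C0 * (\<phi> y * (ennreal (?g t y) * indicator {0<..} t)) \<partial>lborel)"
        proof (intro nn_integral_cong)
          fix y
          have "ennreal (?h y) * ennreal (t powr (\<gamma> / 2 - 1)) = ennreal C0 * ennreal (?g t y)"
            using C0 by (simp add: ennreal_mult[symmetric] mult.assoc)
          then show "ennreal (?h y) * \<phi> y * ennreal (t powr (\<gamma> / 2 - 1)) = ennreal C0 * (\<phi> y * (ennreal (?g t y) * indicator {0<..} t))"
            using t by (simp only: mult_ac) (simp add: mult.left_commute mult.assoc[symmetric])
        qed
        finally show ?thesis using t by simp
      qed simp
    qed
    also have "\<dots> = (\<integral>\<^sup>+y. (\<integral>\<^sup>+t. ennreal C0 * (\<phi> y * (ennreal (?g t y) * indicator {0<..} t)) \<partial>lborel) \<partial>lborel)"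
      by (rule lborel_pair.Fubini'[symmetric]) measurable
    also have "\<dots> \<le> (\<integral>\<^sup>+y. ennreal (C0 * C1) * (ennreal (dist x y powr (- (?n - \<gamma>))) * \<phi> y) \<partial>lborel)"
    \<comment> \<open>The time integral is controlled only for d > 0, so the point y = x is
      discarded.\<close>
    proof (rule nn_integral_mono_AE, use AE_lborel_singleton[of x] in eventually_elim)
      fix y assume "y \<noteq> x"
      then have d: "dist x y > 0" by simp
      have "(\<integral>\<^sup>+t. ennreal C0 * (\<phi> y * (ennreal (?g t y) * indicator {0<..} t)) \<partial>lborel)
         = ennreal C0 * (\<phi> y * (\<integral>\<^sup>+t\<in>{0<..}. ennreal (?g t y) \<partial>lborel))"
        by (simp add: nn_integral_cmult)
      also have "\<dots> \<le> ennreal C0 * (\<phi> y * ennreal (C1 * dist x y powr (\<gamma> - ?n)))"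
        by (intro mult_left_mono time d) auto
      also have "\<dots> = ennreal (C0 * C1) * (ennreal (dist x y powr (- (?n - \<gamma>))) * \<phi> y)"
        using C0 C1 by (simp add: ennreal_mult mult_ac)
      finally show "(\<integral>\<^sup>+t. ennreal C0 * (\<phi> y * (ennreal (?g t y) * indicator {0<..} t)) \<partial>lborel)
         \<le> ennreal (C0 * C1) * (ennreal (dist x y powr (- (?n - \<gamma>))) * \<phi> y)" .
    qed
    also have "\<dots> = ennreal (C0 * C1) * riesz (?n - \<gamma>) \<phi> x"
      unfolding riesz_def by (rule nn_integral_cmult) measurable
    finally show "absolute_potential k \<gamma> f x \<le> ennreal (C0 * C1) * riesz (?n - \<gamma>) \<phi> x" .
  qed
qed

text \<open>Covers functions that are not integrable as well, since their integral is 0 by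
  convention.\<close>

lemma norm_integral_le_nn_integral:
  fixes f :: "'a \<Rightarrow> 'b::{banach, second_countable_topology}"
  shows "ennreal (norm (integral\<^sup>L M f)) \<le> (\<integral>\<^sup>+x. ennreal (norm (f x)) \<partial>M)"
  by (cases "integrable M f") (auto simp: not_integrable_integral_eq integral_norm_bound_ennreal)

lemma norm_semigroup_integral_le:
  "(\<integral>\<^sup>+t. ennreal (norm (indicat_real {0<..} t *\<^sub>R (semigroup_integral k t f x * complex_of_real (t powr (\<gamma> / 2 - 1))))) \<partial>lebesgue)
    \<le> absolute_potential k \<gamma> f x"
  unfolding absolute_potential_def nn_integral_completion
proof (intro nn_integral_mono)
  fix t :: real
  have "ennreal (norm (semigroup_integral k t f x)) \<le> (\<integral>\<^sup>+y. ennreal (norm (k t x y * f y)) \<partial>lborel)"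
    using norm_integral_le_nn_integral[of lebesgue "\<lambda>y. k t x y * f y"]
    by (simp only: semigroup_integral_def nn_integral_completion)
  then have "ennreal (norm (semigroup_integral k t f x)) * ennreal (t powr (\<gamma> / 2 - 1))
     \<le> (\<integral>\<^sup>+y. ennreal (norm (k t x y * f y)) \<partial>lborel) * ennreal (t powr (\<gamma> / 2 - 1))"
    by (rule mult_right_mono) simp
  then show "ennreal (norm (indicat_real {0<..} t *\<^sub>R (semigroup_integral k t f x * complex_of_real (t powr (\<gamma> / 2 - 1)))))
     \<le> (\<integral>\<^sup>+y. ennreal (norm (k t x y * f y)) \<partial>lborel) * ennreal (t powr (\<gamma> / 2 - 1)) * indicator {0<..} t"
    by (cases "t > 0") (simp_all add: norm_mult ennreal_mult)
qed

lemma norm_fractional_integral_le: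
  assumes \<gamma>: "\<gamma> > 0"
  shows "ennreal (norm (fractional_integral k \<gamma> f x)) \<le> ennreal (1 / Gamma (\<gamma> / 2)) * absolute_potential k \<gamma> f x"
proof -
  let ?g = "\<lambda>t. semigroup_integral k t f x * complex_of_real (t powr (\<gamma> / 2 - 1))"
  have G: "Gamma (\<gamma> / 2) > 0" using \<gamma> by (simp add: Gamma_real_pos)
  have "ennreal (norm (LINT t:{0<..}|lebesgue. ?g t)) \<le> absolute_potential k \<gamma> f x"
    unfolding set_lebesgue_integral_def
    by (rule order_trans[OF norm_integral_le_nn_integral norm_semigroup_integral_le])
  then have "ennreal (1 / Gamma (\<gamma> / 2)) * ennreal (norm (LINT t:{0<..}|lebesgue. ?g t)) \<le> ennreal (1 / Gamma (\<gamma> / 2)) * absolute_potential k \<gamma> f x"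
    by (rule mult_left_mono) simp
  then show ?thesis
    unfolding fractional_integral_def using G by (simp add: norm_mult norm_divide ennreal_mult[symmetric])
qed

section \<open>Measurability and almost everywhere convergence of the fractional integral\<close>

lemma completion_ex_borel_measurable_complex:
  fixes g :: "'a \<Rightarrow> complex"
  assumes [measurable]: "g \<in> borel_measurable (completion M)"
  obtains g' where "g' \<in> borel_measurable M" "AE x in M. g x = g' x"
proof -
  have "(\<lambda>x. Re (g x)) \<in> borel_measurable (completion M)" "(\<lambda>x. Im (g x)) \<in> borel_measurable (completion M)"
    by measurable
  from this[THEN completion_ex_borel_measurable_real] obtain a b
    where [measurable]: "a \<in> borel_measurable M" "b \<in> borel_measurable M"
      and "AE x in M. Re (g x) = a x" "AE x in M. Im (g x) = b x" by blast
  then have "AE x in M. g x = Complex (a x) (b x)"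
    by (auto elim!: eventually_elim2 simp: complex_eq_iff)
  moreover have "(\<lambda>x. Complex (a x) (b x)) = (\<lambda>x. complex_of_real (a x) + \<i> * complex_of_real (b x))"
    by (simp add: fun_eq_iff Complex_eq)
  then have "(\<lambda>x. Complex (a x) (b x)) \<in> borel_measurable M" by simp
  ultimately show ?thesis using that by blast
qed

text \<open>
  The kernel is only Lebesgue measurable jointly in (t, x, y), so its sections are handled through a Borel
  representative, for almost every x.
\<close>

lemma AE_lborel_triple_swap:
  assumes "AE p in (lborel :: ('a::euclidean_space \<times> 'b::euclidean_space \<times> 'c::euclidean_space) measure). P p"
  shows "AE x in lborel. AE t in lborel. AE y in lborel. P (t, x, y)"
proof -
  obtain N where N: "N \<in> null_sets lborel" "{p. \<not> P p} \<subseteq> N"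
    using assms by (auto simp: eventually_ae_filter)
  have meas: "N \<in> sets (lborel \<Otimes>\<^sub>M (lborel \<Otimes>\<^sub>M lborel))"
    unfolding lborel_prod using N(1) by (rule null_setsD2)
  then have [measurable]: "N \<in> sets (borel \<Otimes>\<^sub>M (borel \<Otimes>\<^sub>M borel))" by simp
  have sigma_finite: "sigma_finite_measure (lborel \<Otimes>\<^sub>M lborel :: ('b \<times> 'c) measure)"
    unfolding lborel_prod by (rule lborel.sigma_finite_measure_axioms)
  have "0 = emeasure (lborel \<Otimes>\<^sub>M (lborel \<Otimes>\<^sub>M lborel)) N"
    unfolding lborel_prod using N(1) by (rule null_setsD1[symmetric])
  also have "\<dots> = (\<integral>\<^sup>+p. indicator N p \<partial>(lborel \<Otimes>\<^sub>M (lborel \<Otimes>\<^sub>M lborel)))"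
    using meas by (rule nn_integral_indicator[symmetric])
  also have "\<dots> = (\<integral>\<^sup>+t. (\<integral>\<^sup>+z. indicator N (t, z) \<partial>(lborel \<Otimes>\<^sub>M lborel)) \<partial>lborel)"
    by (rule sigma_finite_measure.nn_integral_fst[OF sigma_finite, symmetric]) (use meas in measurable)
  also have "\<dots> = (\<integral>\<^sup>+t. (\<integral>\<^sup>+x. (\<integral>\<^sup>+y. indicator N (t, x, y) \<partial>lborel) \<partial>lborel) \<partial>lborel)"
    by (intro nn_integral_cong lborel.nn_integral_fst[symmetric]) measurable
  also have "\<dots> = (\<integral>\<^sup>+x. (\<integral>\<^sup>+t. (\<integral>\<^sup>+y. indicator N (t, x, y) \<partial>lborel) \<partial>lborel) \<partial>lborel)"
    by (rule lborel_pair.Fubini'[symmetric]) measurable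
  finally have "(\<integral>\<^sup>+x. (\<integral>\<^sup>+t. (\<integral>\<^sup>+y. indicator N (t, x, y) \<partial>lborel) \<partial>lborel) \<partial>lborel) = 0" by simp
  then have "AE x in lborel. (\<integral>\<^sup>+t. (\<integral>\<^sup>+y. indicator N (t, x, y) \<partial>lborel) \<partial>lborel) = 0"
    by (subst (asm) nn_integral_0_iff_AE) measurable
  then show ?thesis
  proof eventually_elim
    fix x assume "(\<integral>\<^sup>+t. (\<integral>\<^sup>+y. indicator N (t, x, y) \<partial>lborel) \<partial>lborel) = 0"
    then have "AE t in lborel. (\<integral>\<^sup>+y. indicator N (t, x, y) \<partial>lborel) = 0"
      by (subst (asm) nn_integral_0_iff_AE) measurable
    then show "AE t in lborel. AE y in lborel. P (t, x, y)"
    proof eventually_elim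
      fix t assume "(\<integral>\<^sup>+y. indicator N (t, x, y) \<partial>lborel) = 0"
      then have "AE y in lborel. indicator N (t, x, y) = (0 :: ennreal)"
        by (subst (asm) nn_integral_0_iff_AE) measurable
      then show "AE y in lborel. P (t, x, y)"
        using N(2) by (auto elim!: eventually_mono simp: indicator_def split: if_splits)
    qed
  qed
qed

text \<open>For almost every x the sections of the kernel and of f agree almost everywhere with
  those of the Borel representatives K and g. At these x both integrals can be computed from K and
  g, for which joint measurability gives measurable inner integrals; completeness of Lebesgue
  measure carries the result back.\<close>

lemma fractional_integral_regularity:
  fixes k :: "real \<Rightarrow> real^'n \<Rightarrow> real^'n \<Rightarrow> complex"
  assumes kernel: "has_kernel T k" and f: "f \<in> borel_measurable lebesgue"
  shows "fractional_integral k \<gamma> f \<in> borel_measurable lebesgue"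
    and "AE x in lborel. absolute_potential k \<gamma> f x < top \<longrightarrow> fractional_integral_converges k \<gamma> f x"
proof -
  \<comment> \<open>The kernel is measurable on t > 0 only; multiplying by the indicator of this
    open set gives a measurable function on the whole space.\<close>
  let ?S = "{0<..} \<times> UNIV :: (real \<times> (real^'n) \<times> (real^'n)) set"
  have "open ?S" by (intro open_Times) auto
  then have "?S \<in> sets lebesgue" by (intro sets_completionI_sets) simp
  moreover have "(\<lambda>(t, x, y). k t x y) \<in> borel_measurable (lebesgue_on ?S)"
    using kernel by (simp add: has_kernel_def)
  ultimately have "(\<lambda>p. indicat_real ?S p *\<^sub>R (case p of (t, x, y) \<Rightarrow> k t x y)) \<in> borel_measurable lebesgue"
    by (subst (asm) borel_measurable_restrict_space_iff) auto
  then obtain K where K [measurable]: "K \<in> borel_measurable lborel"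
    and K_eq: "AE p in lborel. indicat_real ?S p *\<^sub>R (case p of (t, x, y) \<Rightarrow> k t x y) = K p"
    by (rule completion_ex_borel_measurable_complex)
  obtain g where [measurable]: "g \<in> borel_measurable lborel" and g: "AE y in lborel. f y = g y"
    using f by (rule completion_ex_borel_measurable_complex)
  have [measurable]: "K \<in> borel_measurable (borel \<Otimes>\<^sub>M (borel \<Otimes>\<^sub>M borel))"
    using K by (simp add: borel_prod)
  define H where "H t x = (LINT y|lborel. K (t, x, y) * g y)" for t x
  have [measurable]: "(\<lambda>(t, x). H t x) \<in> borel_measurable (borel \<Otimes>\<^sub>M borel)"
    unfolding H_def by measurable
  define \<Phi> where "\<Phi> t x = indicat_real {0<..} t *\<^sub>R (H t x * complex_of_real (t powr (\<gamma> / 2 - 1)))" for t x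
  have \<Phi> [measurable]: "(\<lambda>(t, x). \<Phi> t x) \<in> borel_measurable (borel \<Otimes>\<^sub>M borel)"
    unfolding \<Phi>_def by measurable
  have "AE x in lborel. AE t in lborel. AE y in lborel. indicat_real ?S (t, x, y) *\<^sub>R k t x y = K (t, x, y)"
    using AE_lborel_triple_swap[OF K_eq] by simp
  then have *: "AE x in lborel. AE t in lborel. AE y in lborel. t > 0 \<longrightarrow> k t x y * f y = K (t, x, y) * g y"
  proof eventually_elim
    fix x assume "AE t in lborel. AE y in lborel. indicat_real ?S (t, x, y) *\<^sub>R k t x y = K (t, x, y)"
    then show "AE t in lborel. AE y in lborel. t > 0 \<longrightarrow> k t x y * f y = K (t, x, y) * g y"
    proof eventually_elim
      fix t :: real assume "AE y in lborel. indicat_real ?S (t, x, y) *\<^sub>R k t x y = K (t, x, y)"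
      with g show "AE y in lborel. t > 0 \<longrightarrow> k t x y * f y = K (t, x, y) * g y"
        by eventually_elim auto
    qed
  qed
  have time_slice: "AE t in lborel. indicat_real {0<..} t *\<^sub>R (semigroup_integral k t f x * complex_of_real (t powr (\<gamma> / 2 - 1))) = \<Phi> t x"
    if x: "AE t in lborel. AE y in lborel. t > 0 \<longrightarrow> k t x y * f y = K (t, x, y) * g y" for x
    using x
  proof eventually_elim
    fix t :: real assume t: "AE y in lborel. t > 0 \<longrightarrow> k t x y * f y = K (t, x, y) * g y"
    show "indicat_real {0<..} t *\<^sub>R (semigroup_integral k t f x * complex_of_real (t powr (\<gamma> / 2 - 1))) = \<Phi> t x"
    proof (cases "t > 0")
      case True
      then have eq: "AE y in lebesgue. K (t, x, y) * g y = k t x y * f y"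
        using t by (intro AE_completion) (auto elim!: eventually_mono)
      have m: "(\<lambda>y. K (t, x, y) * g y) \<in> borel_measurable lborel" by measurable
      have "semigroup_integral k t f x = (LINT y|lebesgue. K (t, x, y) * g y)"
        unfolding semigroup_integral_def using eq m
        by (intro integral_cong_AE borel_measurable_AE[OF measurable_completion[OF m] eq] measurable_completion)
           (auto elim!: eventually_mono)
      also have "\<dots> = H t x" unfolding H_def using m by (rule integral_completion)
      finally show ?thesis by (simp add: \<Phi>_def)
    qed (simp add: \<Phi>_def)
  qed
  have \<Phi>x: "(\<lambda>t. \<Phi> t x) \<in> borel_measurable lborel" for x by measurable
  have time_meas: "(\<lambda>t. indicat_real {0<..} t *\<^sub>R (semigroup_integral k t f x * complex_of_real (t powr (\<gamma> / 2 - 1)))) \<in> borel_measurable lebesgue"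
    if x: "AE t in lborel. AE y in lborel. t > 0 \<longrightarrow> k t x y * f y = K (t, x, y) * g y" for x
  proof (rule borel_measurable_AE[OF measurable_completion[OF \<Phi>x]])
    show "AE t in lebesgue. \<Phi> t x = indicat_real {0<..} t *\<^sub>R (semigroup_integral k t f x * complex_of_real (t powr (\<gamma> / 2 - 1)))"
      using time_slice[OF x] by (intro AE_completion) (auto elim!: eventually_mono)
  qed
  define F where "F x = complex_of_real (1 / Gamma (\<gamma> / 2)) * (LINT t|lborel. \<Phi> t x)" for x
  have F: "F \<in> borel_measurable lborel" unfolding F_def by measurable
  have "AE x in lborel. F x = fractional_integral k \<gamma> f x"
    using *
  proof eventually_elim
    fix x assume x: "AE t in lborel. AE y in lborel. t > 0 \<longrightarrow> k t x y * f y = K (t, x, y) * g y"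
    have "(LINT t:{0<..}|lebesgue. semigroup_integral k t f x * complex_of_real (t powr (\<gamma> / 2 - 1))) = (LINT t|lebesgue. \<Phi> t x)"
      unfolding set_lebesgue_integral_def
      using time_slice[OF x] by (intro integral_cong_AE time_meas[OF x] measurable_completion[OF \<Phi>x] AE_completion)
    also have "\<dots> = (LINT t|lborel. \<Phi> t x)" using \<Phi>x by (rule integral_completion)
    finally show "F x = fractional_integral k \<gamma> f x" by (simp add: F_def fractional_integral_def)
  qed
  then show "fractional_integral k \<gamma> f \<in> borel_measurable lebesgue"
    by (intro borel_measurable_AE[OF measurable_completion[OF F]] AE_completion)
  show "AE x in lborel. absolute_potential k \<gamma> f x < top \<longrightarrow> fractional_integral_converges k \<gamma> f x"
    using *
  proof (eventually_elim, intro impI)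
    fix x assume x: "AE t in lborel. AE y in lborel. t > 0 \<longrightarrow> k t x y * f y = K (t, x, y) * g y"
      and fin: "absolute_potential k \<gamma> f x < top"
    let ?I = "\<lambda>t. \<integral>\<^sup>+y. ennreal (norm (k t x y * f y)) \<partial>lborel"
    let ?J = "\<lambda>t. \<integral>\<^sup>+y. ennreal (norm (K (t, x, y) * g y)) \<partial>lborel"
    have IJ: "AE t in lborel. t > 0 \<longrightarrow> ?I t = ?J t"
      using x by eventually_elim (auto intro!: nn_integral_cong_AE elim!: eventually_mono)
    have "(\<integral>\<^sup>+t\<in>{0<..}. ?J t * ennreal (t powr (\<gamma> / 2 - 1)) \<partial>lborel) = absolute_potential k \<gamma> f x"
      unfolding absolute_potential_def using IJ
      by (intro nn_integral_cong_AE) (auto elim!: eventually_mono simp: indicator_def)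
    then have "AE t in lborel. ?J t * ennreal (t powr (\<gamma> / 2 - 1)) * indicator {0<..} t \<noteq> \<infinity>"
      using fin by (intro nn_integral_PInf_AE) auto
    then have "AE t in lborel. 0 < t \<longrightarrow> integrable lebesgue (\<lambda>y. k t x y * f y)"
      using x IJ
    proof (eventually_elim, intro impI)
      fix t :: real
      assume J: "?J t * ennreal (t powr (\<gamma> / 2 - 1)) * indicator {0<..} t \<noteq> \<infinity>"
        and y: "AE y in lborel. t > 0 \<longrightarrow> k t x y * f y = K (t, x, y) * g y"
        and t: "t > 0"
      then have eq: "AE y in lebesgue. K (t, x, y) * g y = k t x y * f y"
        by (intro AE_completion) (auto elim!: eventually_mono)
      have m: "(\<lambda>y. K (t, x, y) * g y) \<in> borel_measurable lborel" by measurable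
      \<comment> \<open>The factor t^(\<gamma>/2-1) is positive, so a finite product forces the
        inner integral to be finite.\<close>
      have "?J t < top" using J t by (auto simp: ennreal_mult_eq_top_iff less_top)
      then have "integrable lborel (\<lambda>y. K (t, x, y) * g y)"
        using m by (simp add: integrable_iff_bounded)
      then have "integrable lebesgue (\<lambda>y. K (t, x, y) * g y)"
        using m by (simp add: integrable_completion)
      then show "integrable lebesgue (\<lambda>y. k t x y * f y)"
        using eq by (rule integrable_cong_AE_imp[OF _ borel_measurable_AE[OF measurable_completion[OF m] eq]])
    qed
    then have "AE t in lebesgue. 0 < t \<longrightarrow> integrable lebesgue (\<lambda>y. k t x y * f y)"
      by (rule AE_completion)
    moreover have "set_integrable lebesgue {0<..} (\<lambda>t. semigroup_integral k t f x * complex_of_real (t powr (\<gamma> / 2 - 1)))"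
      unfolding set_integrable_def integrable_iff_bounded
    proof (intro conjI time_meas[OF x])
      have "(\<integral>\<^sup>+t. ennreal (norm (indicat_real {0<..} t *\<^sub>R (semigroup_integral k t f x * complex_of_real (t powr (\<gamma> / 2 - 1))))) \<partial>lebesgue)
         \<le> absolute_potential k \<gamma> f x"
        by (rule norm_semigroup_integral_le)
      also have "\<dots> < \<infinity>" using fin by simp
      finally show "(\<integral>\<^sup>+t. ennreal (norm (indicat_real {0<..} t *\<^sub>R (semigroup_integral k t f x * complex_of_real (t powr (\<gamma> / 2 - 1))))) \<partial>lebesgue) < \<infinity>" .
    qed
    ultimately show "fractional_integral_converges k \<gamma> f x"
      by (simp add: fractional_integral_converges_def)
  qed
qed

section \<open>The amalgam estimate\<close>

lemma (in dual_weights) nn_integral_ball_finite: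
  assumes [measurable]: "F \<in> borel_measurable borel"
    and fin: "(\<integral>\<^sup>+x\<in>ball y r. ennreal (u x) * epowr (F x) (1 / a) \<partial>lborel) < top"
  shows "(\<integral>\<^sup>+x\<in>ball y r. F x \<partial>lborel) < top"
proof -
  \<comment> \<open>F = (u F^q)^a v^b with a + b < 1, and a weighted geometric mean is below the sum\<close>
  have pointwise: "F x \<le> ennreal (u x) * epowr (F x) (1 / a) + ennreal (v x) + 1" for x
  proof (cases "F x")
    case (real t)
    define X where "X = u x * t powr (1 / a)"
    define M where "M = max 1 (max X (v x))"
    have X: "X \<ge> 0" using u_pos[of x] by (simp add: X_def)
    have "t = (u x powr a * v x powr b) * t" by (simp add: duality)
    also have "\<dots> = X powr a * v x powr b"
      using real a_pos by (simp add: X_def powr_mult powr_powr)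
    also have "\<dots> \<le> M powr a * M powr b"
      using X v_pos[of x] a_pos b_pos by (intro mult_mono powr_mono2) (auto simp: M_def)
    also have "\<dots> = M powr (a + b)" by (simp add: powr_add)
    also have "\<dots> \<le> M powr 1"
      using ab_less by (intro powr_mono) (auto simp: M_def)
    also have "\<dots> \<le> X + v x + 1" using X v_pos[of x] by (auto simp: M_def)
    finally have "ennreal t \<le> ennreal (X + v x + 1)" by (rule ennreal_leI)
    also have "\<dots> = ennreal X + ennreal (v x) + 1"
      using X v_pos[of x] by (simp add: ennreal_plus)
    also have "ennreal X = ennreal (u x) * epowr (F x) (1 / a)"
      using real u_pos[of x] a_pos by (simp add: X_def epowr_ennreal' ennreal_mult)
    finally show ?thesis using real by simp
  qed (use a_pos u_pos[of x] in \<open>simp add: ennreal_mult_top\<close>)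
  let ?B = "ball y r"
  have "(\<integral>\<^sup>+x\<in>?B. F x \<partial>lborel) \<le> (\<integral>\<^sup>+x. ennreal (u x) * epowr (F x) (1 / a) * indicator ?B x + ennreal (v x) * indicator ?B x + indicator ?B x \<partial>lborel)"
  proof (intro nn_integral_mono)
    fix x
    show "F x * indicator ?B x \<le> ennreal (u x) * epowr (F x) (1 / a) * indicator ?B x + ennreal (v x) * indicator ?B x + indicator ?B x"
      using pointwise[of x] by (cases "x \<in> ?B") auto
  qed
  also have "\<dots> = (\<integral>\<^sup>+x\<in>?B. ennreal (u x) * epowr (F x) (1 / a) \<partial>lborel) + emeasure V ?B + emeasure lborel ?B"
    by (simp add: nn_integral_add emeasure_density)
  also have "\<dots> < top"
    using fin v_finite[of y r] emeasure_lborel_ball_finite[of y r] by (simp add: ennreal_add_less_top)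
  finally show ?thesis .
qed

section \<open>Translation of the weighted norms to positive Borel representatives\<close>

lemma locally_integrable_measurable:
  fixes f :: "real^'n \<Rightarrow> 'b::euclidean_space"
  assumes "locally_integrable f"
  shows "f \<in> borel_measurable lebesgue"
proof (rule borel_measurable_LIMSEQ_metric)
  fix i :: nat
  show "(\<lambda>x. indicat_real (cball 0 (real i)) x *\<^sub>R f x) \<in> borel_measurable lebesgue"
    using assms compact_cball[of 0 "real i"] borel_measurable_integrable
    unfolding locally_integrable_def set_integrable_def by blast
next
  fix x :: "real^'n"
  obtain N :: nat where N: "norm x \<le> real N" using real_arch_simple by blast
  have "\<forall>\<^sub>F i in sequentially. indicat_real (cball 0 (real i)) x *\<^sub>R f x = f x"
    using eventually_ge_at_top[of N] by eventually_elim (use N in auto)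
  then show "(\<lambda>i. indicat_real (cball 0 (real i)) x *\<^sub>R f x) \<longlonglongrightarrow> f x"
    by (rule tendsto_eventually)
qed

lemma sets_weighted [simp]: "sets (weighted \<omega>) = sets lebesgue"
  by (simp add: weighted_def)

lemma nn_integral_weighted:
  assumes [measurable]: "\<omega> \<in> borel_measurable lebesgue" "g \<in> borel_measurable lebesgue"
  shows "(\<integral>\<^sup>+x. g x \<partial>weighted \<omega>) = (\<integral>\<^sup>+x. ennreal (\<omega> x) * g x \<partial>lborel)"
  by (simp add: weighted_def nn_integral_density nn_integral_completion)

lemma emeasure_weighted:
  assumes "\<omega> \<in> borel_measurable lebesgue" "\<omega>' \<in> borel_measurable borel" "AE x in lborel. \<omega> x = \<omega>' x"
    and E: "E \<in> sets borel"
  shows "emeasure (weighted \<omega>) E = emeasure (density lborel (\<lambda>x. ennreal (\<omega>' x))) E"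
proof -
  have "E \<in> sets lebesgue" using E by (simp add: sets_completionI_sets)
  then have "emeasure (weighted \<omega>) E = (\<integral>\<^sup>+x. ennreal (\<omega> x) * indicator E x \<partial>lborel)"
    using assms(1) by (simp add: weighted_def emeasure_density nn_integral_completion)
  also have "\<dots> = (\<integral>\<^sup>+x. ennreal (\<omega>' x) * indicator E x \<partial>lborel)"
    using assms(3) by (intro nn_integral_cong_AE) (auto elim!: eventually_mono)
  finally show ?thesis using assms(2) E by (simp add: emeasure_density)
qed

lemma Lnorm_weighted:
  fixes f :: "real^'n \<Rightarrow> complex"
  assumes P: "P > 0" and \<omega>: "\<omega> \<in> borel_measurable lebesgue" "AE x in lborel. \<omega> x = \<omega>' x"
    and f: "f \<in> borel_measurable lebesgue" "AE x in lborel. ennreal (norm (f x)) = \<phi> x"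
  shows "Lnorm (ennreal P) (weighted \<omega>) (\<lambda>x. ennreal (norm (f x)) * indicator (ball y r) x)
    = epowr (\<integral>\<^sup>+x\<in>ball y r. ennreal (\<omega>' x) * epowr (\<phi> x) P \<partial>lborel) (1 / P)"
proof -
  have [measurable]: "ball y r \<in> sets lebesgue" by (simp add: sets_completionI_sets)
  note [measurable] = \<omega>(1) f(1)
  have "(\<integral>\<^sup>+x. epowr (ennreal (norm (f x)) * indicator (ball y r) x) P \<partial>weighted \<omega>)
     = (\<integral>\<^sup>+x. ennreal (\<omega> x) * epowr (ennreal (norm (f x)) * indicator (ball y r) x) P \<partial>lborel)"
    by (rule nn_integral_weighted) measurable
  also have "\<dots> = (\<integral>\<^sup>+x\<in>ball y r. ennreal (\<omega>' x) * epowr (\<phi> x) P \<partial>lborel)"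
  proof (rule nn_integral_cong_AE, use \<omega>(2) f(2) in eventually_elim)
    fix x assume "\<omega> x = \<omega>' x" "ennreal (norm (f x)) = \<phi> x"
    then show "ennreal (\<omega> x) * epowr (ennreal (norm (f x)) * indicator (ball y r) x) P = ennreal (\<omega>' x) * epowr (\<phi> x) P * indicator (ball y r) x"
      using P by (cases "x \<in> ball y r") auto
  qed
  finally show ?thesis using P by (simp add: Lnorm_def)
qed

text \<open>w' is a Borel version of w, reset to 1 on the null set where that version is not
  positive. Finiteness of both masses on balls is extracted from the A condition itself: both are
  positive, so if one were infinite the product would be infinite too.\<close>

lemma A_weight_dual_weights:
  fixes w :: "real^'n \<Rightarrow> real"
  assumes A: "A_weight p q w" and p: "p > 1" and q: "q > 0" and less: "1 / q < 1 / p"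
  obtains w' C where "w' \<in> borel_measurable borel" "\<And>x. w' x > 0" "AE x in lborel. w x = w' x"
    and "dual_weights (\<lambda>x. w' x powr q) (\<lambda>x. w' x powr (- (p / (p - 1)))) (1 / q) (1 - 1 / p) C"
proof -
  have w_meas: "w \<in> borel_measurable lebesgue"
    using A by (auto simp: A_weight_def weight_def intro: locally_integrable_measurable)
  obtain w0 where [measurable]: "w0 \<in> borel_measurable lborel" and w0: "AE x in lborel. w x = w0 x"
    using completion_ex_borel_measurable_real[OF w_meas] by blast
  define w' where "w' x = (if w0 x > 0 then w0 x else 1)" for x
  have w'_meas [measurable]: "w' \<in> borel_measurable borel"
    unfolding w'_def by measurable
  have w'_pos: "w' x > 0" for x by (simp add: w'_def)
  have "AE x in lborel. 0 < w x" using A by (simp add: A_weight_def AE_completion_iff)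
  with w0 have w': "AE x in lborel. w x = w' x"
    by eventually_elim (auto simp: w'_def)
  define p' where "p' = p / (p - 1)"
  have p': "p' > 0" "1 / p' = 1 - 1 / p" using p by (auto simp: p'_def field_simps)
  let ?u = "\<lambda>x. w' x powr q" and ?v = "\<lambda>x. w' x powr (- p')"
  let ?U = "density lborel (\<lambda>x. ennreal (?u x))" and ?V = "density lborel (\<lambda>x. ennreal (?v x))"
  obtain C where C: "C > 0" and bound: "\<And>y r. r > 0 \<Longrightarrow>
      epowr (emeasure (weighted (\<lambda>x. w x powr q)) (ball y r) / emeasure lebesgue (ball y r)) (1 / q) *
        epowr (emeasure (weighted (\<lambda>x. w x powr (- p'))) (ball y r) / emeasure lebesgue (ball y r)) (1 / p') \<le> ennreal C"
    using A unfolding A_weight_def p'_def by blast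
  have eq: "emeasure (weighted (\<lambda>x. w x powr e)) (ball y r) = emeasure (density lborel (\<lambda>x. ennreal (w' x powr e))) (ball y r)" for e y r
    using w_meas w' by (intro emeasure_weighted) (auto elim!: eventually_mono)
  have AP: "emeasure ?U (ball y r) < top \<and> emeasure ?V (ball y r) < top \<and>
      measure ?U (ball y r) powr (1 / q) * measure ?V (ball y r) powr (1 / p') \<le> C * measure lborel (ball y r) powr (1 / q + 1 / p')"
    if r: "r > 0" for y r
  proof -
    let ?m = "measure lborel (ball y r)"
    have L: "emeasure lborel (ball y r) = ennreal ?m"
      using emeasure_lborel_ball_finite[of y r] by (intro emeasure_eq_ennreal_measure) auto
    have m: "?m > 0" using r by simp
    have b: "epowr (emeasure ?U (ball y r) / ennreal ?m) (1 / q) * epowr (emeasure ?V (ball y r) / ennreal ?m) (1 / p') \<le> ennreal C"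
      using bound[OF r, of y] unfolding eq by (simp add: L emeasure_completion)
    have pos: "emeasure ?U (ball y r) > 0" "emeasure ?V (ball y r) > 0"
      using m w'_pos by (auto intro!: emeasure_density_pos simp: L less_imp_neq[symmetric])
    \<comment> \<open>Excludes the product of 0 and \<infinity>, which is 0 in
      \<open>ennreal\<close> and would hide an infinite mass.\<close>
    have nz: "epowr (emeasure ?U (ball y r) / ennreal ?m) (1 / q) \<noteq> 0" "epowr (emeasure ?V (ball y r) / ennreal ?m) (1 / p') \<noteq> 0"
      using pos q p'(1) by (subst epowr_eq_0_iff; simp)+
    have U_fin: "emeasure ?U (ball y r) \<noteq> top"
    proof
      assume "emeasure ?U (ball y r) = top"
      then have "top * epowr (emeasure ?V (ball y r) / ennreal ?m) (1 / p') \<le> ennreal C"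
        using b q by (simp add: ennreal_top_divide)
      then show False
        using nz(2) by (simp add: ennreal_top_mult top_unique)
    qed
    have V_fin: "emeasure ?V (ball y r) \<noteq> top"
    proof
      assume "emeasure ?V (ball y r) = top"
      then have "epowr (emeasure ?U (ball y r) / ennreal ?m) (1 / q) * top \<le> ennreal C"
        using b p'(1) by (simp add: ennreal_top_divide)
      then show False
        using nz(1) by (simp add: ennreal_mult_top top_unique)
    qed
    have UV: "emeasure ?U (ball y r) = ennreal (measure ?U (ball y r))" "emeasure ?V (ball y r) = ennreal (measure ?V (ball y r))"
      using U_fin V_fin by (auto intro: emeasure_eq_ennreal_measure)
    have "(measure ?U (ball y r) / ?m) powr (1 / q) * (measure ?V (ball y r) / ?m) powr (1 / p') \<le> C"
      using b C m p'(1) q unfolding UV by (simp add: divide_ennreal epowr_ennreal' ennreal_mult[symmetric])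
    then have "measure ?U (ball y r) powr (1 / q) * measure ?V (ball y r) powr (1 / p') \<le> C * (?m powr (1 / q) * ?m powr (1 / p'))"
      using m by (simp add: powr_divide field_simps)
    then show ?thesis using U_fin V_fin by (simp add: powr_add less_top)
  qed
  show ?thesis
  proof (rule that[OF w'_meas w'_pos w'])
    show "dual_weights (\<lambda>x. w' x powr q) (\<lambda>x. w' x powr (- (p / (p - 1)))) (1 / q) (1 - 1 / p) C"
      unfolding p'_def[symmetric] p'(2)[symmetric]
    proof
      fix x :: "real^'n" and r :: real
      show "emeasure ?U (ball x r) < top" "emeasure ?V (ball x r) < top"
        using AP[of r x] by (cases "r > 0"; simp add: not_less ball_empty)+
      show "(w' x powr q) powr (1 / q) * (w' x powr (- p')) powr (1 / p') = 1"
      proof -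
        have "q * (1 / q) = 1" "- p' * (1 / p') = - 1" using q p'(1) by auto
        then have "(w' x powr q) powr (1 / q) * (w' x powr (- p')) powr (1 / p') = w' x powr 1 * w' x powr (- 1)"
          by (simp only: powr_powr)
        also have "\<dots> = 1" using w'_pos[of x] by (simp add: powr_minus)
        finally show ?thesis .
      qed
      show "0 < r \<Longrightarrow> measure ?U (ball x r) powr (1 / q) * measure ?V (ball x r) powr (1 / p') \<le> C * measure lborel (ball x r) powr (1 / q + 1 / p')"
        using AP by blast
    qed (use w'_pos p q p' C less in \<open>auto simp: less_imp_neq[symmetric]\<close>)
  qed
qed

theorem corollary3p3:
  fixes D :: "(real^'n \<Rightarrow> complex) set"
    and L :: "(real^'n \<Rightarrow> complex) \<Rightarrow> (real^'n \<Rightarrow> complex)"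
    and T :: "complex \<Rightarrow> (real^'n \<Rightarrow> complex) \<Rightarrow> (real^'n \<Rightarrow> complex)"
    and k :: "real \<Rightarrow> real^'n \<Rightarrow> real^'n \<Rightarrow> complex"
    and \<gamma> p q \<alpha> \<beta> :: real
    and s :: ennreal
    and w \<mu> :: "real^'n \<Rightarrow> real"
  assumes "linear_operator D L"
    and "generates_analytic_semigroup D L T"
    and "has_kernel T k"
    and "gaussian_upper_bound k"
    and "0 < \<gamma>" "\<gamma> < real CARD('n)"
    and "1 < p" "p < real CARD('n) / \<gamma>"
    and "1 / q = 1 / p - \<gamma> / real CARD('n)"
    and "A_weight p q w"
    and "p \<le> \<alpha>" "\<alpha> < \<beta>" "ennreal \<beta> < s"
    and "1 / \<beta> = 1 / \<alpha> - \<gamma> / real CARD('n)"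
    and "doubling_weight \<mu>"
  shows "\<exists>C::real. 0 < C \<and>
    (\<forall>f \<in> amalgam_space (ennreal p) s (ennreal \<alpha>) (\<lambda>x. w x powr p) (\<lambda>x. w x powr q) \<mu>.
       (AE x in lebesgue. fractional_integral_converges k \<gamma> f x) \<and>
       fractional_integral k \<gamma> f
         \<in> amalgam_space (ennreal q) s (ennreal \<beta>) (\<lambda>x. w x powr q) (\<lambda>x. w x powr q) \<mu> \<and>
       amalgam_norm (ennreal q) s (ennreal \<beta>) (\<lambda>x. w x powr q) (\<lambda>x. w x powr q) \<mu>
           (fractional_integral k \<gamma> f)
         \<le> ennreal C *
           amalgam_norm (ennreal p) s (ennreal \<alpha>) (\<lambda>x. w x powr p) (\<lambda>x. w x powr q) \<mu> f)"
proof -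
  let ?n = "real CARD('n)"
  note p = \<open>1 < p\<close>
  have \<gamma>: "0 < \<gamma>" "\<gamma> < ?n" by fact+
  have "\<gamma> / ?n < 1 / p"
    using \<open>p < ?n / \<gamma>\<close> p \<gamma> by (simp add: field_simps)
  then have "1 / q > 0" using \<open>1 / q = 1 / p - \<gamma> / ?n\<close> by simp
  then have q: "q > 0" by simp
  have qp: "1 / q < 1 / p" using \<open>1 / q = 1 / p - \<gamma> / ?n\<close> \<gamma> by simp
  have \<alpha>\<beta>: "\<alpha> > 0" "\<beta> > 1" "\<beta> > 0" using p \<open>p \<le> \<alpha>\<close> \<open>\<alpha> < \<beta>\<close> by auto
  have s1: "1 \<le> s"
  proof (rule order_trans)
    show "1 \<le> ennreal \<beta>" using \<alpha>\<beta> ennreal_leI[of 1 \<beta>] by simp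
    show "ennreal \<beta> \<le> s" using \<open>ennreal \<beta> < s\<close> by simp
  qed
  obtain w' C0 where w'_meas [measurable]: "w' \<in> borel_measurable borel" and w'_pos: "\<And>x. w' x > 0"
    and w': "AE x in lborel. w x = w' x"
    and dual: "dual_weights (\<lambda>x. w' x powr q) (\<lambda>x. w' x powr (- (p / (p - 1)))) (1 / q) (1 - 1 / p) C0"
    using A_weight_dual_weights[OF \<open>A_weight p q w\<close> p q qp] by blast
  define u where "u x = w' x powr q" for x
  define v where "v x = w' x powr (- (p / (p - 1)))" for x
  interpret dual_weights u v "1 / q" "1 - 1 / p" C0
    using dual unfolding u_def v_def .
  have sp: "sp = p" using p by (simp add: sp_def)
  have v_power: "v x powr (1 - sp) = w' x powr p" for x
  proof -
    have "- (p / (p - 1)) * (1 - p) = p" using p by (simp add: field_simps)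
    then show ?thesis unfolding v_def sp powr_powr by (simp only:)
  qed
  have dim: "real DIM(real^'n) * (1 / q + (1 - 1 / p)) = ?n - \<gamma>"
    using \<open>1 / q = 1 / p - \<gamma> / ?n\<close> by (simp add: field_simps)
  \<comment> \<open>The two exponents of w^q(B) in the amalgam norms, on the source and on the
    target side, both equal \<eta> - 1/q by the relations between p, q, \<alpha> and
    \<beta>.\<close>
  define \<eta> where "\<eta> = 1 / \<beta> - enn2real (1 / s)"
  have "enn2real (1 / s) < 1 / \<beta>"
  proof (cases s)
    case (real \<sigma>)
    then have "\<beta> < \<sigma>" using \<open>ennreal \<beta> < s\<close> \<alpha>\<beta> by (simp add: ennreal_less_iff)
    moreover have "1 / s = ennreal (1 / \<sigma>)"
      using real \<open>\<beta> < \<sigma>\<close> \<alpha>\<beta> divide_ennreal[of 1 \<sigma>] by simp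
    ultimately show ?thesis using \<alpha>\<beta> by (simp add: frac_less2)
  qed (use \<alpha>\<beta> in simp)
  then have \<eta>: "\<eta> > 0" by (simp add: \<eta>_def)
  have inverse_eq: "enn2real (1 / ennreal z) = 1 / z" if "z > 0" for z
    using that divide_ennreal[of 1 z] by simp
  have exponent_\<beta>: "enn2real (1 / ennreal \<beta>) - enn2real (1 / ennreal q) - enn2real (1 / s) = \<eta> - 1 / q"
    using \<alpha>\<beta> q by (simp add: inverse_eq \<eta>_def)
  have exponent_\<alpha>: "enn2real (1 / ennreal \<alpha>) - enn2real (1 / ennreal p) - enn2real (1 / s) = \<eta> - 1 / q"
    using \<alpha>\<beta> p \<open>1 / q = 1 / p - \<gamma> / ?n\<close> \<open>1 / \<beta> = 1 / \<alpha> - \<gamma> / ?n\<close> by (simp add: inverse_eq \<eta>_def)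
  have w_meas [measurable]: "w \<in> borel_measurable lebesgue"
    using \<open>A_weight p q w\<close> by (auto simp: A_weight_def weight_def intro: locally_integrable_measurable)
  have w_power: "AE x in lborel. w x powr e = w' x powr e" for e
    using w' by eventually_elim simp
  have ball_weight: "epowr (emeasure (weighted (\<lambda>x. w x powr q)) (ball y r)) e = ennreal (measure U (ball y r) powr e)" if "r > 0" for y r e
  proof -
    have "emeasure (weighted (\<lambda>x. w x powr q)) (ball y r) = emeasure U (ball y r)"
      unfolding u_def by (intro emeasure_weighted w_power) auto
    also have "\<dots> = ennreal (measure U (ball y r))"
      using u_finite[of y r] by (intro emeasure_eq_ennreal_measure) auto
    finally show ?thesis using ball_measure_pos(1)[OF that, of y] by (simp add: epowr_ennreal)
  qed
  obtain c S where c: "\<And>j::nat. c j \<ge> 0" "c sums S" "S > 0"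
    and local: "\<And>\<phi> y r. \<lbrakk>\<phi> \<in> borel_measurable borel; r > 0\<rbrakk> \<Longrightarrow>
      ennreal (measure U (ball y r) powr (\<eta> - 1 / q)) *
      epowr (\<integral>\<^sup>+x\<in>ball y r. ennreal (u x) * epowr (riesz (?n - \<gamma>) \<phi> x) q \<partial>lborel) (1 / q)
      \<le> (\<Sum>j. ennreal (c j) * (ennreal (measure U (ball y (2 ^ j * r)) powr (\<eta> - 1 / q)) * local_norm \<phi> y (2 ^ j * r)))"
    using weighted_local_riesz_bound[OF \<eta>] unfolding dim by (simp only: div_by_1 divide_divide_eq_right mult_1) blast
  obtain C1 where C1: "C1 > 0" and pointwise: "\<And>f \<phi> x. \<phi> \<in> borel_measurable borel \<Longrightarrow> (AE y in lborel. ennreal (norm (f y)) = \<phi> y) \<Longrightarrow>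
      absolute_potential k \<gamma> f x \<le> ennreal C1 * riesz (?n - \<gamma>) \<phi> x"
    by (rule absolute_potential_le_riesz[OF \<open>gaussian_upper_bound k\<close> \<gamma>]) (rule that)
  have Gamma_pos: "Gamma (\<gamma> / 2) > 0" using \<gamma> by (simp add: Gamma_real_pos)
  define C2 where "C2 = C1 / Gamma (\<gamma> / 2)"
  have C2: "C2 > 0" using C1 Gamma_pos by (simp add: C2_def)
  have ball_integral_meas [measurable]: "(\<lambda>y. \<integral>\<^sup>+x\<in>ball y r. g x \<partial>lborel) \<in> borel_measurable borel"
    if [measurable]: "g \<in> borel_measurable borel" for g :: "real^'n \<Rightarrow> ennreal" and r
    by measurable
  have ball_measure_meas [measurable]: "(\<lambda>y. measure U (ball y r)) \<in> borel_measurable borel" for r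
    unfolding measure_def by measurable
  have weighted_meas: "g \<in> borel_measurable (weighted \<mu>)" if "g \<in> borel_measurable borel" for g :: "real^'n \<Rightarrow> ennreal"
  proof -
    have "measurable (weighted \<mu>) borel = (measurable lebesgue borel :: (real^'n \<Rightarrow> ennreal) set)"
      by (rule measurable_cong_sets) simp_all
    moreover have "g \<in> measurable lebesgue borel"
      using that by (intro measurable_completion) simp
    ultimately show ?thesis by (simp only:)
  qed
  have \<mu>: "\<mu> \<in> borel_measurable lebesgue" "\<And>x. 0 \<le> \<mu> x" "\<not> (AE x in lebesgue. \<mu> x = 0)"
    using \<open>doubling_weight \<mu>\<close> by (auto simp: doubling_weight_def weight_def intro: locally_integrable_measurable)
  show ?thesis
  proof (intro exI[of _ "C2 * S"] conjI ballI)
    show "0 < C2 * S" using C2 c(3) by simp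
    fix f :: "real^'n \<Rightarrow> complex"
    let ?N = "amalgam_norm (ennreal p) s (ennreal \<alpha>) (\<lambda>x. w x powr p) (\<lambda>x. w x powr q) \<mu> f"
    let ?M = "amalgam_norm (ennreal q) s (ennreal \<beta>) (\<lambda>x. w x powr q) (\<lambda>x. w x powr q) \<mu> (fractional_integral k \<gamma> f)"
    assume "f \<in> amalgam_space (ennreal p) s (ennreal \<alpha>) (\<lambda>x. w x powr p) (\<lambda>x. w x powr q) \<mu>"
    then have "locally_integrable f" and N_fin: "?N < top" by (auto simp: amalgam_space_def)
    then have f: "f \<in> borel_measurable lebesgue" by (intro locally_integrable_measurable)
    obtain \<phi> where \<phi>_meas [measurable]: "\<phi> \<in> borel_measurable borel" and \<phi>: "AE x in lborel. ennreal (norm (f x)) = \<phi> x"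
      using completion_ex_borel_measurable[of "\<lambda>x. ennreal (norm (f x))" lborel] f by auto
    let ?I = "fractional_integral k \<gamma> f"
    note regularity = fractional_integral_regularity[OF \<open>has_kernel T k\<close> f, of \<gamma>]
    obtain \<psi> where \<psi>_meas [measurable]: "\<psi> \<in> borel_measurable borel" and \<psi>: "AE x in lborel. ennreal (norm (?I x)) = \<psi> x"
      using completion_ex_borel_measurable[of "\<lambda>x. ennreal (norm (?I x))" lborel] regularity(1) by auto
    have I_le: "ennreal (norm (?I x)) \<le> ennreal C2 * riesz (?n - \<gamma>) \<phi> x" for x
    proof -
      have "ennreal (norm (?I x)) \<le> ennreal (1 / Gamma (\<gamma> / 2)) * (ennreal C1 * riesz (?n - \<gamma>) \<phi> x)"
        by (rule order_trans[OF norm_fractional_integral_le[OF \<gamma>(1)]], rule mult_left_mono, rule pointwise[OF \<phi>_meas \<phi>]) simp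
      also have "\<dots> = ennreal C2 * riesz (?n - \<gamma>) \<phi> x"
        using C1 Gamma_pos by (subst ennreal_mult_mult) (auto simp: C2_def)
      finally show ?thesis .
    qed
    \<comment> \<open>The functions of y under the L^s norm: H for f, Q for its fractional integral,
      G for the potential in between. Then Q R \<le> C2 G R, and G R is at most the sum of the c j H
      (2^j R), each of which has norm at most that of f.\<close>
    define H where "H R y = ennreal (measure U (ball y R) powr (\<eta> - 1 / q)) * local_norm \<phi> y R" for R y
    define G where "G R y = ennreal (measure U (ball y R) powr (\<eta> - 1 / q)) *
      epowr (\<integral>\<^sup>+x\<in>ball y R. ennreal (u x) * epowr (riesz (?n - \<gamma>) \<phi> x) q \<partial>lborel) (1 / q)" for R y
    define Q where "Q R y = ennreal (measure U (ball y R) powr (\<eta> - 1 / q)) *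
      epowr (\<integral>\<^sup>+x\<in>ball y R. ennreal (u x) * epowr (\<psi> x) q \<partial>lborel) (1 / q)" for R y
    have meas [measurable]: "H R \<in> borel_measurable borel" "G R \<in> borel_measurable borel" "Q R \<in> borel_measurable borel" for R
      unfolding H_def G_def Q_def local_norm_def by measurable
    have N_eq: "?N = (SUP R\<in>{0<..}. Lnorm s (weighted \<mu>) (H R))"
      unfolding amalgam_norm_def
    proof (rule SUP_cong[OF refl])
      fix R :: real assume "R \<in> {0<..}"
      then have R: "R > 0" by simp
      have "Lnorm (ennreal p) (weighted (\<lambda>x. w x powr p)) (\<lambda>x. ennreal (norm (f x)) * indicator (ball y R) x) = local_norm \<phi> y R" for y
        unfolding local_norm_def v_power unfolding sp using p by (intro Lnorm_weighted w_power f \<phi>) auto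
      then show "Lnorm s (weighted \<mu>) (\<lambda>y. epowr (emeasure (weighted (\<lambda>x. w x powr q)) (ball y R))
          (enn2real (1 / ennreal \<alpha>) - enn2real (1 / ennreal p) - enn2real (1 / s)) *
        Lnorm (ennreal p) (weighted (\<lambda>x. w x powr p)) (\<lambda>x. ennreal (norm (f x)) * indicator (ball y R) x)) = Lnorm s (weighted \<mu>) (H R)"
        by (simp only: exponent_\<alpha> ball_weight[OF R] H_def[abs_def])
    qed
    have M_eq: "?M = (SUP R\<in>{0<..}. Lnorm s (weighted \<mu>) (Q R))"
      unfolding amalgam_norm_def
    proof (rule SUP_cong[OF refl])
      fix R :: real assume "R \<in> {0<..}"
      then have R: "R > 0" by simp
      have "Lnorm (ennreal q) (weighted (\<lambda>x. w x powr q)) (\<lambda>x. ennreal (norm (?I x)) * indicator (ball y R) x)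
        = epowr (\<integral>\<^sup>+x\<in>ball y R. ennreal (u x) * epowr (\<psi> x) q \<partial>lborel) (1 / q)" for y
        unfolding u_def using q by (intro Lnorm_weighted w_power regularity(1) \<psi>) auto
      then show "Lnorm s (weighted \<mu>) (\<lambda>y. epowr (emeasure (weighted (\<lambda>x. w x powr q)) (ball y R))
          (enn2real (1 / ennreal \<beta>) - enn2real (1 / ennreal q) - enn2real (1 / s)) *
        Lnorm (ennreal q) (weighted (\<lambda>x. w x powr q)) (\<lambda>x. ennreal (norm (?I x)) * indicator (ball y R) x)) = Lnorm s (weighted \<mu>) (Q R)"
        by (simp only: exponent_\<beta> ball_weight[OF R] Q_def[abs_def])
    qed
    have H_le: "Lnorm s (weighted \<mu>) (H R) \<le> ?N" if "R > 0" for R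
      unfolding N_eq using that by (intro SUP_upper) auto
    have G_le: "G R y \<le> (\<Sum>j. ennreal (c j) * H (2 ^ j * R) y)" if "R > 0" for R y
      unfolding G_def H_def using that by (intro local) auto
    have Q_le: "Q R y \<le> ennreal C2 * G R y" for R y
    proof -
      have "(\<integral>\<^sup>+x\<in>ball y R. ennreal (u x) * epowr (\<psi> x) q \<partial>lborel)
         \<le> (\<integral>\<^sup>+x. ennreal (C2 powr q) * (ennreal (u x) * epowr (riesz (?n - \<gamma>) \<phi> x) q * indicator (ball y R) x) \<partial>lborel)"
      proof (rule nn_integral_mono_AE, use \<psi> in eventually_elim)
        fix x assume "ennreal (norm (?I x)) = \<psi> x"
        then have "epowr (\<psi> x) q \<le> epowr (ennreal C2 * riesz (?n - \<gamma>) \<phi> x) q"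
          using I_le[of x] q by (intro epowr_mono) auto
        also have "\<dots> = ennreal (C2 powr q) * epowr (riesz (?n - \<gamma>) \<phi> x) q"
          using q C2 by (simp add: epowr_mult epowr_ennreal)
        finally have "ennreal (u x) * epowr (\<psi> x) q * indicator (ball y R) x
          \<le> ennreal (u x) * (ennreal (C2 powr q) * epowr (riesz (?n - \<gamma>) \<phi> x) q) * indicator (ball y R) x"
          by (intro mult_right_mono mult_left_mono) auto
        then show "ennreal (u x) * epowr (\<psi> x) q * indicator (ball y R) x
          \<le> ennreal (C2 powr q) * (ennreal (u x) * epowr (riesz (?n - \<gamma>) \<phi> x) q * indicator (ball y R) x)"
          by (simp only: mult_ac)
      qed
      also have "\<dots> = ennreal (C2 powr q) * (\<integral>\<^sup>+x\<in>ball y R. ennreal (u x) * epowr (riesz (?n - \<gamma>) \<phi> x) q \<partial>lborel)"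
        by (rule nn_integral_cmult) measurable
      finally have "epowr (\<integral>\<^sup>+x\<in>ball y R. ennreal (u x) * epowr (\<psi> x) q \<partial>lborel) (1 / q)
         \<le> epowr (ennreal (C2 powr q) * (\<integral>\<^sup>+x\<in>ball y R. ennreal (u x) * epowr (riesz (?n - \<gamma>) \<phi> x) q \<partial>lborel)) (1 / q)"
        using q by (intro epowr_mono) auto
      also have "\<dots> = ennreal C2 * epowr (\<integral>\<^sup>+x\<in>ball y R. ennreal (u x) * epowr (riesz (?n - \<gamma>) \<phi> x) q \<partial>lborel) (1 / q)"
        using q C2 by (simp add: epowr_mult epowr_ennreal powr_powr)
      finally have "Q R y \<le> ennreal (measure U (ball y R) powr (\<eta> - 1 / q)) *
         (ennreal C2 * epowr (\<integral>\<^sup>+x\<in>ball y R. ennreal (u x) * epowr (riesz (?n - \<gamma>) \<phi> x) q \<partial>lborel) (1 / q))"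
        unfolding Q_def by (rule mult_left_mono) simp
      then show ?thesis unfolding G_def by (simp only: mult_ac)
    qed
    have bound: "?M \<le> ennreal (C2 * S) * ?N"
      unfolding M_eq
    proof (rule SUP_least)
      fix R :: real assume "R \<in> {0<..}"
      then have R: "R > 0" by simp
      show "Lnorm s (weighted \<mu>) (Q R) \<le> ennreal (C2 * S) * ?N"
      proof (rule Lnorm_le_suminf[OF s1])
        show "(\<lambda>j. C2 * c j) sums (C2 * S)" using c(2) by (rule sums_mult)
        show "Q R y \<le> (\<Sum>j. ennreal (C2 * c j) * H (2 ^ j * R) y)" for y
        proof -
          have "Q R y \<le> ennreal C2 * (\<Sum>j. ennreal (c j) * H (2 ^ j * R) y)"
            using order_trans[OF Q_le mult_left_mono[OF G_le[OF R]]] by simp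
          also have "\<dots> = (\<Sum>j. ennreal (C2 * c j) * H (2 ^ j * R) y)"
            using C2 c(1) by (simp only: ennreal_suminf_cmult[symmetric] ennreal_mult_mult less_imp_le)
          finally show ?thesis .
        qed
      qed (use C2 c R H_le weighted_meas[OF meas(1)] weighted_meas[OF meas(3)] in auto)
    qed
    then show "?M \<le> ennreal (C2 * S) * ?N" .
    have G_norm: "Lnorm s (weighted \<mu>) (G R) < top" if R: "R > 0" for R
    proof -
      have "Lnorm s (weighted \<mu>) (G R) \<le> ennreal S * ?N"
        by (rule Lnorm_le_suminf[where h="\<lambda>j. H (2 ^ j * R)" and c=c, OF s1])
           (use c R H_le G_le weighted_meas[OF meas(1)] weighted_meas[OF meas(2)] in auto)
      also have "\<dots> < top" using N_fin by (simp add: ennreal_mult_less_top)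
      finally show ?thesis .
    qed
    \<comment> \<open>The estimate also yields convergence and local integrability. As \<mu> is not
      almost everywhere zero, its null sets are not everything, so some centre y0 has finite G at
      all integer radii at once, and the balls around y0 exhaust the space.\<close>
    have "AE y in weighted \<mu>. \<forall>m::nat. G (real (Suc m)) y < top"
      using G_norm by (subst AE_all_countable) (intro allI AE_finite_of_Lnorm[OF s1] weighted_meas meas(2), auto)
    moreover have "\<not> (AE y in weighted \<mu>. False)"
    proof
      assume "AE y in weighted \<mu>. False"
      then have "AE x in lebesgue. 0 < ennreal (\<mu> x) \<longrightarrow> False"
        using \<mu>(1) unfolding weighted_def by (subst (asm) AE_density) auto
      then have "AE x in lebesgue. \<mu> x = 0"
        by eventually_elim (use \<mu>(2) in \<open>auto simp: not_less intro: antisym\<close>)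
      with \<mu>(3) show False by blast
    qed
    ultimately obtain y0 where y0: "\<And>m::nat. G (real (Suc m)) y0 < top"
      using eventually_mono[of _ "ae_filter (weighted \<mu>)" "\<lambda>_. False"] by blast
    have riesz_local: "(\<integral>\<^sup>+x\<in>ball y0 (real (Suc m)). ennreal (u x) * epowr (riesz (?n - \<gamma>) \<phi> x) q \<partial>lborel) < top" for m
    proof -
      have "measure U (ball y0 (real (Suc m))) > 0" by (rule ball_measure_pos) simp
      then show ?thesis
        using y0[of m] q by (auto simp: G_def ennreal_mult_less_top epowr_less_top_iff epowr_eq_0_iff)
    qed
    \<comment> \<open>Turns the finite weighted q-th power integral on each ball into plain
      integrability of the potential there. This gives its finiteness almost everywhere, and later
      the local integrability of the image.\<close>
    have riesz_finite: "(\<integral>\<^sup>+x\<in>ball y0 (real (Suc m)). riesz (?n - \<gamma>) \<phi> x \<partial>lborel) < top" for m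
    proof (rule nn_integral_ball_finite)
      show "(\<integral>\<^sup>+x\<in>ball y0 (real (Suc m)). ennreal (u x) * epowr (riesz (?n - \<gamma>) \<phi> x) (1 / (1 / q)) \<partial>lborel) < top"
        using riesz_local[of m] by simp
    qed measurable
    have "AE x in lborel. \<forall>m. x \<in> ball y0 (real (Suc m)) \<longrightarrow> riesz (?n - \<gamma>) \<phi> x < top"
    proof (subst AE_all_countable, intro allI)
      fix m
      have "AE x in lborel. riesz (?n - \<gamma>) \<phi> x * indicator (ball y0 (real (Suc m))) x \<noteq> \<infinity>"
        using riesz_finite[of m] by (intro nn_integral_PInf_AE) auto
      then show "AE x in lborel. x \<in> ball y0 (real (Suc m)) \<longrightarrow> riesz (?n - \<gamma>) \<phi> x < top"
        by eventually_elim (auto simp: less_top)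
    qed
    then have "AE x in lborel. fractional_integral_converges k \<gamma> f x"
      using regularity(2)
    proof eventually_elim
      fix x assume fin: "\<forall>m. x \<in> ball y0 (real (Suc m)) \<longrightarrow> riesz (?n - \<gamma>) \<phi> x < top"
        and conv: "absolute_potential k \<gamma> f x < top \<longrightarrow> fractional_integral_converges k \<gamma> f x"
      obtain m :: nat where "dist y0 x < real m" using reals_Archimedean2 by blast
      then have "x \<in> ball y0 (real (Suc m))" by simp
      then have "riesz (?n - \<gamma>) \<phi> x < top" using fin by blast
      then have "ennreal C1 * riesz (?n - \<gamma>) \<phi> x < top" by (simp add: ennreal_mult_less_top)
      then show "fractional_integral_converges k \<gamma> f x"
        using conv pointwise[OF \<phi>_meas \<phi>, of x] by (auto intro: le_less_trans)
    qed
    then show "AE x in lebesgue. fractional_integral_converges k \<gamma> f x" by (rule AE_completion)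
    have "locally_integrable ?I"
      unfolding locally_integrable_def
    proof (intro allI impI)
      fix K :: "(real^'n) set" assume K: "compact K"
      then obtain B where B: "K \<subseteq> ball y0 B" using bounded_subset_ballD[OF compact_imp_bounded] by blast
      obtain m :: nat where "B < real m" using reals_Archimedean2 by blast
      with B have Km: "K \<subseteq> ball y0 (real (Suc m))" using subset_ball[of B "real (Suc m)" y0] by fastforce
      have "(\<integral>\<^sup>+x\<in>ball y0 (real (Suc m)). (ennreal C2 * riesz (?n - \<gamma>) \<phi> x) \<partial>lborel)
         = ennreal C2 * (\<integral>\<^sup>+x\<in>ball y0 (real (Suc m)). riesz (?n - \<gamma>) \<phi> x \<partial>lborel)"
        by (simp add: nn_integral_cmult mult.assoc)
      then have fin: "(\<integral>\<^sup>+x\<in>ball y0 (real (Suc m)). (ennreal C2 * riesz (?n - \<gamma>) \<phi> x) \<partial>lborel) < top"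
        using riesz_finite[of m] by (simp add: ennreal_mult_less_top)
      have "(\<integral>\<^sup>+x. ennreal (norm (indicat_real K x *\<^sub>R ?I x)) \<partial>lebesgue)
         \<le> (\<integral>\<^sup>+x\<in>ball y0 (real (Suc m)). (ennreal C2 * riesz (?n - \<gamma>) \<phi> x) \<partial>lborel)"
        unfolding nn_integral_completion
      proof (intro nn_integral_mono)
        fix x
        show "ennreal (norm (indicat_real K x *\<^sub>R ?I x)) \<le> ennreal C2 * riesz (?n - \<gamma>) \<phi> x * indicator (ball y0 (real (Suc m))) x"
          using I_le[of x] Km by (cases "x \<in> K") (auto simp: subset_iff)
      qed
      with fin have "(\<integral>\<^sup>+x. ennreal (norm (indicat_real K x *\<^sub>R ?I x)) \<partial>lebesgue) < \<infinity>" by simp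
      moreover have "K \<in> sets lebesgue" using K by (simp add: compact_imp_closed sets_completionI_sets borel_closed)
      ultimately show "?I absolutely_integrable_on K"
        unfolding set_integrable_def integrable_iff_bounded using regularity(1)
        by (intro conjI borel_measurable_scaleR borel_measurable_indicator) auto
    qed
    moreover have "?M < top"
      using bound N_fin by (auto simp: ennreal_mult_less_top intro: le_less_trans)
    ultimately show "?I \<in> amalgam_space (ennreal q) s (ennreal \<beta>) (\<lambda>x. w x powr q) (\<lambda>x. w x powr q) \<mu>"
      by (simp add: amalgam_space_def)
  qed
qed

end
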